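(* Let $d\ge1$, let $\mathcal{E}$ and $\mathcal{E}'$ be weakly idempotent complete exact categories, let $\mathcal{M}$ be a $d$-cluster tilting subcategory of $\mathcal{E}$ and $\mathcal{N}$ a $d$-cluster tilting subcategory of $\mathcal{E}'$, and assume we have an equivalence $\Phi\colon\mathcal{M}\xrightarrow{\cong}\mathcal{N}$ of $d$-exact categories (for the induced $d$-exact structures). Then there exists an exact equivalence $\Psi\colon\mathcal{E}\xrightarrow{\cong}\mathcal{E}'$ making the square formed by $\Phi$, $\Psi$ and the canonical inclusions $\mathcal{M}\to\mathcal{E}$, $\mathcal{N}\to\mathcal{E}'$ commutative, i.e. $\Psi|_{\mathcal{M}}$ equals $\Phi$ followed by the inclusion $\mathcal{N}\to\mathcal{E}'$.
   Context: Conventions: all categories and functors are additive; subcategories are full, closed under isomorphisms and finite direct sums. An additive category is weakly idempotent complete if every split epimorphism has a kernel. Exact categories are in the sense of Quillen, with conflations, inflations and deflations; an exact equivalence is a functor preserving conflations which is an equivalence of categories. A complex is acyclic if it is spliced from conflations. $\operatorname{Ext}$ denotes Yoneda Ext. A subcategory $\mathcal{M}$ of an exact category $\mathcal{E}$ is $d$-cluster tilting if it is generating (every $E\in\mathcal{E}$ admits a deflation $M\to E$ with $M\in\mathcal{M}$), cogenerating (every $E$ admits an inflation $E\to M$ with $M\in\mathcal{M}$), functorially finite, and $\mathcal{M}=\{E\in\mathcal{E}\mid\operatorname{Ext}^i_{\mathcal{E}}(E,\mathcal{M})=0,\ 0<i<d\}=\{E\in\mathcal{E}\mid\operatorname{Ext}^i_{\mathcal{E}}(\mathcal{M},E)=0,\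 0<i<d\}$. If $\mathcal{E}$ is weakly idempotent complete, the admissible $d$-exact sequences of the induced $d$-exact structure on $\mathcal{M}$ are the complexes $0\to M_{d+1}\to\cdots\to M_0\to0$ in $\mathcal{M}$ which are acyclic in $\mathcal{E}$. An equivalence of $d$-exact categories is a functor sending admissible $d$-exact sequences to admissible $d$-exact sequences and having a quasi-inverse with the same property. *)

theory Defs
  imports "HOL-Algebra.Group"
begin

section \<open>Additive categories\<close>

text \<open>
  Only the values of \<open>Hom\<close>, \<open>Ident\<close> and \<open>Zero\<close> at members of \<open>Obj\<close>, and those of
  \<open>Comp\<close> and \<open>Add\<close> at composable, respectively parallel, morphisms between members of
  \<open>Obj\<close>, are meaningful.  Composition is written in applicative order.
\<close>

record ('o, 'm) precat =
  Obj :: "'o set"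
  Hom :: "'o \<Rightarrow> 'o \<Rightarrow> 'm set"
  Comp :: "'m \<Rightarrow> 'm \<Rightarrow> 'm" (infixl "\<cdot>\<index>" 70)
  Ident :: "'o \<Rightarrow> 'm"
  Add :: "'m \<Rightarrow> 'm \<Rightarrow> 'm"
  Zero :: "'o \<Rightarrow> 'o \<Rightarrow> 'm"

locale category =
  fixes C :: "('o, 'm, 'x) precat_scheme" (structure)
  assumes Hom_disjoint:
      "\<lbrakk>A \<in> Obj C; B \<in> Obj C; A' \<in> Obj C; B' \<in> Obj C; f \<in> Hom C A B; f \<in> Hom C A' B'\<rbrakk>
        \<Longrightarrow> A = A' \<and> B = B'"
    and Ident_in_Hom: "A \<in> Obj C \<Longrightarrow> Ident C A \<in> Hom C A A"
    and Comp_in_Hom: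
      "\<lbrakk>A \<in> Obj C; B \<in> Obj C; D \<in> Obj C; f \<in> Hom C A B; g \<in> Hom C B D\<rbrakk>
        \<Longrightarrow> g \<cdot> f \<in> Hom C A D"
    and Comp_Ident_right: "\<lbrakk>A \<in> Obj C; B \<in> Obj C; f \<in> Hom C A B\<rbrakk> \<Longrightarrow> f \<cdot> Ident C A = f"
    and Comp_Ident_left: "\<lbrakk>A \<in> Obj C; B \<in> Obj C; f \<in> Hom C A B\<rbrakk> \<Longrightarrow> Ident C B \<cdot> f = f"
    and Comp_assoc:
      "\<lbrakk>A \<in> Obj C; B \<in> Obj C; D \<in> Obj C; G \<in> Obj C;
        f \<in> Hom C A B; g \<in> Hom C B D; h \<in> Hom C D G\<rbrakk> \<Longrightarrow> (h \<cdot> g) \<cdot> f = h \<cdot> (g \<cdot> f)"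

definition Hom_group :: "('o, 'm, 'x) precat_scheme \<Rightarrow> 'o \<Rightarrow> 'o \<Rightarrow> 'm monoid" where
  "Hom_group C A B = \<lparr>carrier = Hom C A B, monoid.mult = Add C, one = Zero C A B\<rparr>"

locale preadditive_category = category +
  assumes Hom_comm_group: "\<lbrakk>A \<in> Obj C; B \<in> Obj C\<rbrakk> \<Longrightarrow> comm_group (Hom_group C A B)"
    and Comp_Add_right:
      "\<lbrakk>A \<in> Obj C; B \<in> Obj C; D \<in> Obj C; f \<in> Hom C A B; f' \<in> Hom C A B; g \<in> Hom C B D\<rbrakk>
        \<Longrightarrow> g \<cdot> Add C f f' = Add C (g \<cdot> f) (g \<cdot> f')"
    and Comp_Add_left:
      "\<lbrakk>A \<in> Obj C; B \<in> Obj C; D \<in> Obj C; f \<in> Hom C A B; g \<in> Hom C B D; g' \<in> Hom C B D\<rbrakk>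
        \<Longrightarrow> Add C g g' \<cdot> f = Add C (g \<cdot> f) (g' \<cdot> f)"

definition zero_object :: "('o, 'm, 'x) precat_scheme \<Rightarrow> 'o \<Rightarrow> bool" where
  "zero_object C Z \<longleftrightarrow> Z \<in> Obj C \<and>
     (\<forall>A\<in>Obj C. is_singleton (Hom C A Z) \<and> is_singleton (Hom C Z A))"

definition direct_sum :: "('o, 'm, 'x) precat_scheme \<Rightarrow> 'o \<Rightarrow> 'o \<Rightarrow> 'o \<Rightarrow> bool" where
  "direct_sum C A B S \<longleftrightarrow> A \<in> Obj C \<and> B \<in> Obj C \<and> S \<in> Obj C \<and>
     (\<exists>i\<in>Hom C A S. \<exists>j\<in>Hom C B S. \<exists>p\<in>Hom C S A. \<exists>q\<in>Hom C S B.
        p \<cdot>\<^bsub>C\<^esub> i = Ident C A \<and> q \<cdot>\<^bsub>C\<^esub> j = Ident C B \<and>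
        p \<cdot>\<^bsub>C\<^esub> j = Zero C B A \<and> q \<cdot>\<^bsub>C\<^esub> i = Zero C A B \<and>
        Add C (i \<cdot>\<^bsub>C\<^esub> p) (j \<cdot>\<^bsub>C\<^esub> q) = Ident C S)"

locale additive_category = preadditive_category +
  assumes ex_zero_object: "\<exists>Z. zero_object C Z"
    and ex_direct_sum: "\<lbrakk>A \<in> Obj C; B \<in> Obj C\<rbrakk> \<Longrightarrow> \<exists>S. direct_sum C A B S"

definition isomorphism :: "('o, 'm, 'x) precat_scheme \<Rightarrow> 'o \<Rightarrow> 'o \<Rightarrow> 'm \<Rightarrow> bool" where
  "isomorphism C A B f \<longleftrightarrow> A \<in> Obj C \<and> B \<in> Obj C \<and> f \<in> Hom C A B \<and>
     (\<exists>g\<in>Hom C B A. g \<cdot>\<^bsub>C\<^esub> f = Ident C A \<and> f \<cdot>\<^bsub>C\<^esub> g = Ident C B)"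

text \<open>\<open>is_kernel C A B D i p\<close>: the morphism \<open>i : A \<rightarrow> B\<close> is a kernel of \<open>p : B \<rightarrow> D\<close>;
  \<open>is_cokernel C A B D i p\<close>: the morphism \<open>p : B \<rightarrow> D\<close> is a cokernel of \<open>i : A \<rightarrow> B\<close>.\<close>

definition is_kernel ::
    "('o, 'm, 'x) precat_scheme \<Rightarrow> 'o \<Rightarrow> 'o \<Rightarrow> 'o \<Rightarrow> 'm \<Rightarrow> 'm \<Rightarrow> bool" where
  "is_kernel C A B D i p \<longleftrightarrow> A \<in> Obj C \<and> B \<in> Obj C \<and> D \<in> Obj C \<and>
     i \<in> Hom C A B \<and> p \<in> Hom C B D \<and> p \<cdot>\<^bsub>C\<^esub> i = Zero C A D \<and>
     (\<forall>X\<in>Obj C. \<forall>g\<in>Hom C X B. p \<cdot>\<^bsub>C\<^esub> g = Zero C X D \<longrightarrow>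
        (\<exists>!h. h \<in> Hom C X A \<and> i \<cdot>\<^bsub>C\<^esub> h = g))"

definition is_cokernel ::
    "('o, 'm, 'x) precat_scheme \<Rightarrow> 'o \<Rightarrow> 'o \<Rightarrow> 'o \<Rightarrow> 'm \<Rightarrow> 'm \<Rightarrow> bool" where
  "is_cokernel C A B D i p \<longleftrightarrow> A \<in> Obj C \<and> B \<in> Obj C \<and> D \<in> Obj C \<and>
     i \<in> Hom C A B \<and> p \<in> Hom C B D \<and> p \<cdot>\<^bsub>C\<^esub> i = Zero C A D \<and>
     (\<forall>X\<in>Obj C. \<forall>g\<in>Hom C B X. g \<cdot>\<^bsub>C\<^esub> i = Zero C A X \<longrightarrow>
        (\<exists>!h. h \<in> Hom C D X \<and> h \<cdot>\<^bsub>C\<^esub> p = g))"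

definition weakly_idempotent_complete :: "('o, 'm, 'x) precat_scheme \<Rightarrow> bool" where
  "weakly_idempotent_complete C \<longleftrightarrow>
     (\<forall>B\<in>Obj C. \<forall>D\<in>Obj C. \<forall>p\<in>Hom C B D.
        (\<exists>s\<in>Hom C D B. p \<cdot>\<^bsub>C\<^esub> s = Ident C D) \<longrightarrow> (\<exists>A i. is_kernel C A B D i p))"

text \<open>\<open>is_pushout C A B A' B' i f i' f'\<close>: the square with \<open>i : A \<rightarrow> B\<close>, \<open>f : A \<rightarrow> A'\<close>,
  \<open>i' : A' \<rightarrow> B'\<close>, \<open>f' : B \<rightarrow> B'\<close> is a pushout.
  \<open>is_pullback C B' D' B D p' f' p f\<close>: the square with \<open>p' : B' \<rightarrow> D'\<close>, \<open>f' : B' \<rightarrow> B\<close>,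
  \<open>p : B \<rightarrow> D\<close>, \<open>f : D' \<rightarrow> D\<close> is a pullback.\<close>

definition is_pushout ::
    "('o, 'm, 'x) precat_scheme \<Rightarrow> 'o \<Rightarrow> 'o \<Rightarrow> 'o \<Rightarrow> 'o \<Rightarrow> 'm \<Rightarrow> 'm \<Rightarrow> 'm \<Rightarrow> 'm \<Rightarrow> bool"
  where
  "is_pushout C A B A' B' i f i' f' \<longleftrightarrow>
     A \<in> Obj C \<and> B \<in> Obj C \<and> A' \<in> Obj C \<and> B' \<in> Obj C \<and>
     i \<in> Hom C A B \<and> f \<in> Hom C A A' \<and> i' \<in> Hom C A' B' \<and> f' \<in> Hom C B B' \<and>
     f' \<cdot>\<^bsub>C\<^esub> i = i' \<cdot>\<^bsub>C\<^esub> f \<and>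
     (\<forall>X\<in>Obj C. \<forall>u\<in>Hom C B X. \<forall>v\<in>Hom C A' X. u \<cdot>\<^bsub>C\<^esub> i = v \<cdot>\<^bsub>C\<^esub> f \<longrightarrow>
        (\<exists>!h. h \<in> Hom C B' X \<and> h \<cdot>\<^bsub>C\<^esub> f' = u \<and> h \<cdot>\<^bsub>C\<^esub> i' = v))"

definition is_pullback ::
    "('o, 'm, 'x) precat_scheme \<Rightarrow> 'o \<Rightarrow> 'o \<Rightarrow> 'o \<Rightarrow> 'o \<Rightarrow> 'm \<Rightarrow> 'm \<Rightarrow> 'm \<Rightarrow> 'm \<Rightarrow> bool"
  where
  "is_pullback C B' D' B D p' f' p f \<longleftrightarrow>
     B' \<in> Obj C \<and> D' \<in> Obj C \<and> B \<in> Obj C \<and> D \<in> Obj C \<and>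
     p' \<in> Hom C B' D' \<and> f' \<in> Hom C B' B \<and> p \<in> Hom C B D \<and> f \<in> Hom C D' D \<and>
     p \<cdot>\<^bsub>C\<^esub> f' = f \<cdot>\<^bsub>C\<^esub> p' \<and>
     (\<forall>X\<in>Obj C. \<forall>u\<in>Hom C X B. \<forall>v\<in>Hom C X D'. p \<cdot>\<^bsub>C\<^esub> u = f \<cdot>\<^bsub>C\<^esub> v \<longrightarrow>
        (\<exists>!h. h \<in> Hom C X B' \<and> f' \<cdot>\<^bsub>C\<^esub> h = u \<and> p' \<cdot>\<^bsub>C\<^esub> h = v))"

section \<open>Functors\<close>

text \<open>Two functors out of \<open>C\<close> are identified (\<open>functor_eq\<close>) when they agree on the objects
  and the morphisms of \<open>C\<close>; the underlying HOL functions are total and their other values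
  carry no information.\<close>

record ('o, 'm, 'p, 'n) func =
  on_obj :: "'o \<Rightarrow> 'p"
  on_mor :: "'m \<Rightarrow> 'n"

definition additive_functor ::
    "('o, 'm, 'x) precat_scheme \<Rightarrow> ('p, 'n, 'y) precat_scheme \<Rightarrow> ('o, 'm, 'p, 'n) func \<Rightarrow> bool"
  where
  "additive_functor C D F \<longleftrightarrow>
     (\<forall>A\<in>Obj C. on_obj F A \<in> Obj D \<and> on_mor F (Ident C A) = Ident D (on_obj F A)) \<and>
     (\<forall>A\<in>Obj C. \<forall>B\<in>Obj C. \<forall>f\<in>Hom C A B. on_mor F f \<in> Hom D (on_obj F A) (on_obj F B)) \<and>
     (\<forall>A\<in>Obj C. \<forall>B\<in>Obj C. \<forall>G\<in>Obj C. \<forall>f\<in>Hom C A B. \<forall>g\<in>Hom C B G.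
        on_mor F (g \<cdot>\<^bsub>C\<^esub> f) = on_mor F g \<cdot>\<^bsub>D\<^esub> on_mor F f) \<and>
     (\<forall>A\<in>Obj C. \<forall>B\<in>Obj C. \<forall>f\<in>Hom C A B. \<forall>g\<in>Hom C A B.
        on_mor F (Add C f g) = Add D (on_mor F f) (on_mor F g))"

definition functor_eq ::
    "('o, 'm, 'x) precat_scheme \<Rightarrow> ('o, 'm, 'p, 'n) func \<Rightarrow> ('o, 'm, 'p, 'n) func \<Rightarrow> bool" where
  "functor_eq C F G \<longleftrightarrow>
     (\<forall>A\<in>Obj C. on_obj F A = on_obj G A) \<and>
     (\<forall>A\<in>Obj C. \<forall>B\<in>Obj C. \<forall>f\<in>Hom C A B. on_mor F f = on_mor G f)"

definition id_functor :: "('o, 'm, 'o, 'm) func" where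
  "id_functor = \<lparr>on_obj = (\<lambda>A. A), on_mor = (\<lambda>f. f)\<rparr>"

definition comp_functor ::
    "('p, 'n, 'q, 'k) func \<Rightarrow> ('o, 'm, 'p, 'n) func \<Rightarrow> ('o, 'm, 'q, 'k) func"
    (infixl "\<circ>\<^sub>F" 55) where
  "G \<circ>\<^sub>F F = \<lparr>on_obj = on_obj G \<circ> on_obj F, on_mor = on_mor G \<circ> on_mor F\<rparr>"

definition naturally_isomorphic ::
    "('o, 'm, 'x) precat_scheme \<Rightarrow> ('p, 'n, 'y) precat_scheme
      \<Rightarrow> ('o, 'm, 'p, 'n) func \<Rightarrow> ('o, 'm, 'p, 'n) func \<Rightarrow> bool" where
  "naturally_isomorphic C D F G \<longleftrightarrow>
     (\<exists>\<eta>. (\<forall>A\<in>Obj C. isomorphism D (on_obj F A) (on_obj G A) (\<eta> A)) \<and>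
          (\<forall>A\<in>Obj C. \<forall>B\<in>Obj C. \<forall>f\<in>Hom C A B.
             \<eta> B \<cdot>\<^bsub>D\<^esub> on_mor F f = on_mor G f \<cdot>\<^bsub>D\<^esub> \<eta> A))"

definition quasi_inverse ::
    "('o, 'm, 'x) precat_scheme \<Rightarrow> ('p, 'n, 'y) precat_scheme
      \<Rightarrow> ('o, 'm, 'p, 'n) func \<Rightarrow> ('p, 'n, 'o, 'm) func \<Rightarrow> bool" where
  "quasi_inverse C D F G \<longleftrightarrow> additive_functor C D F \<and> additive_functor D C G \<and>
     naturally_isomorphic C C (G \<circ>\<^sub>F F) id_functor \<and>
     naturally_isomorphic D D (F \<circ>\<^sub>F G) id_functor"

definition equivalence_of_categories ::
    "('o, 'm, 'x) precat_scheme \<Rightarrow> ('p, 'n, 'y) precat_scheme \<Rightarrow> ('o, 'm, 'p, 'n) func \<Rightarrow> bool"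
  where
  "equivalence_of_categories C D F \<longleftrightarrow> (\<exists>G. quasi_inverse C D F G)"

section \<open>Subcategories\<close>

text \<open>Subcategories are full, hence given by their set of objects.\<close>

definition subcategory :: "('o, 'm, 'x) precat_scheme \<Rightarrow> 'o set \<Rightarrow> bool" where
  "subcategory C M \<longleftrightarrow> M \<subseteq> Obj C \<and>
     (\<forall>A\<in>M. \<forall>B\<in>Obj C. (\<exists>f. isomorphism C A B f) \<longrightarrow> B \<in> M) \<and>
     (\<forall>Z. zero_object C Z \<longrightarrow> Z \<in> M) \<and>
     (\<forall>A\<in>M. \<forall>B\<in>M. \<forall>S. direct_sum C A B S \<longrightarrow> S \<in> M)"

definition full_subcat :: "('o, 'm, 'x) precat_scheme \<Rightarrow> 'o set \<Rightarrow> ('o, 'm) precat" where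
  "full_subcat C M =
     \<lparr>Obj = M, Hom = Hom C, Comp = Comp C, Ident = Ident C, Add = Add C, Zero = Zero C\<rparr>"

text \<open>The canonical inclusion of a full subcategory acts as the identity on objects and
  morphisms.\<close>

abbreviation inclusion :: "('o, 'm, 'o, 'm) func" where
  "inclusion \<equiv> id_functor"

definition contravariantly_finite :: "('o, 'm, 'x) precat_scheme \<Rightarrow> 'o set \<Rightarrow> bool" where
  "contravariantly_finite C M \<longleftrightarrow>
     (\<forall>A\<in>Obj C. \<exists>X\<in>M. \<exists>f\<in>Hom C X A.
        \<forall>Y\<in>M. \<forall>g\<in>Hom C Y A. \<exists>h\<in>Hom C Y X. f \<cdot>\<^bsub>C\<^esub> h = g)"

definition covariantly_finite :: "('o, 'm, 'x) precat_scheme \<Rightarrow> 'o set \<Rightarrow> bool" where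
  "covariantly_finite C M \<longleftrightarrow>
     (\<forall>A\<in>Obj C. \<exists>X\<in>M. \<exists>f\<in>Hom C A X.
        \<forall>Y\<in>M. \<forall>g\<in>Hom C A Y. \<exists>h\<in>Hom C X Y. h \<cdot>\<^bsub>C\<^esub> f = g)"

definition functorially_finite :: "('o, 'm, 'x) precat_scheme \<Rightarrow> 'o set \<Rightarrow> bool" where
  "functorially_finite C M \<longleftrightarrow> contravariantly_finite C M \<and> covariantly_finite C M"

section \<open>Exact categories\<close>

record ('o, 'm) excat = "('o, 'm) precat" +
  Conf :: "('m \<times> 'm) set"

definition inflation :: "('o, 'm, 'x) excat_scheme \<Rightarrow> 'm \<Rightarrow> bool" where
  "inflation C i \<longleftrightarrow> (\<exists>p. (i, p) \<in> Conf C)"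

definition deflation :: "('o, 'm, 'x) excat_scheme \<Rightarrow> 'm \<Rightarrow> bool" where
  "deflation C p \<longleftrightarrow> (\<exists>i. (i, p) \<in> Conf C)"

locale exact_category = additive_category C
  for C :: "('o, 'm, 'x) excat_scheme" (structure) +
  assumes Conf_kernel_cokernel_pair:
      "(i, p) \<in> Conf C \<Longrightarrow> \<exists>A B D. is_kernel C A B D i p \<and> is_cokernel C A B D i p"
    and Conf_isomorphic:
      "\<lbrakk>(i, p) \<in> Conf C;
        A \<in> Obj C; B \<in> Obj C; D \<in> Obj C; i \<in> Hom C A B; p \<in> Hom C B D;
        A' \<in> Obj C; B' \<in> Obj C; D' \<in> Obj C; i' \<in> Hom C A' B'; p' \<in> Hom C B' D';
        isomorphism C A A' a; isomorphism C B B' b; isomorphism C D D' c;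
        b \<cdot> i = i' \<cdot> a; c \<cdot> p = p' \<cdot> b\<rbrakk> \<Longrightarrow> (i', p') \<in> Conf C"
    and inflation_Ident: "A \<in> Obj C \<Longrightarrow> inflation C (Ident C A)"
    and deflation_Ident: "A \<in> Obj C \<Longrightarrow> deflation C (Ident C A)"
    and inflation_Comp:
      "\<lbrakk>A \<in> Obj C; B \<in> Obj C; D \<in> Obj C; i \<in> Hom C A B; j \<in> Hom C B D;
        inflation C i; inflation C j\<rbrakk> \<Longrightarrow> inflation C (j \<cdot> i)"
    and deflation_Comp:
      "\<lbrakk>A \<in> Obj C; B \<in> Obj C; D \<in> Obj C; p \<in> Hom C A B; q \<in> Hom C B D;
        deflation C p; deflation C q\<rbrakk> \<Longrightarrow> deflation C (q \<cdot> p)"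
    and inflation_pushout:
      "\<lbrakk>A \<in> Obj C; B \<in> Obj C; A' \<in> Obj C; i \<in> Hom C A B; f \<in> Hom C A A'; inflation C i\<rbrakk>
        \<Longrightarrow> \<exists>B' i' f'. is_pushout C A B A' B' i f i' f' \<and> inflation C i'"
    and deflation_pullback:
      "\<lbrakk>B \<in> Obj C; D \<in> Obj C; D' \<in> Obj C; p \<in> Hom C B D; f \<in> Hom C D' D; deflation C p\<rbrakk>
        \<Longrightarrow> \<exists>B' p' f'. is_pullback C B' D' B D p' f' p f \<and> deflation C p'"

definition exact_equivalence ::
    "('o, 'm, 'x) excat_scheme \<Rightarrow> ('p, 'n, 'y) excat_scheme \<Rightarrow> ('o, 'm, 'p, 'n) func \<Rightarrow> bool"
  where
  "exact_equivalence C D F \<longleftrightarrow> equivalence_of_categories C D F \<and>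
     (\<forall>(i, p) \<in> Conf C. (on_mor F i, on_mor F p) \<in> Conf D)"

definition generating :: "('o, 'm, 'x) excat_scheme \<Rightarrow> 'o set \<Rightarrow> bool" where
  "generating C M \<longleftrightarrow> (\<forall>A\<in>Obj C. \<exists>X\<in>M. \<exists>p\<in>Hom C X A. deflation C p)"

definition cogenerating :: "('o, 'm, 'x) excat_scheme \<Rightarrow> 'o set \<Rightarrow> bool" where
  "cogenerating C M \<longleftrightarrow> (\<forall>A\<in>Obj C. \<exists>X\<in>M. \<exists>i\<in>Hom C A X. inflation C i)"

section \<open>Acyclic complexes and Yoneda Ext\<close>

text \<open>
  A complex \<open>0 \<rightarrow> X n \<rightarrow> \<dots> \<rightarrow> X 0 \<rightarrow> 0\<close> is a pair \<open>(X, f)\<close> with \<open>f k : X (k + 1) \<rightarrow> X k\<close> for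
  \<open>k < n\<close>; the values \<open>X k\<close> for \<open>k > n\<close> and \<open>f k\<close> for \<open>k \<ge> n\<close> carry no information.
\<close>

type_synonym ('o, 'm) cplx = "(nat \<Rightarrow> 'o) \<times> (nat \<Rightarrow> 'm)"

definition is_complex :: "('o, 'm, 'x) precat_scheme \<Rightarrow> nat \<Rightarrow> ('o, 'm) cplx \<Rightarrow> bool" where
  "is_complex C n = (\<lambda>(X, f).
     (\<forall>k\<le>n. X k \<in> Obj C) \<and>
     (\<forall>k<n. f k \<in> Hom C (X (Suc k)) (X k)) \<and>
     (\<forall>k. Suc k < n \<longrightarrow> f k \<cdot>\<^bsub>C\<^esub> f (Suc k) = Zero C (X (Suc (Suc k))) (X k)))"

text \<open>The complex is spliced from conflations \<open>Z (k + 1) \<rightarrow> X k \<rightarrow> Z k\<close> for \<open>k = 0, \<dots>, n\<close>,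
  where the outermost objects \<open>Z 0\<close> and \<open>Z (n + 1)\<close> are zero because the complex is bounded.\<close>

definition acyclic_complex :: "('o, 'm, 'x) excat_scheme \<Rightarrow> nat \<Rightarrow> ('o, 'm) cplx \<Rightarrow> bool" where
  "acyclic_complex C n = (\<lambda>(X, f).
     is_complex C n (X, f) \<and>
     (\<exists>Z \<iota> \<pi>. (\<forall>k\<le>Suc n. Z k \<in> Obj C) \<and>
        zero_object C (Z 0) \<and> zero_object C (Z (Suc n)) \<and>
        (\<forall>k\<le>n. \<iota> k \<in> Hom C (Z (Suc k)) (X k) \<and> \<pi> k \<in> Hom C (X k) (Z k) \<and>
                (\<iota> k, \<pi> k) \<in> Conf C) \<and>
        (\<forall>k<n. f k = \<iota> k \<cdot>\<^bsub>C\<^esub> \<pi> (Suc k))))"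

text \<open>
  For \<open>n \<ge> 1\<close>, an \<open>n\<close>-extension of \<open>A\<close> by \<open>B\<close> is an acyclic complex
  \<open>0 \<rightarrow> B \<rightarrow> X n \<rightarrow> \<dots> \<rightarrow> X 1 \<rightarrow> A \<rightarrow> 0\<close>.  The set underlying the Yoneda Ext group
  \<open>Ext\<^sup>n(A, B)\<close> is the quotient by the equivalence relation generated by the chain maps which are
  the identity on \<open>A\<close> and \<open>B\<close>.
\<close>

definition extensions :: "('o, 'm, 'x) excat_scheme \<Rightarrow> nat \<Rightarrow> 'o \<Rightarrow> 'o \<Rightarrow> ('o, 'm) cplx set" where
  "extensions C n A B =
     {(X, f). acyclic_complex C (Suc n) (X, f) \<and> X 0 = A \<and> X (Suc n) = B}"

definition extension_map ::
    "('o, 'm, 'x) excat_scheme \<Rightarrow> nat \<Rightarrow> 'o \<Rightarrow> 'o \<Rightarrow> (('o, 'm) cplx \<times> ('o, 'm) cplx) set" where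
  "extension_map C n A B =
     {((X, f), (Y, g)). (X, f) \<in> extensions C n A B \<and> (Y, g) \<in> extensions C n A B \<and>
        (\<exists>\<phi>. (\<forall>k\<le>Suc n. \<phi> k \<in> Hom C (X k) (Y k)) \<and>
             (\<forall>k\<le>n. \<phi> k \<cdot>\<^bsub>C\<^esub> f k = g k \<cdot>\<^bsub>C\<^esub> \<phi> (Suc k)) \<and>
             \<phi> 0 = Ident C A \<and> \<phi> (Suc n) = Ident C B)}"

definition yoneda_Ext ::
    "('o, 'm, 'x) excat_scheme \<Rightarrow> nat \<Rightarrow> 'o \<Rightarrow> 'o \<Rightarrow> ('o, 'm) cplx set set" where
  "yoneda_Ext C n A B =
     extensions C n A B // (extension_map C n A B \<union> (extension_map C n A B)\<inverse>)\<^sup>*"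

text \<open>A group is zero if and only if its underlying set has exactly one element.\<close>

definition Ext_zero :: "('o, 'm, 'x) excat_scheme \<Rightarrow> nat \<Rightarrow> 'o \<Rightarrow> 'o \<Rightarrow> bool" where
  "Ext_zero C n A B \<longleftrightarrow> is_singleton (yoneda_Ext C n A B)"

section \<open>Cluster tilting subcategories and their higher exact structure\<close>

definition cluster_tilting :: "nat \<Rightarrow> ('o, 'm, 'x) excat_scheme \<Rightarrow> 'o set \<Rightarrow> bool" where
  "cluster_tilting d C M \<longleftrightarrow>
     subcategory C M \<and> generating C M \<and> cogenerating C M \<and> functorially_finite C M \<and>
     M = {A \<in> Obj C. \<forall>i. 0 < i \<and> i < d \<longrightarrow> (\<forall>X\<in>M. Ext_zero C i A X)} \<and>
     M = {A \<in> Obj C. \<forall>i. 0 < i \<and> i < d \<longrightarrow> (\<forall>X\<in>M. Ext_zero C i X A)}"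

record ('o, 'm) dexcat = "('o, 'm) precat" +
  AdmSeq :: "('o, 'm) cplx set"

definition induced_dexact ::
    "nat \<Rightarrow> ('o, 'm, 'x) excat_scheme \<Rightarrow> 'o set \<Rightarrow> ('o, 'm) dexcat" where
  "induced_dexact d C M =
     \<lparr>Obj = M, Hom = Hom C, Comp = Comp C, Ident = Ident C, Add = Add C, Zero = Zero C,
      AdmSeq = {(X, f). is_complex (full_subcat C M) (Suc d) (X, f) \<and>
                        acyclic_complex C (Suc d) (X, f)}\<rparr>"

definition preserves_AdmSeq ::
    "('o, 'm, 'x) dexcat_scheme \<Rightarrow> ('p, 'n, 'y) dexcat_scheme \<Rightarrow> ('o, 'm, 'p, 'n) func \<Rightarrow> bool"
  where
  "preserves_AdmSeq C D F \<longleftrightarrow>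
     (\<forall>(X, f) \<in> AdmSeq C. (on_obj F \<circ> X, on_mor F \<circ> f) \<in> AdmSeq D)"

definition dexact_equivalence ::
    "('o, 'm, 'x) dexcat_scheme \<Rightarrow> ('p, 'n, 'y) dexcat_scheme \<Rightarrow> ('o, 'm, 'p, 'n) func \<Rightarrow> bool"
  where
  "dexact_equivalence C D F \<longleftrightarrow> preserves_AdmSeq C D F \<and>
     (\<exists>G. quasi_inverse C D F G \<and> preserves_AdmSeq D C G)"

end

theory Submission imports Defs begin

text \<open>An object \<open>A\<close> of \<open>E\<close> is determined by the functor \<open>Hom(-, A)\<close> restricted to \<open>M\<close>, because \<open>M\<close>
  is generating.  So it suffices to find, for every \<open>A\<close>, an object \<open>A'\<close> of \<open>E'\<close> with a natural
  isomorphism \<open>Hom(-, A) \<cong> Hom(\<Phi> -, A')\<close> on \<open>M\<close>, and to choose \<open>A' = \<Phi> A\<close> for \<open>A\<close> in \<open>M\<close>.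

  Resolutions by right \<open>M\<close>-approximations end after \<open>d - 1\<close> steps by dimension shifting, so a
  deflation between objects of \<open>M\<close> is the last map of an admissible \<open>d\<close>-exact sequence and is
  preserved by \<open>\<Phi>\<close>.  It follows that the isomorphisms \<open>Hom(-, D) \<cong> Hom(\<Phi> -, D')\<close> send deflations
  from objects of \<open>M\<close> to deflations: a map to \<open>D'\<close> is a deflation as soon as it admits local lifts
  of some cover, by weak idempotent completeness.  Hence, for a conflation \<open>A \<rightarrow> T \<rightarrow> D\<close> with \<open>T\<close> in
  \<open>M\<close> and \<open>D\<close> represented by \<open>D'\<close>, the kernel of the induced deflation \<open>\<Phi> T \<rightarrow> D'\<close> represents \<open>A\<close>,
  and finite coresolutions by \<open>M\<close> reach every object.  The same fact on deflations shows that the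
  resulting functor is exact; applied to a quasi-inverse of \<open>\<Phi>\<close> the construction gives essential
  surjectivity.\<close>

section \<open>Arrows in preadditive categories\<close>

text \<open>Yoneda Ext is here a set of complexes modulo zigzags, and an exact category need not
  have enough projectives. The way around this is refinement: a statement about a class becomes a
  statement about one extension after pulling back along further deflations. In this form the
  zigzags disappear, and the one fragment of the long exact sequence that dimension shifting needs
  is a diagram chase with pullbacks. Only resolutions, governed by the vanishing of
  Ext(\<open>M\<close>, -), are constructed; coresolutions are resolutions in the opposite exact
  category, which satisfies the same hypotheses. The number \<open>d - 1\<close> has two sources
  that must agree: it is the number of degrees \<open>0 < i < d\<close> in which Ext has to vanish
  for a syzygy to lie in \<open>M\<close>, and together with the given deflation it produces exactly
  the \<open>d + 2\<close> terms of an admissible \<open>d\<close>-exact sequence. Weak idempotent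
  completeness enters as cancellation: if \<open>p \<cdot> g\<close> is a deflation, so is
  \<open>p\<close>. This is what allows deflations to be tested on covers by objects of
  \<open>M\<close>.\<close>

context category
begin

definition ar :: "'m \<Rightarrow> 'o \<Rightarrow> 'o \<Rightarrow> bool" where
  "ar f A B \<longleftrightarrow> A \<in> Obj C \<and> B \<in> Obj C \<and> f \<in> Hom C A B"

definition arr :: "'m \<Rightarrow> bool" where
  "arr f \<longleftrightarrow> (\<exists>A B. ar f A B)"

definition dom :: "'m \<Rightarrow> 'o" where
  "dom f = (THE A. \<exists>B. ar f A B)"

definition cod :: "'m \<Rightarrow> 'o" where
  "cod f = (THE B. \<exists>A. ar f A B)"

lemma ar_unique: "ar f A B \<Longrightarrow> ar f A' B' \<Longrightarrow> A = A' \<and> B = B'"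
  unfolding ar_def using Hom_disjoint by blast

lemma ar_dom_cod: "ar f A B \<Longrightarrow> dom f = A \<and> cod f = B"
  unfolding dom_def cod_def using ar_unique by blast

text \<open>Typing judgements become equations for \<open>dom\<close> and \<open>cod\<close>, which
  the simplifier can rewrite with. The rule is deleted where \<open>ar f A B\<close> has to stay
  intact for matching.\<close>

lemma ar_iff [simp]: "ar f A B \<longleftrightarrow> arr f \<and> dom f = A \<and> cod f = B"
  using ar_dom_cod unfolding arr_def by metis

lemma ar_Obj: "ar f A B \<Longrightarrow> A \<in> Obj C \<and> B \<in> Obj C"
  unfolding ar_def by blast

lemma arI: "A \<in> Obj C \<Longrightarrow> B \<in> Obj C \<Longrightarrow> f \<in> Hom C A B \<Longrightarrow> ar f A B"
  unfolding ar_def by blast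

lemma arr_dom_Obj [simp]: "arr f \<Longrightarrow> dom f \<in> Obj C"
  and arr_cod_Obj [simp]: "arr f \<Longrightarrow> cod f \<in> Obj C"
  using ar_iff ar_def by metis+

lemma Ident_ar [simp]:
  assumes "A \<in> Obj C"
  shows "arr (Ident C A)" "dom (Ident C A) = A" "cod (Ident C A) = A"
  using assms Ident_in_Hom[OF assms] ar_iff ar_def by metis+

lemma comp_ar [simp]:
  assumes "arr f" "arr g" "dom g = cod f"
  shows "arr (g \<cdot> f)" "dom (g \<cdot> f) = dom f" "cod (g \<cdot> f) = cod g"
proof -
  have "ar f (dom f) (cod f)" "ar g (cod f) (cod g)" using assms by auto
  then have "ar (g \<cdot> f) (dom f) (cod g)" unfolding ar_def using Comp_in_Hom by blast
  then show "arr (g \<cdot> f)" "dom (g \<cdot> f) = dom f" "cod (g \<cdot> f) = cod g" by auto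
qed

lemma comp_Ident [simp]:
  "arr f \<Longrightarrow> dom f = A \<Longrightarrow> f \<cdot> Ident C A = f"
  "arr f \<Longrightarrow> cod f = B \<Longrightarrow> Ident C B \<cdot> f = f"
  using Comp_Ident_right Comp_Ident_left ar_iff ar_def by metis+

lemma assoc [simp]:
  assumes "arr f" "arr g" "arr h" "dom g = cod f" "dom h = cod g"
  shows "(h \<cdot> g) \<cdot> f = h \<cdot> (g \<cdot> f)"
proof -
  have "ar f (dom f) (cod f)" "ar g (cod f) (cod g)" "ar h (cod g) (cod h)" using assms by auto
  then show ?thesis unfolding ar_def using Comp_assoc by blast
qed

text \<open>Composites are normalised to right-nested form by \<open>assoc\<close>, where an
  equation for \<open>g \<cdot> f\<close> no longer matches inside a longer composite. This version
  does.\<close>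

lemma comp_ext:
  "g \<cdot> f = k \<Longrightarrow> arr f \<Longrightarrow> arr g \<Longrightarrow> arr x \<Longrightarrow> dom g = cod f \<Longrightarrow> dom f = cod x
    \<Longrightarrow> g \<cdot> (f \<cdot> x) = k \<cdot> x"
  by (metis assoc)

lemma isomorphism_iff:
  "isomorphism C A B f \<longleftrightarrow>
     ar f A B \<and> (\<exists>g. ar g B A \<and> g \<cdot> f = Ident C A \<and> f \<cdot> g = Ident C B)"
  unfolding isomorphism_def ar_def by blast

lemma isomorphism_Ident: "A \<in> Obj C \<Longrightarrow> isomorphism C A A (Ident C A)"
  unfolding isomorphism_iff by (intro conjI exI[of _ "Ident C A"]) auto

lemma isomorphism_inverse:
  assumes "isomorphism C A B f"
  obtains g where "isomorphism C B A g" "g \<cdot> f = Ident C A" "f \<cdot> g = Ident C B"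
    "ar g B A" "ar f A B"
  using assms unfolding isomorphism_iff by auto

end

section \<open>Addition, zero morphisms and universal properties in typed form\<close>

context preadditive_category
begin

abbreviation plus (infixl "\<oplus>" 65) where "f \<oplus> g \<equiv> Add C f g"

lemma add_facts:
  assumes "A \<in> Obj C" "B \<in> Obj C"
  shows "f \<in> Hom C A B \<Longrightarrow> g \<in> Hom C A B \<Longrightarrow> f \<oplus> g \<in> Hom C A B"
    and "f \<in> Hom C A B \<Longrightarrow> g \<in> Hom C A B \<Longrightarrow> h \<in> Hom C A B \<Longrightarrow> (f \<oplus> g) \<oplus> h = f \<oplus> (g \<oplus> h)"
    and "f \<in> Hom C A B \<Longrightarrow> g \<in> Hom C A B \<Longrightarrow> f \<oplus> g = g \<oplus> f"
    and "Zero C A B \<in> Hom C A B"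
    and "f \<in> Hom C A B \<Longrightarrow> Zero C A B \<oplus> f = f"
    and "f \<in> Hom C A B \<Longrightarrow> \<exists>g\<in>Hom C A B. g \<oplus> f = Zero C A B"
proof -
  interpret G: comm_group "Hom_group C A B" using Hom_comm_group assms by blast
  show "f \<in> Hom C A B \<Longrightarrow> g \<in> Hom C A B \<Longrightarrow> f \<oplus> g \<in> Hom C A B"
    using G.m_closed[of f g] by (simp add: Hom_group_def)
  show "f \<in> Hom C A B \<Longrightarrow> g \<in> Hom C A B \<Longrightarrow> h \<in> Hom C A B \<Longrightarrow> (f \<oplus> g) \<oplus> h = f \<oplus> (g \<oplus> h)"
    using G.m_assoc[of f g h] by (simp add: Hom_group_def)
  show "f \<in> Hom C A B \<Longrightarrow> g \<in> Hom C A B \<Longrightarrow> f \<oplus> g = g \<oplus> f"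
    using G.m_comm[of f g] by (simp add: Hom_group_def)
  show "Zero C A B \<in> Hom C A B" using G.one_closed by (simp add: Hom_group_def)
  show "f \<in> Hom C A B \<Longrightarrow> Zero C A B \<oplus> f = f" using G.l_one[of f] by (simp add: Hom_group_def)
  show "f \<in> Hom C A B \<Longrightarrow> \<exists>g\<in>Hom C A B. g \<oplus> f = Zero C A B"
    using G.l_inv_ex[of f] by (simp add: Hom_group_def)
qed

lemma add_ar [simp]:
  assumes "arr f" "arr g" "dom f = dom g" "cod f = cod g"
  shows "arr (f \<oplus> g)" "dom (f \<oplus> g) = dom g" "cod (f \<oplus> g) = cod g"
proof -
  have "ar f (dom g) (cod g)" "ar g (dom g) (cod g)" using assms by auto
  then have "ar (f \<oplus> g) (dom g) (cod g)" unfolding ar_def using add_facts(1) by blast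
  then show "arr (f \<oplus> g)" "dom (f \<oplus> g) = dom g" "cod (f \<oplus> g) = cod g" by auto
qed

lemma Zero_ar [simp]:
  assumes "A \<in> Obj C" "B \<in> Obj C"
  shows "arr (Zero C A B)" "dom (Zero C A B) = A" "cod (Zero C A B) = B"
  using assms add_facts(4)[OF assms] ar_iff ar_def by metis+

lemma add_assoc:
  "arr f \<Longrightarrow> arr g \<Longrightarrow> arr h \<Longrightarrow> dom f = dom g \<Longrightarrow> cod f = cod g \<Longrightarrow> dom g = dom h \<Longrightarrow> cod g = cod h
    \<Longrightarrow> (f \<oplus> g) \<oplus> h = f \<oplus> (g \<oplus> h)"
  using add_facts(2)[of "dom f" "cod f" f g h] ar_iff ar_def by metis

lemma add_commute:
  "arr f \<Longrightarrow> arr g \<Longrightarrow> dom f = dom g \<Longrightarrow> cod f = cod g \<Longrightarrow> f \<oplus> g = g \<oplus> f"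
  using add_facts(3)[of "dom f" "cod f" f g] ar_iff ar_def by metis

lemma add_Zero [simp]:
  "arr f \<Longrightarrow> dom f = A \<Longrightarrow> cod f = B \<Longrightarrow> Zero C A B \<oplus> f = f"
  "arr f \<Longrightarrow> dom f = A \<Longrightarrow> cod f = B \<Longrightarrow> f \<oplus> Zero C A B = f"
proof -
  show *: "arr f \<Longrightarrow> dom f = A \<Longrightarrow> cod f = B \<Longrightarrow> Zero C A B \<oplus> f = f"
    using add_facts(5)[of "dom f" "cod f" f] ar_iff ar_def by metis
  show "arr f \<Longrightarrow> dom f = A \<Longrightarrow> cod f = B \<Longrightarrow> f \<oplus> Zero C A B = f"
    using * add_commute[of f "Zero C A B"] by auto
qed

lemma ex_neg:
  assumes "arr f"
  obtains g where "arr g" "dom g = dom f" "cod g = cod f" "g \<oplus> f = Zero C (dom f) (cod f)"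
    "f \<oplus> g = Zero C (dom f) (cod f)"
proof -
  have f: "f \<in> Hom C (dom f) (cod f)" using assms ar_iff ar_def by metis
  obtain g where g: "g \<in> Hom C (dom f) (cod f)" "g \<oplus> f = Zero C (dom f) (cod f)"
    using add_facts(6)[OF _ _ f] assms by auto
  have "ar g (dom f) (cod f)" using g assms by (intro arI) auto
  then show ?thesis using g that[of g] add_commute[of f g] assms by auto
qed

lemma add_left_cancel:
  assumes "h \<oplus> f = h \<oplus> g" "arr f" "arr g" "arr h" "dom f = dom h" "dom g = dom h"
    "cod f = cod h" "cod g = cod h"
  shows "f = g"
proof -
  obtain n where n: "arr n" "dom n = dom h" "cod n = cod h" "n \<oplus> h = Zero C (dom h) (cod h)"
    using ex_neg[OF assms(4)] by metis
  have "(n \<oplus> h) \<oplus> f = (n \<oplus> h) \<oplus> g"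
    using assms n(1-3) by (simp add: add_assoc)
  then show ?thesis using n assms by simp
qed

lemma comp_add [simp]:
  "arr f \<Longrightarrow> arr f' \<Longrightarrow> arr g \<Longrightarrow> dom f = dom f' \<Longrightarrow> cod f = cod f' \<Longrightarrow> dom g = cod f'
    \<Longrightarrow> g \<cdot> (f \<oplus> f') = (g \<cdot> f) \<oplus> (g \<cdot> f')"
  "arr f \<Longrightarrow> arr g' \<Longrightarrow> arr g \<Longrightarrow> dom g = dom g' \<Longrightarrow> cod g = cod g' \<Longrightarrow> dom g' = cod f
    \<Longrightarrow> (g \<oplus> g') \<cdot> f = (g \<cdot> f) \<oplus> (g' \<cdot> f)"
proof -
  show "arr f \<Longrightarrow> arr f' \<Longrightarrow> arr g \<Longrightarrow> dom f = dom f' \<Longrightarrow> cod f = cod f' \<Longrightarrow> dom g = cod f'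
    \<Longrightarrow> g \<cdot> (f \<oplus> f') = (g \<cdot> f) \<oplus> (g \<cdot> f')"
    using Comp_Add_right[of "dom f'" "cod f'" "cod g" f f' g] ar_iff ar_def by metis
  show "arr f \<Longrightarrow> arr g' \<Longrightarrow> arr g \<Longrightarrow> dom g = dom g' \<Longrightarrow> cod g = cod g' \<Longrightarrow> dom g' = cod f
    \<Longrightarrow> (g \<oplus> g') \<cdot> f = (g \<cdot> f) \<oplus> (g' \<cdot> f)"
    using Comp_Add_left[of "dom f" "cod f" "cod g" f g g'] ar_iff ar_def by metis
qed

lemma comp_Zero [simp]:
  "arr g \<Longrightarrow> dom g = B \<Longrightarrow> A \<in> Obj C \<Longrightarrow> g \<cdot> Zero C A B = Zero C A (cod g)"
  "arr g \<Longrightarrow> cod g = B \<Longrightarrow> D \<in> Obj C \<Longrightarrow> Zero C B D \<cdot> g = Zero C (dom g) D"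
proof -
  assume "arr g" "dom g = B" "A \<in> Obj C"
  then have [simp]: "arr g" "dom g = B" "A \<in> Obj C" "B \<in> Obj C" by auto
  \<comment> \<open>A morphism \<open>x\<close> with \<open>x \<oplus> x = x \<oplus> 0\<close> is
    zero by cancellation.\<close>
  have "g \<cdot> Zero C A B \<oplus> g \<cdot> Zero C A B = g \<cdot> Zero C A B \<oplus> Zero C A (cod g)"
    using comp_add(1)[of "Zero C A B" "Zero C A B" g] by (simp del: comp_add)
  then show "g \<cdot> Zero C A B = Zero C A (cod g)" by (rule add_left_cancel) auto
next
  assume "arr g" "cod g = B" "D \<in> Obj C"
  then have [simp]: "arr g" "cod g = B" "D \<in> Obj C" "B \<in> Obj C" by auto
  have "Zero C B D \<cdot> g \<oplus> Zero C B D \<cdot> g = Zero C B D \<cdot> g \<oplus> Zero C (dom g) D"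
    using comp_add(2)[of g "Zero C B D" "Zero C B D"] by (simp del: comp_add)
  then show "Zero C B D \<cdot> g = Zero C (dom g) D" by (rule add_left_cancel) auto
qed

text \<open>Stands in for subtraction: later arguments write \<open>x = y \<oplus> z\<close> instead
  of naming negatives.\<close>

lemma ex_diff:
  assumes "ar x A B" "ar y A B"
  obtains z where "ar z A B" "x = y \<oplus> z"
proof -
  have y: "arr y" using assms by simp
  obtain n where n: "arr n" "dom n = dom y" "cod n = cod y" "y \<oplus> n = Zero C (dom y) (cod y)"
    using ex_neg[OF y] by metis
  have 1: "y \<oplus> (n \<oplus> x) = (y \<oplus> n) \<oplus> x" using n(1-3) assms by (simp add: add_assoc)
  have 2: "y \<oplus> (n \<oplus> x) = x" unfolding 1 n(4) using assms by simp
  show ?thesis using that[OF _ 2[symmetric]] n(1-3) assms by simp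
qed

lemma kernel_iff:
  "is_kernel C A B D i p \<longleftrightarrow> ar i A B \<and> ar p B D \<and> p \<cdot> i = Zero C A D \<and>
     (\<forall>X g. ar g X B \<longrightarrow> p \<cdot> g = Zero C X D \<longrightarrow> (\<exists>!h. ar h X A \<and> i \<cdot> h = g))"
proof (cases "A \<in> Obj C")
  case True
  then show ?thesis unfolding is_kernel_def ar_def by (auto; metis)
qed (auto simp: is_kernel_def ar_def simp del: ar_iff)

lemma cokernel_iff:
  "is_cokernel C A B D i p \<longleftrightarrow> ar i A B \<and> ar p B D \<and> p \<cdot> i = Zero C A D \<and>
     (\<forall>X g. ar g B X \<longrightarrow> g \<cdot> i = Zero C A X \<longrightarrow> (\<exists>!h. ar h D X \<and> h \<cdot> p = g))"
proof (cases "D \<in> Obj C")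
  case True
  then show ?thesis unfolding is_cokernel_def ar_def by (auto; metis)
qed (auto simp: is_cokernel_def ar_def simp del: ar_iff)

lemma pullback_iff:
  "is_pullback C B' D' B D p' f' p f \<longleftrightarrow> ar p' B' D' \<and> ar f' B' B \<and> ar p B D \<and> ar f D' D \<and>
     p \<cdot> f' = f \<cdot> p' \<and>
     (\<forall>X u v. ar u X B \<longrightarrow> ar v X D' \<longrightarrow> p \<cdot> u = f \<cdot> v \<longrightarrow>
        (\<exists>!h. ar h X B' \<and> f' \<cdot> h = u \<and> p' \<cdot> h = v))"
proof (cases "B' \<in> Obj C")
  case True
  then show ?thesis unfolding is_pullback_def ar_def by (auto; metis)
qed (auto simp: is_pullback_def ar_def simp del: ar_iff)

lemma pushout_iff:
  "is_pushout C A B A' B' i f i' f' \<longleftrightarrow> ar i A B \<and> ar f A A' \<and> ar i' A' B' \<and> ar f' B B' \<and>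
     f' \<cdot> i = i' \<cdot> f \<and>
     (\<forall>X u v. ar u B X \<longrightarrow> ar v A' X \<longrightarrow> u \<cdot> i = v \<cdot> f \<longrightarrow>
        (\<exists>!h. ar h B' X \<and> h \<cdot> f' = u \<and> h \<cdot> i' = v))"
proof (cases "B' \<in> Obj C")
  case True
  then show ?thesis unfolding is_pushout_def ar_def by (auto; metis)
qed (auto simp: is_pushout_def ar_def simp del: ar_iff)

lemma zero_object_ar:
  assumes "zero_object C Z" "A \<in> Obj C"
  shows "ar f A Z \<longleftrightarrow> f = Zero C A Z" "ar f Z A \<longleftrightarrow> f = Zero C Z A"
proof -
  have Z: "Z \<in> Obj C" "\<exists>x. Hom C A Z = {x}" "\<exists>x. Hom C Z A = {x}"
    using assms unfolding zero_object_def is_singleton_def by auto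
  then show "ar f A Z \<longleftrightarrow> f = Zero C A Z" "ar f Z A \<longleftrightarrow> f = Zero C Z A"
    unfolding ar_def using add_facts(4)[of A Z] add_facts(4)[of Z A] assms(2) by auto
qed

end

section \<open>Conflations and the opposite exact category\<close>

text \<open>The opposite lives on the same objects and morphisms, so that a dual statement is an
  instance of the original one at \<open>op_cat C\<close>. Record extensions are dropped, hence the
  double opposite is literally \<open>C\<close> only at type \<open>excat\<close>.\<close>

definition op_cat :: "('o, 'm, 'x) excat_scheme \<Rightarrow> ('o, 'm) excat" where
  "op_cat C = \<lparr>Obj = Obj C, Hom = (\<lambda>A B. Hom C B A), Comp = (\<lambda>g f. f \<cdot>\<^bsub>C\<^esub> g), Ident = Ident C,
     Add = Add C, Zero = (\<lambda>A B. Zero C B A), Conf = {(i, p). (p, i) \<in> Conf C}\<rparr>"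

lemma op_cat_simps [simp]:
  "Obj (op_cat C) = Obj C" "Hom (op_cat C) A B = Hom C B A" "g \<cdot>\<^bsub>op_cat C\<^esub> f = f \<cdot>\<^bsub>C\<^esub> g"
  "Ident (op_cat C) = Ident C" "Add (op_cat C) = Add C" "Zero (op_cat C) A B = Zero C B A"
  "(i, p) \<in> Conf (op_cat C) \<longleftrightarrow> (p, i) \<in> Conf C"
  by (simp_all add: op_cat_def)

lemma inflation_op [simp]: "inflation (op_cat C) i = deflation C i"
  and deflation_op [simp]: "deflation (op_cat C) i = inflation C i"
  by (simp_all add: inflation_def deflation_def)

lemma kernel_op [simp]: "is_kernel (op_cat C) A B D i p = is_cokernel C D B A p i"
  and cokernel_op [simp]: "is_cokernel (op_cat C) A B D i p = is_kernel C D B A p i"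
  unfolding is_kernel_def is_cokernel_def by auto

lemma isomorphism_op [simp]: "isomorphism (op_cat C) A B f = isomorphism C B A f"
  unfolding isomorphism_def by auto

lemma pullback_op [simp]:
    "is_pullback (op_cat C) B' D' B D p' f' p f = is_pushout C D B D' B' p f p' f'"
  and pushout_op [simp]:
    "is_pushout (op_cat C) D B D' B' p f p' f' = is_pullback C B' D' B D p' f' p f"
  unfolding is_pullback_def is_pushout_def by auto

lemma zero_object_op [simp]: "zero_object (op_cat C) = zero_object C"
  unfolding zero_object_def fun_eq_iff by auto

lemma direct_sum_op [simp]: "direct_sum (op_cat C) = direct_sum C"
  unfolding direct_sum_def fun_eq_iff by (simp; blast)

context exact_category
begin

definition conf :: "'o \<Rightarrow> 'o \<Rightarrow> 'o \<Rightarrow> 'm \<Rightarrow> 'm \<Rightarrow> bool" where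
  "conf A B D i p \<longleftrightarrow> ar i A B \<and> ar p B D \<and> (i, p) \<in> Conf C"

lemma conf_ar: "conf A B D i p \<Longrightarrow> ar i A B \<and> ar p B D"
  unfolding conf_def by blast

lemma conf_Obj: "conf A B D i p \<Longrightarrow> A \<in> Obj C \<and> B \<in> Obj C \<and> D \<in> Obj C"
  unfolding conf_def ar_def by blast

lemma Conf_kernel_cokernel:
  assumes "(i, p) \<in> Conf C"
  shows "\<exists>A B D. conf A B D i p \<and> is_kernel C A B D i p \<and> is_cokernel C A B D i p"
  using Conf_kernel_cokernel_pair[OF assms] assms unfolding conf_def kernel_iff by blast

lemma conf_kernel: "conf A B D i p \<Longrightarrow> is_kernel C A B D i p"
  and conf_cokernel: "conf A B D i p \<Longrightarrow> is_cokernel C A B D i p"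
  using Conf_kernel_cokernel ar_unique unfolding conf_def by metis+

lemma conf_comp: "conf A B D i p \<Longrightarrow> p \<cdot> i = Zero C A D"
  using conf_kernel unfolding kernel_iff by blast

lemma conf_lift:
  assumes "conf A B D i p" "ar g X B" "p \<cdot> g = Zero C X D"
  obtains h where "ar h X A" "i \<cdot> h = g"
  using assms conf_kernel unfolding kernel_iff by metis

lemma conf_colift:
  assumes "conf A B D i p" "ar g B X" "g \<cdot> i = Zero C A X"
  obtains h where "ar h D X" "h \<cdot> p = g"
  using assms conf_cokernel unfolding cokernel_iff by metis

lemma conf_mono:
  assumes "conf A B D i p" "ar x X A" "ar y X A" "i \<cdot> x = i \<cdot> y"
  shows "x = y"
proof -
  have *: "ar i A B" "ar p B D" "p \<cdot> i = Zero C A D" using assms(1) conf_ar conf_comp by auto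
  have "ar (i \<cdot> y) X B" "p \<cdot> (i \<cdot> y) = Zero C X D"
    using * assms(3) comp_ext[of p i _ y] by auto
  then show ?thesis using assms conf_kernel[OF assms(1)] unfolding kernel_iff by metis
qed

lemma conf_epi:
  assumes "conf A B D i p" "ar x D X" "ar y D X" "x \<cdot> p = y \<cdot> p"
  shows "x = y"
proof -
  have *: "ar i A B" "ar p B D" "p \<cdot> i = Zero C A D" using assms(1) conf_ar conf_comp by auto
  have "ar (y \<cdot> p) B X" "(y \<cdot> p) \<cdot> i = Zero C A X"
    using * assms(3) by auto
  then show ?thesis using assms conf_cokernel[OF assms(1)] unfolding cokernel_iff by metis
qed

text \<open>The difference of \<open>x\<close> and \<open>y\<close> is killed by \<open>p\<close>,
  hence factors through the kernel \<open>i\<close>.\<close>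

lemma conf_lift_diff:
  assumes c: "conf A B D i p" and x: "ar x X B" and y: "ar y X B" and e: "p \<cdot> x = p \<cdot> y"
  obtains h where "ar h X A" "x = y \<oplus> i \<cdot> h"
proof -
  have p: "ar p B D" using c conf_ar by auto
  obtain z where z: "ar z X B" "x = y \<oplus> z" using ex_diff[OF x y] by blast
  have "p \<cdot> y \<oplus> p \<cdot> z = p \<cdot> x" unfolding z(2) using z(1) p y by simp
  also have "\<dots> = p \<cdot> y \<oplus> Zero C X D" unfolding e using p y by simp
  finally have "p \<cdot> y \<oplus> p \<cdot> z = p \<cdot> y \<oplus> Zero C X D" .
  then have "p \<cdot> z = Zero C X D" by (rule add_left_cancel) (use p y z(1) in auto)
  then show ?thesis using conf_lift[OF c z(1)] z that by metis
qed

lemma conf_isomorphic: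
  assumes "conf A B D i p" "ar i' A' B'" "ar p' B' D'"
    "isomorphism C A A' a" "isomorphism C B B' b" "isomorphism C D D' c"
    "b \<cdot> i = i' \<cdot> a" "c \<cdot> p = p' \<cdot> b"
  shows "conf A' B' D' i' p'"
  using assms Conf_isomorphic[of i p A B D A' B' D' i' p' a b c]
  unfolding conf_def ar_def by blast

lemma deflation_conf:
  assumes "deflation C p" "ar p B D"
  obtains A i where "conf A B D i p"
  using assms Conf_kernel_cokernel ar_unique unfolding deflation_def conf_def by metis

lemma conf_deflation: "conf A B D i p \<Longrightarrow> deflation C p"
  and conf_inflation: "conf A B D i p \<Longrightarrow> inflation C i"
  unfolding conf_def deflation_def inflation_def by blast+

text \<open>Two kernels of \<open>p\<close> are isomorphic over \<open>B\<close>, one of them sits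
  in a conflation, and conflations are closed under isomorphism.\<close>

lemma kernel_conf:
  assumes k: "is_kernel C A B D i p" and d: "deflation C p"
  shows "conf A B D i p"
proof -
  have ip: "ar i A B" "ar p B D" "p \<cdot> i = Zero C A D" using k unfolding kernel_iff by auto
  obtain A0 i0 where c: "conf A0 B D i0 p" using deflation_conf[OF d] ip by metis
  have i0: "ar i0 A0 B" "p \<cdot> i0 = Zero C A0 D" using c conf_ar conf_comp by auto
  have uni: "\<And>X g. ar g X B \<Longrightarrow> p \<cdot> g = Zero C X D \<Longrightarrow> (\<exists>!h. ar h X A \<and> i \<cdot> h = g)"
    using k unfolding kernel_iff by auto
  obtain a where a: "ar a A0 A" "i \<cdot> a = i0" using uni[OF i0] by blast
  obtain b where b: "ar b A A0" "i0 \<cdot> b = i" using conf_lift[OF c ip(1,3)] by blast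
  have "i \<cdot> (a \<cdot> b) = i" using comp_ext[of i a i0 b] a b ip by auto
  moreover have "i \<cdot> Ident C A = i" "ar (a \<cdot> b) A A" "ar (Ident C A) A A" using ip a b by auto
  ultimately have 1: "a \<cdot> b = Ident C A" using uni[OF ip(1,3)] by blast
  have "i0 \<cdot> (b \<cdot> a) = i0 \<cdot> Ident C A0" using comp_ext[of i0 b i a] a b i0 by auto
  then have 2: "b \<cdot> a = Ident C A0" using conf_mono[OF c, of "b \<cdot> a" A0 "Ident C A0"] a b by auto
  have "isomorphism C A0 A a" unfolding isomorphism_iff using a b 1 2 by blast
  then show ?thesis
    by (rule conf_isomorphic[OF c ip(1,2) _ isomorphism_Ident isomorphism_Ident])
      (use a(1) i0(1) ip(1,2) ar_Obj[OF ip(2)] in \<open>simp_all add: a(2)\<close>)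
qed

lemma isomorphism_deflation:
  assumes "isomorphism C A B f"
  shows "deflation C f"
proof -
  have f: "ar f A B" using assms isomorphism_iff by auto
  have A: "A \<in> Obj C" using f by auto
  obtain K i where c: "conf K A A i (Ident C A)" using deflation_conf[OF deflation_Ident[OF A]] A by
    auto
  have K: "ar i K A" "K \<in> Obj C" using c conf_ar conf_Obj by blast+
  have "conf K A B i f"
    by (rule conf_isomorphic[OF c K(1) f isomorphism_Ident isomorphism_Ident assms]) (use K f A
      ar_Obj[OF f] in simp_all)
  then show ?thesis by (rule conf_deflation)
qed

lemma deflation_comp:
  "ar p A B \<Longrightarrow> ar q B D \<Longrightarrow> deflation C p \<Longrightarrow> deflation C q \<Longrightarrow> deflation C (q \<cdot> p)"
  using deflation_Comp unfolding ar_def by blast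

section \<open>Exactness of the opposite category\<close>

lemma op_category: "category (op_cat C)"
proof (rule category.intro)
  fix A B A' B' f
  assume "A \<in> Obj (op_cat C)" "B \<in> Obj (op_cat C)" "A' \<in> Obj (op_cat C)" "B' \<in> Obj (op_cat C)"
    "f \<in> Hom (op_cat C) A B" "f \<in> Hom (op_cat C) A' B'"
  then show "A = A' \<and> B = B'" unfolding op_cat_simps using Hom_disjoint[of B A B' A' f] by blast
qed (simp_all add: Ident_in_Hom Comp_in_Hom Comp_Ident_left Comp_Ident_right Comp_assoc)

lemma op_preadditive_category: "preadditive_category (op_cat C)"
proof (intro preadditive_category.intro op_category preadditive_category_axioms.intro)
  fix A B assume "A \<in> Obj (op_cat C)" "B \<in> Obj (op_cat C)"
  then show "comm_group (Hom_group (op_cat C) A B)"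
    using Hom_comm_group[of B A] unfolding Hom_group_def by simp
qed (simp_all add: Comp_Add_left Comp_Add_right)

lemma op_additive_category: "additive_category (op_cat C)"
  by (intro additive_category.intro op_preadditive_category additive_category_axioms.intro)
    (simp_all add: ex_zero_object ex_direct_sum)

lemma op_exact_category: "exact_category (op_cat C)"
proof (intro exact_category.intro op_additive_category exact_category_axioms.intro)
  show "\<And>i p. (i, p) \<in> Conf (op_cat C) \<Longrightarrow>
      \<exists>A B D. is_kernel (op_cat C) A B D i p \<and> is_cokernel (op_cat C) A B D i p"
    unfolding op_cat_simps kernel_op cokernel_op using Conf_kernel_cokernel_pair by blast
next
  fix i p A B D A' B' D' i' p' a b c
  assume *: "(i, p) \<in> Conf (op_cat C)"
    "A \<in> Obj (op_cat C)" "B \<in> Obj (op_cat C)" "D \<in> Obj (op_cat C)"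
    "i \<in> Hom (op_cat C) A B" "p \<in> Hom (op_cat C) B D"
    "A' \<in> Obj (op_cat C)" "B' \<in> Obj (op_cat C)" "D' \<in> Obj (op_cat C)"
    "i' \<in> Hom (op_cat C) A' B'" "p' \<in> Hom (op_cat C) B' D'"
    "isomorphism (op_cat C) A A' a" "isomorphism (op_cat C) B B' b" "isomorphism (op_cat C) D D' c"
    "b \<cdot>\<^bsub>op_cat C\<^esub> i = i' \<cdot>\<^bsub>op_cat C\<^esub> a" "c \<cdot>\<^bsub>op_cat C\<^esub> p = p' \<cdot>\<^bsub>op_cat C\<^esub> b"
  then have iso: "isomorphism C A' A a" "isomorphism C B' B b" "isomorphism C D' D c" by simp_all
  have ar: "ar i B A" "ar p D B" "ar i' B' A'" "ar p' D' B'"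
    using * unfolding ar_def by auto
  have e: "i \<cdot> b = a \<cdot> i'" "p \<cdot> c = b \<cdot> p'" using * by simp_all
  \<comment> \<open>In the opposite category the isomorphisms point from the new pair to the given
    conflation, so the closure axiom is applied to their inverses.\<close>
  obtain a' where a': "isomorphism C A A' a'" "a' \<cdot> a = Ident C A'" "a \<cdot> a' = Ident C A"
    "ar a' A A'" "ar a A' A" using isomorphism_inverse[OF iso(1)] by metis
  obtain b' where b': "isomorphism C B B' b'" "b' \<cdot> b = Ident C B'" "b \<cdot> b' = Ident C B"
    "ar b' B B'" "ar b B' B" using isomorphism_inverse[OF iso(2)] by metis
  obtain c' where c': "isomorphism C D D' c'" "c' \<cdot> c = Ident C D'" "c \<cdot> c' = Ident C D"
    "ar c' D D'" "ar c D' D" using isomorphism_inverse[OF iso(3)] by metis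
  have "i' \<cdot> b' = a' \<cdot> ((a \<cdot> i') \<cdot> b')" using comp_ext[OF a'(2)] a'(4,5) ar b' by simp
  also have "\<dots> = a' \<cdot> i" unfolding e(1)[symmetric] using ar b' by simp
  finally have 1: "a' \<cdot> i = i' \<cdot> b'" by simp
  have "p' \<cdot> c' = b' \<cdot> ((b \<cdot> p') \<cdot> c')" using comp_ext[OF b'(2)] b'(4,5) ar c' by simp
  also have "\<dots> = b' \<cdot> p" unfolding e(2)[symmetric] using ar c' by simp
  finally have 2: "b' \<cdot> p = p' \<cdot> c'" by simp
  have "conf D B A p i" unfolding conf_def using ar *(1) by simp
  then have "conf D' B' A' p' i'"
    by (rule conf_isomorphic[OF _ ar(4,3) c'(1) b'(1) a'(1) 2 1])
  then show "(i', p') \<in> Conf (op_cat C)" unfolding conf_def by simp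
next
  show "\<And>A B D i j. \<lbrakk>A \<in> Obj (op_cat C); B \<in> Obj (op_cat C); D \<in> Obj (op_cat C);
    i \<in> Hom (op_cat C) A B; j \<in> Hom (op_cat C) B D; inflation (op_cat C) i; inflation (op_cat C) j\<rbrakk>
    \<Longrightarrow> inflation (op_cat C) (j \<cdot>\<^bsub>op_cat C\<^esub> i)"
    unfolding op_cat_simps inflation_op using deflation_Comp by blast
  show "\<And>A B D p q. \<lbrakk>A \<in> Obj (op_cat C); B \<in> Obj (op_cat C); D \<in> Obj (op_cat C);
    p \<in> Hom (op_cat C) A B; q \<in> Hom (op_cat C) B D; deflation (op_cat C) p; deflation (op_cat C) q\<rbrakk>
    \<Longrightarrow> deflation (op_cat C) (q \<cdot>\<^bsub>op_cat C\<^esub> p)"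
    unfolding op_cat_simps deflation_op using inflation_Comp by blast
  show "\<And>A B A' i f. \<lbrakk>A \<in> Obj (op_cat C); B \<in> Obj (op_cat C); A' \<in> Obj (op_cat C);
    i \<in> Hom (op_cat C) A B; f \<in> Hom (op_cat C) A A'; inflation (op_cat C) i\<rbrakk>
    \<Longrightarrow> \<exists>B' i' f'. is_pushout (op_cat C) A B A' B' i f i' f' \<and> inflation (op_cat C) i'"
    unfolding op_cat_simps inflation_op pushout_op using deflation_pullback by metis
  show "\<And>B D D' p f. \<lbrakk>B \<in> Obj (op_cat C); D \<in> Obj (op_cat C); D' \<in> Obj (op_cat C);
    p \<in> Hom (op_cat C) B D; f \<in> Hom (op_cat C) D' D; deflation (op_cat C) p\<rbrakk>
    \<Longrightarrow> \<exists>B' p' f'. is_pullback (op_cat C) B' D' B D p' f' p f \<and> deflation (op_cat C) p'"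
    unfolding op_cat_simps deflation_op pullback_op using inflation_pushout by metis
qed (simp_all add: inflation_Ident deflation_Ident)

end

section \<open>Pullbacks of conflations and cancellation of deflations\<close>

context category
begin

text \<open>The counterpart of \<open>comp_ext\<close> for commutative squares.\<close>

lemma comp_ext2:
  assumes "g \<cdot> f = g' \<cdot> f'" "arr f" "arr g" "arr f'" "arr g'" "arr x"
    "dom g = cod f" "dom g' = cod f'" "dom f = cod x" "dom f' = cod x"
  shows "g \<cdot> (f \<cdot> x) = g' \<cdot> (f' \<cdot> x)"
proof -
  have "g \<cdot> (f \<cdot> x) = (g \<cdot> f) \<cdot> x" using assms(2-) by simp
  also have "\<dots> = g' \<cdot> (f' \<cdot> x)" unfolding assms(1) using assms(2-) by simp
  finally show ?thesis .
qed

end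

context exact_category
begin

lemma op_ar [simp]: "category.ar (op_cat C) f A B \<longleftrightarrow> ar f B A"
  unfolding category.ar_def[OF op_category] ar_def by auto

lemma op_conf [simp]: "exact_category.conf (op_cat C) A B D i p \<longleftrightarrow> conf D B A p i"
  unfolding exact_category.conf_def[OF op_exact_category] conf_def op_ar op_cat_simps by blast

lemma cokernel_conf:
  assumes "is_cokernel C A B D i p" "inflation C i"
  shows "conf A B D i p"
proof -
  interpret op: exact_category "op_cat C" by (rule op_exact_category)
  show ?thesis using op.kernel_conf[of D B A p i] assms by (simp del: ar_iff)
qed

text \<open>The axiom provides one pullback whose projection is a deflation. Any other pullback is
  isomorphic to it, and deflations compose.\<close>

lemma pullback_deflation:
  assumes pb: "is_pullback C B' D' B D p' f' p f" and d: "deflation C p"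
  shows "deflation C p'"
proof -
  have ar: "ar p' B' D'" "ar f' B' B" "ar p B D" "ar f D' D" and e: "p \<cdot> f' = f \<cdot> p'"
    using pb unfolding pullback_iff by auto
  have U: "\<And>X u v. ar u X B \<Longrightarrow> ar v X D' \<Longrightarrow> p \<cdot> u = f \<cdot> v \<Longrightarrow>
      (\<exists>!h. ar h X B' \<and> f' \<cdot> h = u \<and> p' \<cdot> h = v)"
    using pb unfolding pullback_iff by blast
  obtain P q g where P: "is_pullback C P D' B D q g p f" and q: "deflation C q"
    using deflation_pullback[of B D D' p f] ar d unfolding ar_def by blast
  have ar': "ar q P D'" "ar g P B" and e': "p \<cdot> g = f \<cdot> q"
    using P unfolding pullback_iff by auto
  have U': "\<And>X u v. ar u X B \<Longrightarrow> ar v X D' \<Longrightarrow> p \<cdot> u = f \<cdot> v \<Longrightarrow>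
      (\<exists>!h. ar h X P \<and> g \<cdot> h = u \<and> q \<cdot> h = v)"
    using P unfolding pullback_iff by blast
  obtain a where a: "ar a B' P" "g \<cdot> a = f'" "q \<cdot> a = p'" using U'[OF ar(2,1) e] by blast
  obtain b where b: "ar b P B'" "f' \<cdot> b = g" "p' \<cdot> b = q" using U[OF ar'(2,1) e'] by blast
  have "f' \<cdot> (b \<cdot> a) = f'" "p' \<cdot> (b \<cdot> a) = p'"
    using comp_ext[OF b(2), of a] comp_ext[OF b(3), of a] a b(1) ar by simp_all
  moreover have "f' \<cdot> Ident C B' = f'" "p' \<cdot> Ident C B' = p'" "ar (b \<cdot> a) B' B'"
    "ar (Ident C B') B' B'" using ar ar_Obj[OF ar(1)] a(1) b(1) by simp_all
  ultimately have 1: "b \<cdot> a = Ident C B'" using U[OF ar(2,1) e] by blast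
  have "g \<cdot> (a \<cdot> b) = g" "q \<cdot> (a \<cdot> b) = q"
    using comp_ext[OF a(2), of b] comp_ext[OF a(3), of b] b a(1) ar' by simp_all
  moreover have "g \<cdot> Ident C P = g" "q \<cdot> Ident C P = q" "ar (a \<cdot> b) P P"
    "ar (Ident C P) P P" using ar' ar_Obj[OF ar'(1)] a(1) b(1) by simp_all
  ultimately have 2: "a \<cdot> b = Ident C P" using U'[OF ar'(2,1) e'] by blast
  have "isomorphism C B' P a" unfolding isomorphism_iff using a b 1 2 by blast
  then show ?thesis using deflation_comp[OF a(1) ar'(1) isomorphism_deflation q] a(3) by simp
qed

lemma pushout_inflation:
  assumes "is_pushout C A B A' B' i f i' f'" "inflation C i"
  shows "inflation C i'"
proof -
  interpret op: exact_category "op_cat C" by (rule op_exact_category)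
  show ?thesis using op.pullback_deflation[of B' A' B A i' f' i f] assms by (simp del: ar_iff)
qed

lemma conf_pullback:
  assumes c: "conf A B D i p" and u: "ar u Q D"
  obtains P j r g where "conf A P Q j r" "ar g P B" "p \<cdot> g = u \<cdot> r" "g \<cdot> j = i"
proof -
  have ip: "ar i A B" "ar p B D" "p \<cdot> i = Zero C A D" using c conf_ar conf_comp by blast+
  have Obj: "A \<in> Obj C" "Q \<in> Obj C" "D \<in> Obj C" using ar_Obj[OF ip(1)] ar_Obj[OF u] by auto
  obtain P r g where P: "is_pullback C P Q B D r g p u" and d: "deflation C r"
    using deflation_pullback[of B D Q p u] ip u conf_deflation[OF c] unfolding ar_def by blast
  have ar: "ar r P Q" "ar g P B" and e: "p \<cdot> g = u \<cdot> r"
    using P unfolding pullback_iff by auto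
  have U: "\<And>X x y. ar x X B \<Longrightarrow> ar y X Q \<Longrightarrow> p \<cdot> x = u \<cdot> y \<Longrightarrow>
      (\<exists>!h. ar h X P \<and> g \<cdot> h = x \<and> r \<cdot> h = y)"
    using P unfolding pullback_iff by blast
  have "ar (Zero C A Q) A Q" "p \<cdot> i = u \<cdot> Zero C A Q" using Obj u ip by simp_all
  then obtain j where j: "ar j A P" "g \<cdot> j = i" "r \<cdot> j = Zero C A Q" using U[OF ip(1)] by blast
  have "is_kernel C A P Q j r"
    unfolding kernel_iff
  proof (intro conjI j ar allI impI)
    fix X y assume y: "ar y X P" "r \<cdot> y = Zero C X Q"
    have X: "X \<in> Obj C" using ar_Obj[OF y(1)] by simp
    have gy: "ar (g \<cdot> y) X B" using y ar by simp
    have "p \<cdot> (g \<cdot> y) = u \<cdot> (r \<cdot> y)" using comp_ext2[OF e, of y] y(1) ip ar u by simp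
    also have "\<dots> = Zero C X D" unfolding y(2) using X Obj u by simp
    finally obtain h where h: "ar h X A" "i \<cdot> h = g \<cdot> y" using conf_lift[OF c gy] by blast
    have jh: "ar (j \<cdot> h) X P" "g \<cdot> (j \<cdot> h) = g \<cdot> y" "r \<cdot> (j \<cdot> h) = r \<cdot> y"
      using h(1) X Obj comp_ext[OF j(2), of h] comp_ext[OF j(3), of h] ar j(1) h(2) y(2) by simp_all
    have "j \<cdot> h = y"
      using U[of "g \<cdot> y" X "r \<cdot> y"] jh y(1) gy ar comp_ext2[OF e, of y] ip u
      by (metis ar_iff comp_ar)
    moreover have "h' = h" if h': "ar h' X A" "j \<cdot> h' = y" for h'
    proof (rule conf_mono[OF c h'(1) h(1)])
      have "i \<cdot> h' = g \<cdot> (j \<cdot> h')" using comp_ext[OF j(2), of h'] ar(2) j(1) h' by simp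
      then show "i \<cdot> h' = i \<cdot> h" using h h' by simp
    qed
    ultimately show "\<exists>!h. ar h X A \<and> j \<cdot> h = y" using h(1) by blast
  qed
  then have "conf A P Q j r" using d by (rule kernel_conf)
  then show ?thesis using that j ar e by blast
qed

lemma conf_pushout:
  assumes "conf A B D i p" "ar h A A'"
  obtains B' i' p' g where "conf A' B' D i' p'" "ar g B B'" "g \<cdot> i = i' \<cdot> h" "p' \<cdot> g = p"
proof -
  interpret op: exact_category "op_cat C" by (rule op_exact_category)
  show ?thesis
    using op.conf_pullback[of D B A p i h A'] assms that
    unfolding op_conf op_ar op_cat_simps by metis
qed

text \<open>The kernel \<open>Z\<close> of an identity has zero inclusion, and that inclusion is
  mono, so the identity of \<open>Z\<close> is zero.\<close>

lemma conf_zero: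
  assumes "A \<in> Obj C"
  obtains Z i where "conf Z A A i (Ident C A)" "\<And>X x. ar x Z X \<Longrightarrow> x = Zero C Z X"
    "\<And>X x. ar x X Z \<Longrightarrow> x = Zero C X Z" "zero_object C Z"
proof -
  obtain Z i where c: "conf Z A A i (Ident C A)"
    using deflation_conf[OF deflation_Ident[OF assms]] assms by auto
  have i: "ar i Z A" "Z \<in> Obj C" using conf_ar[OF c] conf_Obj[OF c] by auto
  have "i = Zero C Z A" using conf_comp[OF c] i by simp
  then have "i \<cdot> Ident C Z = i \<cdot> Zero C Z Z" using i by simp
  then have z: "Ident C Z = Zero C Z Z"
    using conf_mono[OF c, of "Ident C Z" Z "Zero C Z Z"] i by simp
  have 1: "x = Zero C Z X" if "ar x Z X" for X x
  proof -
    have "x = x \<cdot> Ident C Z" using that by simp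
    also have "\<dots> = Zero C Z X" unfolding z using that i ar_Obj[OF that] by simp
    finally show ?thesis .
  qed
  have 2: "x = Zero C X Z" if "ar x X Z" for X x
  proof -
    have "x = Ident C Z \<cdot> x" using that by simp
    also have "\<dots> = Zero C X Z" unfolding z using that i ar_Obj[OF that] by simp
    finally show ?thesis .
  qed
  have "zero_object C Z"
    unfolding zero_object_def is_singleton_def
  proof (intro conjI ballI i)
    fix B assume B: "B \<in> Obj C"
    show "\<exists>x. Hom C B Z = {x}" using 2 i(2) B add_facts(4)[of B Z] unfolding ar_def by blast
    show "\<exists>x. Hom C Z B = {x}" using 1 i(2) B add_facts(4)[of Z B] unfolding ar_def by blast
  qed
  then show ?thesis using that c 1 2 by blast
qed

lemma conf_zero_right:
  assumes "A \<in> Obj C"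
  obtains Z p where "conf A A Z (Ident C A) p" "\<And>X x. ar x X Z \<Longrightarrow> x = Zero C X Z" "zero_object C Z"
proof -
  interpret op: exact_category "op_cat C" by (rule op_exact_category)
  show ?thesis
    using op.conf_zero[of A] assms that
    unfolding op_conf op_ar op_cat_simps zero_object_op by metis
qed

text \<open>A split epimorphism with a kernel is a biproduct projection, hence the pullback of the
  deflation \<open>A \<rightarrow> 0\<close> along the zero map from \<open>D\<close>.\<close>

lemma split_epi_conf:
  assumes k: "is_kernel C A B D k p" and s: "ar s D B" "p \<cdot> s = Ident C D"
  shows "conf A B D k p"
proof -
  have ar: "ar k A B" "ar p B D" and pk: "p \<cdot> k = Zero C A D"
    and U: "\<And>X g. ar g X B \<Longrightarrow> p \<cdot> g = Zero C X D \<Longrightarrow> (\<exists>!h. ar h X A \<and> k \<cdot> h = g)"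
    using k unfolding kernel_iff by blast+
  have Obj [simp]: "A \<in> Obj C" "B \<in> Obj C" "D \<in> Obj C" using ar_Obj ar by blast+
  have [simp]: "arr k" "arr p" "arr s" "dom k = A" "cod k = B" "dom p = B" "cod p = D"
    "dom s = D" "cod s = B" using ar s by simp_all
  have mono: "x = y" if "ar x X A" "ar y X A" "k \<cdot> x = k \<cdot> y" for x y X
    using U[of "k \<cdot> y" X] that comp_ext[OF pk, of y] by (auto simp: ar_Obj[OF that(1)])
  \<comment> \<open>\<open>z\<close> is the identity minus \<open>s \<cdot> p\<close>. It is killed
    by \<open>p\<close>, so it factors as \<open>k \<cdot> \<rho>\<close>, and \<open>\<rho>\<close>
    is the other projection of the biproduct.\<close>
  obtain z where z: "ar z B B" "Ident C B = (s \<cdot> p) \<oplus> z"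
    using ex_diff[of "Ident C B" B B "s \<cdot> p"] by auto
  have [simp]: "arr z" "dom z = B" "cod z = B" using z(1) by simp_all
  have "p \<oplus> Zero C B D = p \<cdot> Ident C B" by simp
  also have "\<dots> = (p \<cdot> (s \<cdot> p)) \<oplus> (p \<cdot> z)" unfolding z(2) by simp
  also have "p \<cdot> (s \<cdot> p) = p" using comp_ext[OF s(2), of p] by simp
  finally have "p \<oplus> p \<cdot> z = p \<oplus> Zero C B D" by simp
  then have "p \<cdot> z = Zero C B D" by (rule add_left_cancel) simp_all
  then obtain \<rho> where \<rho>: "ar \<rho> B A" "k \<cdot> \<rho> = z" using U[OF z(1)] by blast
  have [simp]: "arr \<rho>" "dom \<rho> = B" "cod \<rho> = A" using \<rho>(1) by simp_all
  have dec: "h = (s \<cdot> (p \<cdot> h)) \<oplus> (k \<cdot> (\<rho> \<cdot> h))" if "ar h X B" for X h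
  proof -
    have h: "arr h" "cod h = B" using that by simp_all
    have "h = Ident C B \<cdot> h" using h by simp
    also have "\<dots> = (s \<cdot> (p \<cdot> h)) \<oplus> (z \<cdot> h)" unfolding z(2) using h by simp
    finally show ?thesis using \<rho>(2) h comp_ext[OF \<rho>(2), of h] by simp
  qed
  have "k \<cdot> (\<rho> \<cdot> k) = k \<cdot> Ident C A" using dec[of k A, symmetric] pk by simp
  then have \<rho>k: "\<rho> \<cdot> k = Ident C A" by (rule mono[rotated 2]) simp_all
  have "s \<oplus> k \<cdot> (\<rho> \<cdot> s) = s \<oplus> Zero C D B" using dec[of s D, symmetric] s(2) by simp
  then have "k \<cdot> (\<rho> \<cdot> s) = k \<cdot> Zero C D A" using add_left_cancel[of s "k \<cdot> (\<rho> \<cdot> s)"] by simp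
  then have \<rho>s: "\<rho> \<cdot> s = Zero C D A" by (rule mono[rotated 2]) simp_all
  obtain Z q where Z: "conf A A Z (Ident C A) q" "\<And>X x. ar x X Z \<Longrightarrow> x = Zero C X Z"
    using conf_zero_right[OF Obj(1)] by metis
  have q: "ar q A Z" "Z \<in> Obj C" using Z(1) conf_ar conf_Obj by blast+
  have Zu: "x = y" if "ar x X Z" "ar y X Z" for x y X using Z(2) that by metis
  have pb: "is_pullback C B D A Z p \<rho> q (Zero C D Z)"
    unfolding pullback_iff
  proof (intro conjI allI impI ar q \<rho>)
    show "ar (Zero C D Z) D Z" using q by simp
    show "q \<cdot> \<rho> = Zero C D Z \<cdot> p" by (rule Zu[of _ B]) (use q in simp_all)
    fix X u v assume u: "ar u X A" and v: "ar v X D"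
    have [simp]: "arr u" "arr v" "dom u = X" "dom v = X" "cod u = A" "cod v = D" "X \<in> Obj C"
      using u v ar_Obj[OF u] by simp_all
    show "\<exists>!h. ar h X B \<and> \<rho> \<cdot> h = u \<and> p \<cdot> h = v"
    proof (intro ex1I[of _ "(s \<cdot> v) \<oplus> (k \<cdot> u)"])
      have "\<rho> \<cdot> (s \<cdot> v) = Zero C X A" "\<rho> \<cdot> (k \<cdot> u) = u" "p \<cdot> (s \<cdot> v) = v" "p \<cdot> (k \<cdot> u) = Zero C X D"
        using comp_ext[OF \<rho>s, of v] comp_ext[OF \<rho>k, of u] comp_ext[OF s(2), of v]
          comp_ext[OF pk, of u] by simp_all
      then show "ar ((s \<cdot> v) \<oplus> (k \<cdot> u)) X B \<and> \<rho> \<cdot> ((s \<cdot> v) \<oplus> (k \<cdot> u)) = u \<and>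
          p \<cdot> ((s \<cdot> v) \<oplus> (k \<cdot> u)) = v" by simp
      fix h assume "ar h X B \<and> \<rho> \<cdot> h = u \<and> p \<cdot> h = v"
      then show "h = (s \<cdot> v) \<oplus> (k \<cdot> u)" using dec[of h X] by blast
    qed
  qed
  show ?thesis using kernel_conf[OF k pullback_deflation[OF pb conf_deflation[OF Z(1)]]] .
qed

lemma ex_direct_sum_conf:
  assumes "A \<in> Obj C" "B \<in> Obj C"
  obtains S i p t s where "conf A S B i p" "ar t S A" "ar s B S" "t \<cdot> i = Ident C A"
    "p \<cdot> s = Ident C B" "(i \<cdot> t) \<oplus> (s \<cdot> p) = Ident C S"
proof -
  obtain S where "direct_sum C A B S" using ex_direct_sum[OF assms] by blast
  then obtain i s t p where S: "S \<in> Obj C" "i \<in> Hom C A S" "s \<in> Hom C B S" "t \<in> Hom C S A"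
    "p \<in> Hom C S B" and e: "t \<cdot> i = Ident C A" "p \<cdot> s = Ident C B" "t \<cdot> s = Zero C B A"
    "p \<cdot> i = Zero C A B" "(i \<cdot> t) \<oplus> (s \<cdot> p) = Ident C S"
    unfolding direct_sum_def by blast
  then have ar: "ar i A S" "ar s B S" "ar t S A" "ar p S B" unfolding ar_def using assms by blast+
  have k: "is_kernel C A S B i p"
    unfolding kernel_iff
  proof (intro conjI allI impI ar e)
    fix X g assume g: "ar g X S" "p \<cdot> g = Zero C X B"
    have X: "X \<in> Obj C" using ar_Obj g by blast
    show "\<exists>!h. ar h X A \<and> i \<cdot> h = g"
    proof (intro ex1I[of _ "t \<cdot> g"] conjI)
      show "ar (t \<cdot> g) X A" using g(1) ar by simp
      have "g = ((i \<cdot> t) \<oplus> (s \<cdot> p)) \<cdot> g" unfolding e(5) using g(1) by simp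
      also have "\<dots> = (i \<cdot> (t \<cdot> g)) \<oplus> (s \<cdot> (p \<cdot> g))" using g(1) ar by simp
      also have "\<dots> = i \<cdot> (t \<cdot> g)" unfolding g(2) using g(1) ar X assms by simp
      finally show "i \<cdot> (t \<cdot> g) = g" by simp
      fix h assume h: "ar h X A \<and> i \<cdot> h = g"
      then show "h = t \<cdot> g" using comp_ext[OF e(1), of h] ar by auto
    qed
  qed
  show ?thesis using that[OF split_epi_conf[OF k ar(2) e(2)] ar(3,2) e(1,2,5)] .
qed

text \<open>In the pullback of \<open>p \<cdot> g\<close> along \<open>p\<close> the projection to \<open>A\<close> is split, so \<open>p\<close> has a
  kernel by weak idempotent completeness.  This kernel is a pushout of the kernel of the composite
  deflation from the pullback to \<open>D\<close>, hence an inflation with cokernel \<open>p\<close>.\<close>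

lemma deflation_cancel:
  assumes wic: "weakly_idempotent_complete C"
    and g: "ar g A B" and p: "ar p B D" and d: "deflation C (p \<cdot> g)"
  shows "deflation C p"
proof -
  have pg: "ar (p \<cdot> g) A D" using g p by simp
  have [simp]: "A \<in> Obj C" "B \<in> Obj C" "D \<in> Obj C" using ar_Obj g p by blast+
  obtain P b a where P: "is_pullback C P B A D b a (p \<cdot> g) p" and b: "deflation C b"
    using deflation_pullback[of A D B "p \<cdot> g" p] pg p d unfolding ar_def by blast
  have ab: "ar b P B" "ar a P A" and e: "(p \<cdot> g) \<cdot> a = p \<cdot> b"
    using P unfolding pullback_iff by blast+
  have U: "\<And>X x y. ar x X A \<Longrightarrow> ar y X B \<Longrightarrow> (p \<cdot> g) \<cdot> x = p \<cdot> y \<Longrightarrow>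
      (\<exists>!h. ar h X P \<and> a \<cdot> h = x \<and> b \<cdot> h = y)"
    using P unfolding pullback_iff by blast
  have [simp]: "arr g" "arr p" "arr a" "arr b" "dom g = A" "cod g = B" "dom p = B" "cod p = D"
    "dom a = P" "cod a = A" "dom b = P" "cod b = B" "P \<in> Obj C"
    using g p ab ar_Obj[OF ab(1)] by simp_all
  have e': "p \<cdot> b = p \<cdot> (g \<cdot> a)" using e by simp
  have joint: "x = y" if "ar x X P" "ar y X P" "a \<cdot> x = a \<cdot> y" "b \<cdot> x = b \<cdot> y" for x y X
  proof -
    have "ar (a \<cdot> y) X A" "ar (b \<cdot> y) X B" "(p \<cdot> g) \<cdot> (a \<cdot> y) = p \<cdot> (b \<cdot> y)"
      using that(2) comp_ext2[OF e, of y] by simp_all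
    then show ?thesis using U that by metis
  qed
  \<comment> \<open>The section of \<open>a\<close> is the map into the pullback with components the
    identity of \<open>A\<close> and \<open>g\<close>.\<close>
  obtain s where s: "ar s A P" "a \<cdot> s = Ident C A" "b \<cdot> s = g"
    using U[of "Ident C A" A g] g by (auto simp del: ar_iff simp add: ar_iff[of "Ident C A"])
  obtain K k where k: "is_kernel C K P A k a"
    using wic s ab unfolding weakly_idempotent_complete_def ar_def by blast
  have ca: "conf K P A k a" using split_epi_conf[OF k s(1,2)] .
  have k_ar: "ar k K P" and ak: "a \<cdot> k = Zero C K A" and [simp]: "K \<in> Obj C"
    using conf_ar[OF ca] conf_comp[OF ca] conf_Obj[OF ca] by blast+
  have [simp]: "arr k" "dom k = K" "cod k = P" using k_ar by simp_all
  define q where "q = p \<cdot> b"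
  have q: "ar q P D" unfolding q_def by simp
  have "deflation C ((p \<cdot> g) \<cdot> a)" by (rule deflation_comp[OF ab(2) pg conf_deflation[OF ca] d])
  then have dq: "deflation C q" unfolding q_def e .
  obtain W \<kappa> where cq: "conf W P D \<kappa> q" using deflation_conf[OF dq q] by blast
  have \<kappa>: "ar \<kappa> W P" "q \<cdot> \<kappa> = Zero C W D" and [simp]: "W \<in> Obj C"
    using conf_ar[OF cq] conf_comp[OF cq] conf_Obj[OF cq] by blast+
  have [simp]: "arr \<kappa>" "dom \<kappa> = W" "cod \<kappa> = P" using \<kappa> by simp_all
  \<comment> \<open>A map \<open>x\<close> with \<open>p \<cdot> x = 0\<close> corresponds to the
    map into the pullback with components zero and \<open>x\<close>, which factors through the
    kernel \<open>k\<close> of \<open>a\<close>. So \<open>b \<cdot> k\<close> is a kernel of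
    \<open>p\<close>.\<close>
  define \<kappa>' where "\<kappa>' = b \<cdot> k"
  have \<kappa>': "ar \<kappa>' K B" unfolding \<kappa>'_def by simp
  have [simp]: "arr \<kappa>'" "dom \<kappa>' = K" "cod \<kappa>' = B" using \<kappa>' by simp_all
  have p\<kappa>': "p \<cdot> \<kappa>' = Zero C K D"
    unfolding \<kappa>'_def using comp_ext2[OF e'[unfolded e'[symmetric]], of k] comp_ext[OF e', of k] ak
      by simp
  have lift: "\<exists>h. ar h X K \<and> \<kappa>' \<cdot> h = x" if x: "ar x X B" "p \<cdot> x = Zero C X D" for X x
  proof -
    have X: "X \<in> Obj C" using ar_Obj x(1) by blast
    obtain y where y: "ar y X P" "a \<cdot> y = Zero C X A" "b \<cdot> y = x"
      using U[of "Zero C X A" X x] x X by (auto simp del: ar_iff simp add: ar_iff[of "Zero C X A"])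
    obtain h where h: "ar h X K" "k \<cdot> h = y" using conf_lift[OF ca y(1,2)] by blast
    then have "\<kappa>' \<cdot> h = x" unfolding \<kappa>'_def using y by simp
    then show ?thesis using h by blast
  qed
  have mono: "x = y" if "ar x X K" "ar y X K" "\<kappa>' \<cdot> x = \<kappa>' \<cdot> y" for x y X
  proof (rule conf_mono[OF ca that(1,2)], rule joint)
    show "a \<cdot> (k \<cdot> x) = a \<cdot> (k \<cdot> y)"
      using comp_ext[OF ak, of x] comp_ext[OF ak, of y] that(1,2) by simp
    show "b \<cdot> (k \<cdot> x) = b \<cdot> (k \<cdot> y)" using that unfolding \<kappa>'_def by simp
  qed (use that in simp_all)
  have "p \<cdot> (b \<cdot> \<kappa>) = Zero C W D" using \<kappa> unfolding q_def by simp
  then obtain \<rho> where \<rho>: "ar \<rho> W K" "\<kappa>' \<cdot> \<rho> = b \<cdot> \<kappa>" using lift[of "b \<cdot> \<kappa>" W] by auto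
  have [simp]: "arr \<rho>" "dom \<rho> = W" "cod \<rho> = K" using \<rho> by simp_all
  have "q \<cdot> k = Zero C K D" using p\<kappa>' unfolding q_def \<kappa>'_def by simp
  then obtain k' where k': "ar k' K W" "\<kappa> \<cdot> k' = k" using conf_lift[OF cq k_ar] by blast
  have [simp]: "arr k'" "dom k' = K" "cod k' = W" using k' by simp_all
  have \<rho>k': "\<rho> \<cdot> k' = Ident C K"
  proof (rule mono)
    show "\<kappa>' \<cdot> (\<rho> \<cdot> k') = \<kappa>' \<cdot> Ident C K" using comp_ext[OF \<rho>(2), of k'] k'(2) by (simp add: \<kappa>'_def)
  qed simp_all
  \<comment> \<open>The kernel of \<open>b\<close> lies inside \<open>W\<close> and is killed by
    \<open>\<rho>\<close>. Therefore, in the pushout test below, \<open>u\<close> vanishes on it and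
    descends along \<open>b\<close>.\<close>
  obtain L l where cb: "conf L P B l b" using deflation_conf[OF b ab(1)] by blast
  have l: "ar l L P" "b \<cdot> l = Zero C L B" and [simp]: "L \<in> Obj C"
    using conf_ar[OF cb] conf_comp[OF cb] conf_Obj[OF cb] by blast+
  have [simp]: "arr l" "dom l = L" "cod l = P" using l by simp_all
  have "q \<cdot> l = Zero C L D" unfolding q_def using l by simp
  then obtain l' where l': "ar l' L W" "\<kappa> \<cdot> l' = l" using conf_lift[OF cq l(1)] by blast
  have [simp]: "arr l'" "dom l' = L" "cod l' = W" using l' by simp_all
  have \<rho>l': "\<rho> \<cdot> l' = Zero C L K"
    by (rule mono) (use comp_ext[OF \<rho>(2), of l'] l'(2) l(2) in simp_all)
  have po: "is_pushout C W P K B \<kappa> \<rho> \<kappa>' b"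
    unfolding pushout_iff
  proof (intro conjI allI impI \<kappa> \<rho> \<kappa>' ab \<rho>(2)[symmetric])
    fix X u v assume u: "ar u P X" and v: "ar v K X" and uv: "u \<cdot> \<kappa> = v \<cdot> \<rho>"
    have [simp]: "arr u" "arr v" "dom u = P" "dom v = K" "cod u = X" "cod v = X" "X \<in> Obj C"
      using u v ar_Obj[OF u] by simp_all
    have "u \<cdot> l = v \<cdot> (\<rho> \<cdot> l')" using comp_ext2[OF uv, of l'] l' by simp
    then have "u \<cdot> l = Zero C L X" unfolding \<rho>l' by simp
    then obtain h where h: "ar h B X" "h \<cdot> b = u" using conf_colift[OF cb u] by blast
    have [simp]: "arr h" "dom h = B" "cod h = X" using h by simp_all
    have "h \<cdot> (b \<cdot> (\<kappa> \<cdot> k')) = v \<cdot> (\<rho> \<cdot> k')"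
      using comp_ext2[OF uv, of k'] comp_ext[OF h(2), of "\<kappa> \<cdot> k'"] by simp
    then have "h \<cdot> \<kappa>' = v" unfolding \<rho>k' k' \<kappa>'_def by simp
    then show "\<exists>!h. ar h B X \<and> h \<cdot> b = u \<and> h \<cdot> \<kappa>' = v"
      using h conf_epi[OF cb] by metis
  qed
  have inf: "inflation C \<kappa>'" using pushout_inflation[OF po conf_inflation[OF cq]] .
  obtain L' l'' where cpg: "conf L' A D l'' (p \<cdot> g)" using deflation_conf[OF d pg] by blast
  have "is_cokernel C K B D \<kappa>' p"
    unfolding cokernel_iff
  proof (intro conjI allI impI \<kappa>' p p\<kappa>')
    fix X x assume x: "ar x B X" "x \<cdot> \<kappa>' = Zero C K X"
    have [simp]: "arr x" "dom x = B" "cod x = X" "X \<in> Obj C" using x ar_Obj[OF x(1)] by simp_all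
    have "(x \<cdot> b) \<cdot> \<kappa> = Zero C W X" using comp_ext[OF x(2), of \<rho>] \<rho>(2) by simp
    then obtain y where y: "ar y D X" "y \<cdot> q = x \<cdot> b" using conf_colift[OF cq, of "x \<cdot> b" X] by auto
    have [simp]: "arr y" "dom y = D" "cod y = X" using y by simp_all
    have yp: "y \<cdot> p = x" by (rule conf_epi[OF cb]) (use x(1) y in \<open>simp_all add: q_def\<close>)
    show "\<exists>!h. ar h D X \<and> h \<cdot> p = x"
    proof (intro ex1I[of _ y] conjI y yp)
      fix y' assume y': "ar y' D X \<and> y' \<cdot> p = x"
      show "y' = y"
      proof (rule conf_epi[OF cpg _ y(1)])
        show "y' \<cdot> (p \<cdot> g) = y \<cdot> (p \<cdot> g)"
          using comp_ext[of y' p x g] comp_ext[OF yp, of g] y' by simp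
      qed (use y' in blast)
    qed
  qed
  then show ?thesis using cokernel_conf[OF _ inf] conf_deflation by blast
qed

text \<open>If \<open>r\<close> is a retraction of \<open>m\<close>, a kernel \<open>k\<close> of
  \<open>r\<close> makes \<open>B\<close> the biproduct of \<open>D\<close> and \<open>K\<close>.
  The projection \<open>t\<close> onto \<open>K\<close> is then a cokernel of
  \<open>m\<close>.\<close>

lemma op_weakly_idempotent_complete:
  assumes wic: "weakly_idempotent_complete C"
  shows "weakly_idempotent_complete (op_cat C)"
  unfolding weakly_idempotent_complete_def
proof (intro ballI impI)
  fix B D m assume *: "B \<in> Obj (op_cat C)" "D \<in> Obj (op_cat C)" "m \<in> Hom (op_cat C) B D"
    "\<exists>r\<in>Hom (op_cat C) D B. m \<cdot>\<^bsub>op_cat C\<^esub> r = Ident (op_cat C) D"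
  then obtain r where m: "ar m D B" and r: "ar r B D" and rm: "r \<cdot> m = Ident C D"
    unfolding ar_def by auto
  obtain K k where k: "is_kernel C K B D k r"
    using wic m r rm unfolding weakly_idempotent_complete_def ar_def by blast
  have c: "conf K B D k r" using split_epi_conf[OF k m rm] .
  have k_ar: "ar k K B" and rk: "r \<cdot> k = Zero C K D" and Obj: "K \<in> Obj C" "B \<in> Obj C" "D \<in> Obj C"
    using conf_ar[OF c] conf_comp[OF c] conf_Obj[OF c] by blast+
  note [simp] = Obj
  have [simp]: "arr k" "dom k = K" "cod k = B" "arr m" "dom m = D" "cod m = B"
    "arr r" "dom r = B" "cod r = D" using k_ar m r by simp_all
  have e: "r \<cdot> Ident C B = r \<cdot> (m \<cdot> r)" using comp_ext[OF rm, of r] by simp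
  obtain t where t: "ar t B K" "Ident C B = (m \<cdot> r) \<oplus> (k \<cdot> t)"
    using conf_lift_diff[OF c _ _ e, of B] by auto
  have [simp]: "arr t" "dom t = B" "cod t = K" using t(1) by simp_all
  have dec: "x = (m \<cdot> (r \<cdot> x)) \<oplus> (k \<cdot> (t \<cdot> x))" if "ar x X B" for x X
  proof -
    have "x = Ident C B \<cdot> x" using that by simp
    also have "\<dots> = (m \<cdot> (r \<cdot> x)) \<oplus> (k \<cdot> (t \<cdot> x))" unfolding t(2) using that by simp
    finally show ?thesis .
  qed
  have dec': "x = ((x \<cdot> m) \<cdot> r) \<oplus> ((x \<cdot> k) \<cdot> t)" if "ar x B X" for x X
  proof -
    have "x = x \<cdot> Ident C B" using that by simp
    also have "\<dots> = ((x \<cdot> m) \<cdot> r) \<oplus> ((x \<cdot> k) \<cdot> t)" unfolding t(2) using that by simp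
    finally show ?thesis .
  qed
  have "m \<oplus> k \<cdot> (t \<cdot> m) = m" using dec[OF m] unfolding rm by simp
  then have "m \<oplus> k \<cdot> (t \<cdot> m) = m \<oplus> Zero C D B" by simp
  then have "k \<cdot> (t \<cdot> m) = Zero C D B" by (rule add_left_cancel) simp_all
  then have "k \<cdot> (t \<cdot> m) = k \<cdot> Zero C D K" by simp
  then have tm: "t \<cdot> m = Zero C D K" by (rule conf_mono[OF c, rotated 2]) simp_all
  have "k \<cdot> (t \<cdot> k) = k" using dec[of k K, symmetric] rk by simp
  then have "k \<cdot> (t \<cdot> k) = k \<cdot> Ident C K" by simp
  then have tk: "t \<cdot> k = Ident C K" by (rule conf_mono[OF c, rotated 2]) simp_all
  have "is_cokernel C D B K m t"
    unfolding cokernel_iff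
  proof (intro conjI allI impI m t tm)
    fix X x assume x: "ar x B X" "x \<cdot> m = Zero C D X"
    have X: "X \<in> Obj C" using ar_Obj x(1) by blast
    show "\<exists>!h. ar h K X \<and> h \<cdot> t = x"
    proof (intro ex1I[of _ "x \<cdot> k"] conjI)
      show "ar (x \<cdot> k) K X" using x(1) by simp
      show "(x \<cdot> k) \<cdot> t = x" using dec'[OF x(1), symmetric] x X by simp
      fix h assume h: "ar h K X \<and> h \<cdot> t = x"
      then have "h \<cdot> (t \<cdot> k) = x \<cdot> k" by (intro comp_ext) (use x(1) h in simp_all)
      then show "h = x \<cdot> k" unfolding tk using h by simp
    qed
  qed
  then show "\<exists>A i. is_kernel (op_cat C) A B D i m" by auto
qed

end

section \<open>Refinement of chains of conflations\<close>

context exact_category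
begin

text \<open>A chain from \<open>X\<close> is an \<open>n\<close>-extension cut into conflations \<open>Q\<^sub>k \<rightarrow> P\<^sub>k \<rightarrow> Q\<^bsub>k-1\<^esub>\<close> with
  \<open>Q\<^sub>0 = X\<close>.  The list starts with the conflation farthest from \<open>X\<close>, so \<open>chain_end\<close>, the object by
  which \<open>X\<close> is extended, is read off its head.  \<open>chain_map X \<eta> \<zeta> u\<close> says that there is a chain map
  which is the identity on \<open>X\<close> and \<open>u\<close> on the ends; \<open>\<eta>\<close> is then called a refinement of \<open>\<zeta>\<close>.
  \<open>extends_last X \<zeta> B h\<close> expresses that \<open>h\<close> extends over the last inflation; for the empty chain
  this degenerates to \<open>h = 0\<close>.\<close>

fun chain_end :: "'o \<Rightarrow> ('m \<times> 'o \<times> 'm \<times> 'o) list \<Rightarrow> 'o" where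
  "chain_end X [] = X"
| "chain_end X ((j, P, r, Q) # \<zeta>) = Q"

fun chain :: "'o \<Rightarrow> ('m \<times> 'o \<times> 'm \<times> 'o) list \<Rightarrow> bool" where
  "chain X [] \<longleftrightarrow> X \<in> Obj C"
| "chain X ((j, P, r, Q) # \<zeta>) \<longleftrightarrow> conf Q P (chain_end X \<zeta>) j r \<and> chain X \<zeta>"

fun chain_map :: "'o \<Rightarrow> ('m \<times> 'o \<times> 'm \<times> 'o) list \<Rightarrow> ('m \<times> 'o \<times> 'm \<times> 'o) list \<Rightarrow> 'm \<Rightarrow> bool" where
  "chain_map X [] [] u \<longleftrightarrow> u = Ident C X"
| "chain_map X ((j, P, r, Q) # \<eta>) ((i, Z, p, K) # \<zeta>) u \<longleftrightarrow>
     (\<exists>u' g. chain_map X \<eta> \<zeta> u' \<and> ar g P Z \<and> ar u Q K \<and> p \<cdot> g = u' \<cdot> r \<and> g \<cdot> j = i \<cdot> u)"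
| "chain_map X [] (c # \<zeta>) u \<longleftrightarrow> False"
| "chain_map X (c # \<eta>) [] u \<longleftrightarrow> False"

fun extends_last :: "'o \<Rightarrow> ('m \<times> 'o \<times> 'm \<times> 'o) list \<Rightarrow> 'o \<Rightarrow> 'm \<Rightarrow> bool" where
  "extends_last X [] B h \<longleftrightarrow> B \<in> Obj C \<and> h = Zero C X B"
| "extends_last X ((j, P, r, Q) # \<zeta>) B h \<longleftrightarrow> (\<exists>t. ar t P B \<and> t \<cdot> j = h)"

lemma chain_Obj: "chain X \<zeta> \<Longrightarrow> X \<in> Obj C \<and> chain_end X \<zeta> \<in> Obj C"
  by (induction X \<zeta> rule: chain.induct) (auto dest: conf_Obj)

lemma chain_map_ar:
  assumes "chain X \<eta>" "chain_map X \<eta> \<zeta> u"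
  shows "ar u (chain_end X \<eta>) (chain_end X \<zeta>)"
  using assms by (cases "(X, \<eta>, \<zeta>, u)" rule: chain_map.cases) (simp_all, blast)

lemma chain_map_length: "chain_map X \<eta> \<zeta> u \<Longrightarrow> length \<eta> = length \<zeta>"
  by (induction X \<eta> \<zeta> u rule: chain_map.induct) auto

lemma chain_map_refl: "chain X \<zeta> \<Longrightarrow> chain_map X \<zeta> \<zeta> (Ident C (chain_end X \<zeta>))"
proof (induction X \<zeta> rule: chain.induct)
  case (2 X j P r Q \<zeta>)
  then have "conf Q P (chain_end X \<zeta>) j r" by simp
  then have "ar j Q P" "ar r P (chain_end X \<zeta>)" "Q \<in> Obj C" "P \<in> Obj C" "chain_end X \<zeta> \<in> Obj C"
    using conf_ar conf_Obj by blast+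
  then show ?case
    using 2 by (simp, intro exI[of _ "Ident C (chain_end X \<zeta>)"] conjI exI[of _ "Ident C P"]) simp_all
qed simp

lemma chain_map_trans:
  "chain X \<eta> \<Longrightarrow> chain X \<zeta> \<Longrightarrow> chain X \<xi> \<Longrightarrow> chain_map X \<eta> \<zeta> u \<Longrightarrow> chain_map X \<zeta> \<xi> v \<Longrightarrow> chain_map X \<eta> \<xi> (v \<cdot> u)"
proof (induction X \<eta> \<zeta> u arbitrary: \<xi> v rule: chain_map.induct)
  case (1 X u)
  then show ?case by (cases \<xi>) simp_all
next
  case (2 X j P r Q \<eta> i Z p K \<zeta> u)
  obtain k Y q L \<xi>' where \<xi>: "\<xi> = (k, Y, q, L) # \<xi>'" using 2(6) by (cases \<xi>) auto
  obtain u' g where u: "chain_map X \<eta> \<zeta> u'" "ar g P Z" "ar u Q K" "p \<cdot> g = u' \<cdot> r" "g \<cdot> j = i \<cdot> u"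
    using 2(5) by (simp del: ar_iff) blast
  obtain v' g' where v: "chain_map X \<zeta> \<xi>' v'" "ar g' Z Y" "ar v K L" "q \<cdot> g' = v' \<cdot> p" "g' \<cdot> i = k \<cdot> v"
    using 2(6) unfolding \<xi> by (simp del: ar_iff) blast
  have c: "conf Q P (chain_end X \<eta>) j r" "conf K Z (chain_end X \<zeta>) i p" "conf L Y (chain_end X \<xi>') k q"
    "chain X \<eta>" "chain X \<zeta>" "chain X \<xi>'" using 2 \<xi> by simp_all
  note ars = c(1-3)[THEN conf_ar] chain_map_ar[OF c(4) u(1)] chain_map_ar[OF c(5) v(1)] u(2,3) v(2,3)
  have 1: "q \<cdot> (g' \<cdot> g) = v' \<cdot> (u' \<cdot> r)"
    using comp_ext2[OF v(4), of g] u(4) ars by simp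
  have 2: "g' \<cdot> (g \<cdot> j) = k \<cdot> (v \<cdot> u)"
    unfolding u(5) using comp_ext2[OF v(5), of u] ars by simp
  have "chain_map X \<eta> \<xi>' (v' \<cdot> u')" using "2.IH" c(4-6) u(1) v(1) by blast
  then show ?case unfolding \<xi>
    using 1 2 ars by (simp, intro exI[of _ "v' \<cdot> u'"] conjI exI[of _ "g' \<cdot> g"]) simp_all
qed simp_all

lemma extends_last_chain_map:
  assumes "chain X \<eta>" "chain X \<zeta>" "chain_map X \<eta> \<zeta> u" "extends_last X \<zeta> B h"
  shows "extends_last X \<eta> B (h \<cdot> u)"
proof (cases "(X, \<eta>, \<zeta>, u)" rule: chain_map.cases)
  case (1 X u)
  then show ?thesis using assms by simp
next
  case (2 X' j P r Q \<eta>' i Z p K \<zeta>' u')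
  then have eq: "\<eta> = (j, P, r, Q) # \<eta>'" "\<zeta> = (i, Z, p, K) # \<zeta>'" by auto
  obtain g where g: "ar g P Z" "ar u Q K" "g \<cdot> j = i \<cdot> u"
    using assms(3) unfolding eq by (simp del: ar_iff) blast
  obtain t where t: "ar t Z B" "t \<cdot> i = h"
    using assms(4) unfolding eq by (simp del: ar_iff) blast
  have c: "conf Q P (chain_end X \<eta>') j r" "conf K Z (chain_end X \<zeta>') i p" using assms eq by simp_all
  note ars = c[THEN conf_ar] g(1,2) t(1)
  have "(t \<cdot> g) \<cdot> j = h \<cdot> u" using comp_ext[OF t(2), of u] g(3) ars by simp
  then show ?thesis unfolding eq
    using ars by (simp del: assoc) (intro exI[of _ "t \<cdot> g"], simp del: assoc)
qed (use assms in auto)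

lemma extends_last_add:
  assumes "chain X \<zeta>" "extends_last X \<zeta> B h" "extends_last X \<zeta> B k"
  shows "extends_last X \<zeta> B (h \<oplus> k)"
proof (cases \<zeta>)
  case Nil
  then show ?thesis using assms by simp
next
  case (Cons c \<zeta>')
  obtain j P r Q where c: "c = (j, P, r, Q)" by (cases c)
  obtain s t where st: "ar s P B" "s \<cdot> j = h" "ar t P B" "t \<cdot> j = k"
    using assms unfolding Cons c by (simp del: ar_iff) blast
  have "conf Q P (chain_end X \<zeta>') j r" using assms(1) unfolding Cons c by simp
  then have "ar j Q P" using conf_ar by blast
  then have "(s \<oplus> t) \<cdot> j = h \<oplus> k" using st by simp
  moreover have "ar (s \<oplus> t) P B" using st by simp
  ultimately show ?thesis unfolding Cons c extends_last.simps by blast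
qed

text \<open>\<open>h\<close> extends to \<open>t\<close> on the last middle term \<open>P\<close>.
  Replacing \<open>P\<close> by the pullback \<open>W\<close> of \<open>c\<close> along
  \<open>t\<close> makes a lift of \<open>t\<close> available, and its restriction lifts
  \<open>h\<close>. For the empty chain \<open>h\<close> is zero and lifts to zero.\<close>

lemma refine_last:
  assumes \<eta>: "chain X \<eta>" and h: "extends_last X \<eta> D h" and c: "conf A B D a c"
  obtains \<eta>' u h' where "chain X \<eta>'" "chain_map X \<eta>' \<eta> u" "extends_last X \<eta>' B h'" "ar h' (chain_end
    X \<eta>') B" "c \<cdot> h' = h \<cdot> u"
proof (cases \<eta>)
  case Nil
  have "chain X []" "chain_map X [] \<eta> (Ident C X)" "extends_last X [] B (Zero C X B)"
    "ar (Zero C X B) (chain_end X []) B" "c \<cdot> Zero C X B = h \<cdot> Ident C X"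
    using assms conf_Obj[OF c] conf_ar[OF c] unfolding Nil by simp_all
  then show ?thesis using that by blast
next
  case (Cons x \<eta>0)
  obtain j P r Q where x: "x = (j, P, r, Q)" by (cases x)
  obtain t where t: "ar t P D" "t \<cdot> j = h" using h unfolding Cons x by (simp del: ar_iff) blast
  have jr: "conf Q P (chain_end X \<eta>0) j r" and \<eta>0: "chain X \<eta>0" using \<eta> unfolding Cons x by simp_all
  obtain W k w t' where w: "conf A W P k w" "ar t' W B" "c \<cdot> t' = t \<cdot> w"
    using conf_pullback[OF c t(1)] by metis
  have ars: "ar j Q P \<and> ar r P (chain_end X \<eta>0)" "ar k A W \<and> ar w W P" "ar c B D"
    using conf_ar jr w c by blast+
  have "deflation C (r \<cdot> w)" "ar (r \<cdot> w) W (chain_end X \<eta>0)"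
    using deflation_comp[of w W P r "chain_end X \<eta>0"] conf_deflation jr w ars by (blast, simp)
  then obtain Q' j' where j': "conf Q' W (chain_end X \<eta>0) j' (r \<cdot> w)"
    using deflation_conf by metis
  have ar': "ar j' Q' W" using conf_ar[OF j'] by blast
  have "r \<cdot> (w \<cdot> j') = Zero C Q' (chain_end X \<eta>0)" using conf_comp[OF j'] ars ar' by simp
  then obtain u where u: "ar u Q' Q" "j \<cdot> u = w \<cdot> j'"
    using conf_lift[OF jr, of "w \<cdot> j'" Q'] ars ar' by auto
  have 1: "chain X ((j', W, r \<cdot> w, Q') # \<eta>0)" using j' \<eta>0 by simp
  have 2: "chain_map X ((j', W, r \<cdot> w, Q') # \<eta>0) \<eta> u"
    unfolding Cons x chain_map.simps
    by (intro exI[of _ "Ident C (chain_end X \<eta>0)"] exI[of _ w] conjI chain_map_refl \<eta>0)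
      (use u ars in simp_all)
  have 3: "extends_last X ((j', W, r \<cdot> w, Q') # \<eta>0) B (t' \<cdot> j')" using w(2) by auto
  have 4: "c \<cdot> (t' \<cdot> j') = h \<cdot> u"
    using comp_ext2[OF w(3), of j'] comp_ext[OF t(2), of u] u(2) w(2) t(1) u(1) ars ar' by simp
  show ?thesis using that[OF 1 2 3 _ 4] w(2) ar' by simp
qed

text \<open>Two conflations are dominated by one over \<open>K\<close>: pull back the first along
  \<open>u1\<close>, then the second along the map so obtained into \<open>K2\<close>, and compose
  the two deflations.\<close>

lemma common_step:
  assumes c1: "conf Q1 P1 K1 j1 r1" and c2: "conf Q2 P2 K2 j2 r2"
    and u1: "ar u1 K K1" and u2: "ar u2 K K2"
  obtains Q P j r g1 g2 n1 n2 where "conf Q P K j r" "ar g1 P P1" "ar g2 P P2"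
    "ar n1 Q Q1" "ar n2 Q Q2" "r1 \<cdot> g1 = u1 \<cdot> r" "r2 \<cdot> g2 = u2 \<cdot> r"
    "g1 \<cdot> j = j1 \<cdot> n1" "g2 \<cdot> j = j2 \<cdot> n2"
proof -
  obtain S js rs a1 where S: "conf Q1 S K js rs" "ar a1 S P1" "r1 \<cdot> a1 = u1 \<cdot> rs"
    using conf_pullback[OF c1 u1] by metis
  have rs: "ar rs S K" "ar js Q1 S" using conf_ar[OF S(1)] by auto
  have "ar (u2 \<cdot> rs) S K2" using rs u2 by simp
  then obtain P jt rt g2 where P: "conf Q2 P S jt rt" "ar g2 P P2" "r2 \<cdot> g2 = (u2 \<cdot> rs) \<cdot> rt"
    using conf_pullback[OF c2] by metis
  have rt: "ar rt P S" using conf_ar[OF P(1)] by auto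
  have "deflation C (rs \<cdot> rt)" "ar (rs \<cdot> rt) P K"
    using deflation_comp[OF rt rs(1)] conf_deflation S(1) P(1) rs rt by (blast, simp)
  then obtain Q j where c: "conf Q P K j (rs \<cdot> rt)" using deflation_conf by metis
  note ars = rs rt S(2) P(2) u1 u2 conf_ar[OF c1] conf_ar[OF c2] conf_ar[OF c]
  have z: "rs \<cdot> (rt \<cdot> j) = Zero C Q K" using conf_comp[OF c] ars by simp
  have Q: "Q \<in> Obj C" using conf_Obj[OF c] by simp
  have 1: "r1 \<cdot> (a1 \<cdot> rt) = u1 \<cdot> (rs \<cdot> rt)" using comp_ext2[OF S(3), of rt] ars by simp
  have 2: "r2 \<cdot> g2 = u2 \<cdot> (rs \<cdot> rt)" unfolding P(3) using ars by simp
  have "r1 \<cdot> ((a1 \<cdot> rt) \<cdot> j) = Zero C Q K1"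
    using comp_ext2[OF 1, of j] ars z Q ar_Obj[OF u1] by simp
  then obtain n1 where n1: "ar n1 Q Q1" "j1 \<cdot> n1 = (a1 \<cdot> rt) \<cdot> j"
    using conf_lift[OF c1, of "(a1 \<cdot> rt) \<cdot> j" Q] ars by auto
  have "r2 \<cdot> (g2 \<cdot> j) = Zero C Q K2"
    using comp_ext2[OF 2, of j] ars z Q ar_Obj[OF u2] by simp
  then obtain n2 where n2: "ar n2 Q Q2" "j2 \<cdot> n2 = g2 \<cdot> j"
    using conf_lift[OF c2, of "g2 \<cdot> j" Q] ars by auto
  show ?thesis
    by (rule that[OF c _ P(2) n1(1) n2(1) 1 2 n1(2)[symmetric] n2(2)[symmetric]]) (use ars in simp)
qed

text \<open>Takes over the role of comparison with a projective resolution.\<close>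

lemma common_refinement:
  assumes "length \<zeta>1 = length \<zeta>2" "chain X \<zeta>1" "chain X \<zeta>2"
  shows "\<exists>\<eta> u1 u2. chain X \<eta> \<and> chain_map X \<eta> \<zeta>1 u1 \<and> chain_map X \<eta> \<zeta>2 u2"
  using assms
proof (induction \<zeta>1 \<zeta>2 rule: list_induct2)
  case Nil
  then show ?case by (intro exI[of _ "[]"]) auto
next
  case (Cons x1 \<zeta>1 x2 \<zeta>2)
  obtain j1 P1 r1 Q1 where x1: "x1 = (j1, P1, r1, Q1)" by (cases x1)
  obtain j2 P2 r2 Q2 where x2: "x2 = (j2, P2, r2, Q2)" by (cases x2)
  have c: "conf Q1 P1 (chain_end X \<zeta>1) j1 r1" "chain X \<zeta>1" "conf Q2 P2 (chain_end X \<zeta>2) j2 r2"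
    "chain X \<zeta>2"
    using Cons.prems x1 x2 by simp_all
  obtain \<eta> u1 u2 where \<eta>: "chain X \<eta>" "chain_map X \<eta> \<zeta>1 u1" "chain_map X \<eta> \<zeta>2 u2"
    using Cons.IH[OF c(2,4)] by blast
  obtain Q P j r g1 g2 n1 n2 where *: "conf Q P (chain_end X \<eta>) j r" "ar g1 P P1" "ar g2 P P2"
    "ar n1 Q Q1" "ar n2 Q Q2" "r1 \<cdot> g1 = u1 \<cdot> r" "r2 \<cdot> g2 = u2 \<cdot> r"
    "g1 \<cdot> j = j1 \<cdot> n1" "g2 \<cdot> j = j2 \<cdot> n2"
    using common_step[OF c(1,3) chain_map_ar[OF \<eta>(1,2)] chain_map_ar[OF \<eta>(1,3)]] by metis
  have "chain X ((j, P, r, Q) # \<eta>)" "chain_map X ((j, P, r, Q) # \<eta>) (x1 # \<zeta>1) n1"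
    "chain_map X ((j, P, r, Q) # \<eta>) (x2 # \<zeta>2) n2"
    unfolding x1 x2 chain_map.simps chain.simps using * \<eta> by blast+
  then show ?case by blast
qed

text \<open>Two chain maps into the same chain become homotopic after a refinement; on the ends, the
  homotopy leaves a difference which extends over the last inflation.\<close>

lemma common_refinement_over:
  assumes "chain X \<xi>" "chain X \<zeta>1" "chain X \<zeta>2" "chain_map X \<zeta>1 \<xi> v1" "chain_map X \<zeta>2 \<xi> v2"
  shows "\<exists>\<eta> u1 u2 b. chain X \<eta> \<and> chain_map X \<eta> \<zeta>1 u1 \<and> chain_map X \<eta> \<zeta>2 u2 \<and> extends_last X \<eta>
    (chain_end X \<xi>) b \<and>
    ar b (chain_end X \<eta>) (chain_end X \<xi>) \<and> v1 \<cdot> u1 = (v2 \<cdot> u2) \<oplus> b"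
  using assms
proof (induction \<xi> arbitrary: \<zeta>1 \<zeta>2 v1 v2)
  case Nil
  then have "\<zeta>1 = []" "\<zeta>2 = []" by (auto dest: chain_map_length)
  then have "\<zeta>1 = []" "\<zeta>2 = []" "v1 = Ident C X" "v2 = Ident C X" "X \<in> Obj C"
    using Nil by simp_all
  then show ?case
    by (intro exI[of _ "[]"] exI[of _ "Ident C X"] exI[of _ "Zero C X X"]) simp
next
  case (Cons x \<xi>)
  obtain i Z p K where x: "x = (i, Z, p, K)" by (cases x)
  obtain j1 P1 r1 Q1 \<zeta>1' where \<zeta>1: "\<zeta>1 = (j1, P1, r1, Q1) # \<zeta>1'"
    using Cons.prems(4) by (cases \<zeta>1) (auto dest: chain_map_length)
  obtain j2 P2 r2 Q2 \<zeta>2' where \<zeta>2: "\<zeta>2 = (j2, P2, r2, Q2) # \<zeta>2'"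
    using Cons.prems(5) by (cases \<zeta>2) (auto dest: chain_map_length)
  have c: "conf K Z (chain_end X \<xi>) i p" "chain X \<xi>" "conf Q1 P1 (chain_end X \<zeta>1') j1 r1" "chain X \<zeta>1'"
    "conf Q2 P2 (chain_end X \<zeta>2') j2 r2" "chain X \<zeta>2'"
    using Cons.prems x \<zeta>1 \<zeta>2 by simp_all
  obtain v1' g1 where v1: "chain_map X \<zeta>1' \<xi> v1'" "ar g1 P1 Z" "ar v1 Q1 K" "p \<cdot> g1 = v1' \<cdot> r1"
    "g1 \<cdot> j1 = i \<cdot> v1" using Cons.prems(4) unfolding \<zeta>1 x by (simp del: ar_iff) blast
  obtain v2' g2 where v2: "chain_map X \<zeta>2' \<xi> v2'" "ar g2 P2 Z" "ar v2 Q2 K" "p \<cdot> g2 = v2' \<cdot> r2"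
    "g2 \<cdot> j2 = i \<cdot> v2" using Cons.prems(5) unfolding \<zeta>2 x by (simp del: ar_iff) blast
  obtain \<eta>0 w1 w2 b0 where \<eta>0: "chain X \<eta>0" "chain_map X \<eta>0 \<zeta>1' w1" "chain_map X \<eta>0 \<zeta>2' w2"
    "extends_last X \<eta>0 (chain_end X \<xi>) b0" "ar b0 (chain_end X \<eta>0) (chain_end X \<xi>)" "v1' \<cdot> w1 = (v2'
      \<cdot> w2) \<oplus> b0"
    using Cons.IH[OF c(2,4,6) v1(1) v2(1)] by blast
  \<comment> \<open>The homotopy \<open>b0\<close> found for the shorter chains is lifted along the
    deflation \<open>p\<close>, at the price of one more refinement \<open>w\<close>.\<close>
  obtain \<eta> w b where \<eta>: "chain X \<eta>" "chain_map X \<eta> \<eta>0 w" "extends_last X \<eta> Z b" "ar b (chain_end X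
    \<eta>) Z" "p \<cdot> b = b0 \<cdot> w"
    using refine_last[OF \<eta>0(1,4) c(1)] by metis
  have w: "ar w (chain_end X \<eta>) (chain_end X \<eta>0)" using chain_map_ar[OF \<eta>(1,2)] .
  have u1: "chain_map X \<eta> \<zeta>1' (w1 \<cdot> w)" "ar w1 (chain_end X \<eta>0) (chain_end X \<zeta>1')"
    using chain_map_trans[OF \<eta>(1) \<eta>0(1) c(4) \<eta>(2) \<eta>0(2)] chain_map_ar[OF \<eta>0(1,2)] by blast+
  have u2: "chain_map X \<eta> \<zeta>2' (w2 \<cdot> w)" "ar w2 (chain_end X \<eta>0) (chain_end X \<zeta>2')"
    using chain_map_trans[OF \<eta>(1) \<eta>0(1) c(6) \<eta>(2) \<eta>0(3)] chain_map_ar[OF \<eta>0(1,3)] by blast+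
  obtain Q P j r a1 a2 n1 n2 where *: "conf Q P (chain_end X \<eta>) j r" "ar a1 P P1" "ar a2 P P2"
    "ar n1 Q Q1" "ar n2 Q Q2" "r1 \<cdot> a1 = (w1 \<cdot> w) \<cdot> r" "r2 \<cdot> a2 = (w2 \<cdot> w) \<cdot> r"
    "a1 \<cdot> j = j1 \<cdot> n1" "a2 \<cdot> j = j2 \<cdot> n2"
    using common_step[OF c(3,5) chain_map_ar[OF \<eta>(1) u1(1)] chain_map_ar[OF \<eta>(1) u2(1)]] by metis
  have 1: "chain X ((j, P, r, Q) # \<eta>)" "chain_map X ((j, P, r, Q) # \<eta>) \<zeta>1 n1"
    "chain_map X ((j, P, r, Q) # \<eta>) \<zeta>2 n2"
    unfolding \<zeta>1 \<zeta>2 chain_map.simps chain.simps using * \<eta>(1) u1 u2 by blast+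
  have v': "ar v1' (chain_end X \<zeta>1') (chain_end X \<xi>)" "ar v2' (chain_end X \<zeta>2') (chain_end X \<xi>)"
    using chain_map_ar[OF c(4) v1(1)] chain_map_ar[OF c(6) v2(1)] .
  note ars = c(1,3,5)[THEN conf_ar] v1(2,3) v2(2,3) \<eta>0(5) w u1(2) u2(2) conf_ar[OF *(1)] *(2-5) \<eta>(4) v'
  have "p \<cdot> (g1 \<cdot> a1) = v1' \<cdot> ((w1 \<cdot> w) \<cdot> r)"
    using comp_ext2[OF v1(4), of a1] *(6) ars by simp
  also have "\<dots> = (v1' \<cdot> w1) \<cdot> (w \<cdot> r)" using ars by simp
  also have "\<dots> = (v2' \<cdot> ((w2 \<cdot> w) \<cdot> r)) \<oplus> ((b0 \<cdot> w) \<cdot> r)" unfolding \<eta>0(6) using ars by simp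
  also have "\<dots> = (p \<cdot> (g2 \<cdot> a2)) \<oplus> (p \<cdot> (b \<cdot> r))"
    using comp_ext2[OF v2(4), of a2] *(7) comp_ext[OF \<eta>(5), of r] ars by simp
  also have "\<dots> = p \<cdot> ((g2 \<cdot> a2) \<oplus> (b \<cdot> r))" using ars by simp
  finally have "p \<cdot> (g1 \<cdot> a1) = p \<cdot> ((g2 \<cdot> a2) \<oplus> (b \<cdot> r))" .
  \<comment> \<open>Corrected by \<open>b \<cdot> r\<close>, the two maps into \<open>Z\<close>
    agree after \<open>p\<close>, so they differ by a map \<open>h\<close> into \<open>K\<close>.
    Its restriction along \<open>j\<close> is the difference on the new ends, and \<open>h\<close>
    extends it by construction.\<close>
  then obtain h where h: "ar h P K" "g1 \<cdot> a1 = ((g2 \<cdot> a2) \<oplus> (b \<cdot> r)) \<oplus> (i \<cdot> h)"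
    using conf_lift_diff[OF c(1), of "g1 \<cdot> a1" P "(g2 \<cdot> a2) \<oplus> (b \<cdot> r)"] ars by auto
  have Q: "Q \<in> Obj C" "Z \<in> Obj C" "K \<in> Obj C" using conf_Obj[OF *(1)] conf_Obj[OF c(1)] by simp_all
  have rj: "r \<cdot> j = Zero C Q (chain_end X \<eta>)" using conf_comp[OF *(1)] .
  have "i \<cdot> (v1 \<cdot> n1) = g1 \<cdot> (a1 \<cdot> j)" using comp_ext2[OF v1(5), of n1] *(8) ars by simp
  also have "\<dots> = (g1 \<cdot> a1) \<cdot> j" using ars by simp
  also have "\<dots> = ((g2 \<cdot> (a2 \<cdot> j)) \<oplus> (b \<cdot> (r \<cdot> j))) \<oplus> (i \<cdot> (h \<cdot> j))"
    unfolding h(2) using ars h(1) by simp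
  also have "\<dots> = (g2 \<cdot> (j2 \<cdot> n2)) \<oplus> (i \<cdot> (h \<cdot> j))" unfolding rj *(9) using ars h(1) Q by simp
  also have "g2 \<cdot> (j2 \<cdot> n2) = i \<cdot> (v2 \<cdot> n2)" using comp_ext2[OF v2(5), of n2] ars by simp
  finally have "i \<cdot> (v1 \<cdot> n1) = i \<cdot> ((v2 \<cdot> n2) \<oplus> (h \<cdot> j))" using ars h(1) by simp
  then have 2: "v1 \<cdot> n1 = (v2 \<cdot> n2) \<oplus> (h \<cdot> j)"
    by (rule conf_mono[OF c(1), rotated 2]) (use ars h(1) in simp_all)
  have "extends_last X ((j, P, r, Q) # \<eta>) (chain_end X (x # \<xi>)) (h \<cdot> j)"
    "ar (h \<cdot> j) (chain_end X ((j, P, r, Q) # \<eta>)) (chain_end X (x # \<xi>))"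
    unfolding x using h(1) ars by auto
  then show ?case using 1 2 by blast
qed

text \<open>On a common refinement over \<open>\<zeta>'\<close>, the composites through
  \<open>\<zeta>\<close> and through \<open>\<eta>\<close> differ by a map that extends over the
  last inflation. So triviality witnessed by \<open>\<eta>\<close> passes to \<open>h\<close> on a
  refinement of \<open>\<zeta>\<close>.\<close>

lemma extends_last_transfer:
  assumes ch: "chain X \<zeta>" "chain X \<zeta>'" "chain X \<eta>" and h: "chain_map X \<zeta> \<zeta>' h"
    and u: "chain_map X \<eta> \<zeta>' u" "extends_last X \<eta> (chain_end X \<zeta>') u"
  obtains \<eta>' w where "chain X \<eta>'" "chain_map X \<eta>' \<zeta> w" "extends_last X \<eta>' (chain_end X \<zeta>') (h \<cdot> w)"
proof -
  obtain \<eta>' w w' b where *: "chain X \<eta>'" "chain_map X \<eta>' \<zeta> w" "chain_map X \<eta>' \<eta> w'" "extends_last X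
    \<eta>' (chain_end X \<zeta>') b"
    "h \<cdot> w = (u \<cdot> w') \<oplus> b"
    using common_refinement_over[OF ch(2,1,3) h u(1)] by blast
  have "extends_last X \<eta>' (chain_end X \<zeta>') (h \<cdot> w)"
    unfolding *(5) by (rule extends_last_add[OF *(1) extends_last_chain_map[OF *(1) ch(3) *(3) u(2)]
      *(4)])
  then show ?thesis using that * by blast
qed

section \<open>Vanishing of Ext by refinement, and dimension shifting\<close>

text \<open>The class obtained by pushing out \<open>\<zeta>\<close> along \<open>h\<close> is zero if and only if \<open>h\<close>, after a
  refinement, extends over the last inflation.  In this form the vanishing of Ext needs neither
  sums of extensions nor zigzags.\<close>

definition Ext_vanishes :: "nat \<Rightarrow> 'o \<Rightarrow> 'o \<Rightarrow> bool" where
  "Ext_vanishes n X B \<longleftrightarrow> (\<forall>\<zeta> h. chain X \<zeta> \<longrightarrow> length \<zeta> = n \<longrightarrow> ar h (chain_end X \<zeta>) B \<longrightarrow>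
     (\<exists>\<eta> u. chain X \<eta> \<and> chain_map X \<eta> \<zeta> u \<and> extends_last X \<eta> B (h \<cdot> u)))"

text \<open>A class that vanishes lifts along any deflation. In positive degrees this supplies the
  surjectivity hypothesis of \<open>Ext_vanishes_Suc\<close>.\<close>

lemma Ext_vanishes_lift:
  assumes Ext_vanishes: "Ext_vanishes n X D" and c: "conf A B D a c" and "chain X \<zeta>" "length \<zeta> = n"
    "ar h (chain_end X \<zeta>) D"
  obtains \<eta> u e where "chain X \<eta>" "chain_map X \<eta> \<zeta> u" "ar e (chain_end X \<eta>) B" "h \<cdot> u = c \<cdot> e"
proof -
  obtain \<eta> u where *: "chain X \<eta>" "chain_map X \<eta> \<zeta> u" "extends_last X \<eta> D (h \<cdot> u)" using assms
    unfolding Ext_vanishes_def by blast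
  obtain \<eta>' w e where **: "chain X \<eta>'" "chain_map X \<eta>' \<eta> w" "ar e (chain_end X \<eta>') B" "c \<cdot> e = (h \<cdot>
    u) \<cdot> w"
    using refine_last[OF *(1,3) c] by metis
  have "c \<cdot> e = h \<cdot> (u \<cdot> w)"
    unfolding **(4) using assms(5) chain_map_ar[OF *(1,2)] chain_map_ar[OF **(1,2)] by simp
  then show ?thesis using that[OF **(1) chain_map_trans[OF **(1) *(1) assms(3) **(2) *(2)] **(3)] by
    simp
qed

text \<open>Exactness of \<open>Ext\<^sup>n(X, E) \<rightarrow> Ext\<^sup>n(X, D) \<rightarrow> Ext\<^bsup>n+1\<^esup>(X, B) \<rightarrow> Ext\<^bsup>n+1\<^esup>(X, E)\<close>: the last
  hypothesis is surjectivity of the first map.\<close>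

lemma Ext_vanishes_Suc:
  assumes c: "conf B E D a c" and Ext_vanishes: "Ext_vanishes (Suc n) X E"
    and H: "\<And>\<zeta> h. chain X \<zeta> \<Longrightarrow> length \<zeta> = n \<Longrightarrow> ar h (chain_end X \<zeta>) D \<Longrightarrow>
      \<exists>\<eta> u e. chain X \<eta> \<and> chain_map X \<eta> \<zeta> u \<and> ar e (chain_end X \<eta>) E \<and> h \<cdot> u = c \<cdot> e"
  shows "Ext_vanishes (Suc n) X B"
  unfolding Ext_vanishes_def
proof (intro allI impI)
  fix \<zeta> h assume \<zeta>: "chain X \<zeta>" "length \<zeta> = Suc n" "ar h (chain_end X \<zeta>) B"
  have a: "ar a B E" "ar c E D" "c \<cdot> a = Zero C B D" and Obj: "D \<in> Obj C"
    using conf_ar[OF c] conf_comp[OF c] conf_Obj[OF c] by blast+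
  obtain \<eta> u where \<eta>: "chain X \<eta>" "chain_map X \<eta> \<zeta> u" "extends_last X \<eta> E ((a \<cdot> h) \<cdot> u)"
    using Ext_vanishes[unfolded Ext_vanishes_def, rule_format, OF \<zeta>(1,2), of "a \<cdot> h"] \<zeta>(3) a by auto
  obtain j P r Q \<eta>0 where \<eta>0: "\<eta> = (j, P, r, Q) # \<eta>0"
    using chain_map_length[OF \<eta>(2)] \<zeta>(2) by (cases \<eta>) auto
  have len: "length \<eta>0 = n" using chain_map_length[OF \<eta>(2)] \<zeta>(2) \<eta>0 by simp
  have jr: "conf Q P (chain_end X \<eta>0) j r" and ch: "chain X \<eta>0" using \<eta>(1) unfolding \<eta>0 by simp_all
  obtain t where t: "ar t P E" "t \<cdot> j = (a \<cdot> h) \<cdot> u" using \<eta>(3) unfolding \<eta>0 by (simp del: ar_iff) blast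
  have u: "ar u Q (chain_end X \<zeta>)" using chain_map_ar[OF \<eta>(1,2)] \<eta>0 by simp
  note ars = a(1,2) conf_ar[OF jr] t(1) u \<zeta>(3)
  have Q: "Q \<in> Obj C" using conf_Obj[OF jr] by simp
  \<comment> \<open>Inverting the connecting map: \<open>s\<close> represents a class of degree
    \<open>n\<close> with values in \<open>D\<close> that is sent to the class of
    \<open>h\<close>.\<close>
  have "(c \<cdot> t) \<cdot> j = c \<cdot> (a \<cdot> (h \<cdot> u))" using t(2) ars by simp
  also have "\<dots> = Zero C Q D" using comp_ext[OF a(3), of "h \<cdot> u"] ars Obj by simp
  finally obtain s where s: "ar s (chain_end X \<eta>0) D" "s \<cdot> r = c \<cdot> t"
    using conf_colift[OF jr, of "c \<cdot> t" D] ars by auto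
  obtain \<eta>1 w e where w: "chain X \<eta>1" "chain_map X \<eta>1 \<eta>0 w" "ar e (chain_end X \<eta>1) E" "s \<cdot> w = c \<cdot> e"
    using H[OF ch len s(1)] by blast
  have war: "ar w (chain_end X \<eta>1) (chain_end X \<eta>0)" using chain_map_ar[OF w(1,2)] .
  obtain P2 j2 r2 g where g: "conf Q P2 (chain_end X \<eta>1) j2 r2" "ar g P2 P" "r \<cdot> g = w \<cdot> r2" "g \<cdot> j2
    = j"
    using conf_pullback[OF jr war] by metis
  note ars = ars s(1) w(3) war conf_ar[OF g(1)] g(2)
  have "c \<cdot> (t \<cdot> g) = s \<cdot> (w \<cdot> r2)"
    using comp_ext2[OF s(2)[symmetric], of g] g(3) ars by simp
  also have "\<dots> = c \<cdot> (e \<cdot> r2)" using comp_ext2[OF w(4), of r2] ars by simp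
  \<comment> \<open>Subtracting the lift \<open>e \<cdot> r2\<close> from \<open>t \<cdot> g\<close>
    leaves a map into \<open>B\<close>. This correction \<open>h'\<close> is the wanted extension of
    \<open>h \<cdot> u\<close>.\<close>
  finally obtain h' where h': "ar h' P2 B" "t \<cdot> g = (e \<cdot> r2) \<oplus> (a \<cdot> h')"
    using conf_lift_diff[OF c, of "t \<cdot> g" P2 "e \<cdot> r2"] ars by auto
  have "a \<cdot> (h \<cdot> u) = (t \<cdot> g) \<cdot> j2" using g(4) t(2) ars by simp
  also have "\<dots> = (e \<cdot> (r2 \<cdot> j2)) \<oplus> (a \<cdot> (h' \<cdot> j2))" unfolding h'(2) using ars h'(1) by simp
  also have "\<dots> = a \<cdot> (h' \<cdot> j2)" unfolding conf_comp[OF g(1)] using ars h'(1) Q by simp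
  finally have eq: "h \<cdot> u = h' \<cdot> j2" by (rule conf_mono[OF c, rotated 2]) (use ars h'(1) in simp_all)
  have ch2: "chain X ((j2, P2, r2, Q) # \<eta>1)" using g(1) w(1) by simp
  have "chain_map X ((j2, P2, r2, Q) # \<eta>1) \<eta> (Ident C Q)"
    unfolding \<eta>0 chain_map.simps by (intro exI[of _ w] exI[of _ g] conjI w(2)) (use g(3,4) ars Q in
      simp_all)
  then have "chain_map X ((j2, P2, r2, Q) # \<eta>1) \<zeta> (u \<cdot> Ident C Q)" by (rule chain_map_trans[OF ch2
    \<eta>(1) \<zeta>(1) _ \<eta>(2)])
  then have "chain_map X ((j2, P2, r2, Q) # \<eta>1) \<zeta> u" using u by simp
  moreover have "extends_last X ((j2, P2, r2, Q) # \<eta>1) B (h \<cdot> u)" unfolding eq extends_last.simps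
    using h'(1) by blast
  ultimately show "\<exists>\<eta> u. chain X \<eta> \<and> chain_map X \<eta> \<zeta> u \<and> extends_last X \<eta> B (h \<cdot> u)" using ch2 by blast
qed

end

section \<open>Chains and Yoneda extensions\<close>

text \<open>\<open>r\<close> may be an equivalence on more than \<open>A\<close>: the closure in
  \<open>yoneda_Ext\<close> is reflexive on the whole type of complexes.\<close>

lemma is_singleton_quotient_iff:
  assumes "sym r" "trans r" "\<And>x. x \<in> A \<Longrightarrow> (x, x) \<in> r"
  shows "is_singleton (A // r) \<longleftrightarrow> A \<noteq> {} \<and> (\<forall>x\<in>A. \<forall>y\<in>A. (x, y) \<in> r)"
proof -
  have eq: "r `` {x} = r `` {y}" if "(x, y) \<in> r" for x y
    using that assms(1,2) by (meson equivE Image_singleton_iff subset_antisym subsetI symD transD)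
  show ?thesis
  proof
    assume *: "is_singleton (A // r)"
    then obtain c where c: "A // r = {c}" by (rule is_singletonE)
    then have "r `` {x} = c" if "x \<in> A" for x using quotientI[OF that, of r] by auto
    then have "(x, y) \<in> r" if "x \<in> A" "y \<in> A" for x y using that assms(3) by blast
    moreover have "A \<noteq> {}" using c by auto
    ultimately show "A \<noteq> {} \<and> (\<forall>x\<in>A. \<forall>y\<in>A. (x, y) \<in> r)" by blast
  next
    assume *: "A \<noteq> {} \<and> (\<forall>x\<in>A. \<forall>y\<in>A. (x, y) \<in> r)"
    then obtain a where a: "a \<in> A" by blast
    have "A // r = {r `` {a}}"
      using a * eq unfolding quotient_def by blast
    then show "is_singleton (A // r)" by simp
  qed
qed

lemma Ext_zero_iff:
  "Ext_zero C n A B \<longleftrightarrow> extensions C n A B \<noteq> {} \<and>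
     (\<forall>x\<in>extensions C n A B. \<forall>y\<in>extensions C n A B.
        (x, y) \<in> (extension_map C n A B \<union> (extension_map C n A B)\<inverse>)\<^sup>*)"
  unfolding Ext_zero_def yoneda_Ext_def
proof (rule is_singleton_quotient_iff)
  show "sym ((extension_map C n A B \<union> (extension_map C n A B)\<inverse>)\<^sup>*)"
    by (intro sym_rtrancl) (auto simp: sym_def)
qed (auto simp: trans_rtrancl)

context exact_category
begin

lemma conf_zero_iso_left:
  assumes c: "conf A B Z a z" and Z: "zero_object C Z"
  shows "isomorphism C A B a"
proof -
  have ar: "ar a A B" "ar z B Z" and Obj: "A \<in> Obj C" "B \<in> Obj C" "Z \<in> Obj C"
    using conf_ar[OF c] conf_Obj[OF c] by blast+
  have "z = Zero C B Z" using zero_object_ar(1)[OF Z Obj(2)] ar by blast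
  then have "z \<cdot> Ident C B = Zero C B Z" using ar by simp
  then obtain h where h: "ar h B A" "a \<cdot> h = Ident C B" using conf_lift[OF c, of "Ident C B" B] Obj
    by auto
  have "a \<cdot> (h \<cdot> a) = a \<cdot> Ident C A" using comp_ext[OF h(2), of a] ar h(1) by simp
  then have "h \<cdot> a = Ident C A" by (rule conf_mono[OF c, rotated 2]) (use ar h(1) Obj in simp_all)
  then show ?thesis unfolding isomorphism_iff using ar h by blast
qed

lemma conf_zero_iso_right:
  assumes "conf Z B D z p" "zero_object C Z"
  shows "isomorphism C B D p"
proof -
  interpret op: exact_category "op_cat C" by (rule op_exact_category)
  show ?thesis using op.conf_zero_iso_left[of D B Z p z] assms by simp
qed

text \<open>The identity for the empty chain lets the differential next to \<open>X\<close> follow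
  the same splicing rule as all others.\<close>

fun last_inflation :: "'o \<Rightarrow> ('m \<times> 'o \<times> 'm \<times> 'o) list \<Rightarrow> 'm" where
  "last_inflation X [] = Ident C X"
| "last_inflation X ((j, P, r, Q) # \<zeta>) = j"

text \<open>The complex \<open>(Y, f)\<close> is composed of the conflations of the chain; only \<open>Y k\<close> for
  \<open>k \<le> length \<zeta>\<close> and \<open>f k\<close> for \<open>k < length \<zeta>\<close> are constrained.\<close>

fun spliced :: "'o \<Rightarrow> ('m \<times> 'o \<times> 'm \<times> 'o) list \<Rightarrow> (nat \<Rightarrow> 'o) \<Rightarrow> (nat \<Rightarrow> 'm) \<Rightarrow> bool" where
  "spliced X [] Y f \<longleftrightarrow> Y 0 = X"
| "spliced X ((j, P, r, Q) # \<zeta>) Y f \<longleftrightarrow> spliced X \<zeta> Y f \<and> Y (Suc (length \<zeta>)) = P \<and>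
     f (length \<zeta>) = last_inflation X \<zeta> \<cdot> r"

definition spliced_extension :: "'o \<Rightarrow> ('m \<times> 'o \<times> 'm \<times> 'o) list \<Rightarrow> (nat \<Rightarrow> 'o) \<Rightarrow> (nat \<Rightarrow> 'm) \<Rightarrow> bool" where
  "spliced_extension X \<zeta> Y f \<longleftrightarrow> spliced X \<zeta> Y f \<and> Y (Suc (length \<zeta>)) = chain_end X \<zeta> \<and> f (length \<zeta>) =
    last_inflation X \<zeta>"

lemma spliced_cong:
  assumes "\<And>k. k \<le> length \<zeta> \<Longrightarrow> Y k = Y' k" "\<And>k. k < length \<zeta> \<Longrightarrow> f k = f' k"
  shows "spliced X \<zeta> Y f \<longleftrightarrow> spliced X \<zeta> Y' f'"
  using assms by (induction X \<zeta> Y f rule: spliced.induct) auto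

lemma ex_spliced: "\<exists>Y f. spliced X \<zeta> Y f"
proof (induction \<zeta>)
  case Nil
  then show ?case by (intro exI[of _ "\<lambda>_. X"]) simp
next
  case (Cons x \<zeta>)
  then obtain Y f where *: "spliced X \<zeta> Y f" by blast
  obtain j P r Q where x: "x = (j, P, r, Q)" by (cases x)
  have "spliced X \<zeta> (Y(Suc (length \<zeta>) := P)) (f(length \<zeta> := last_inflation X \<zeta> \<cdot> r))"
    using * by (subst spliced_cong[where Y' = Y and f' = f]) auto
  then show ?case unfolding x
    by (intro exI[of _ "Y(Suc (length \<zeta>) := P)"] exI[of _ "f(length \<zeta> := last_inflation X \<zeta> \<cdot> r)"])
      (simp add: fun_upd_def)
qed

lemma ex_spliced_extension: "\<exists>Y f. spliced_extension X \<zeta> Y f"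
proof -
  obtain Y f where "spliced X \<zeta> Y f" using ex_spliced by blast
  then have "spliced X \<zeta> (Y(Suc (length \<zeta>) := chain_end X \<zeta>)) (f(length \<zeta> := last_inflation X \<zeta>))"
    by (subst spliced_cong[where Y' = Y and f' = f]) auto
  then show ?thesis unfolding spliced_extension_def by fastforce
qed

lemma last_inflation_ar:
  assumes "chain X \<zeta>" "spliced X \<zeta> Y f"
  shows "ar (last_inflation X \<zeta>) (chain_end X \<zeta>) (Y (length \<zeta>))"
proof (cases \<zeta>)
  case Nil
  then show ?thesis using assms by simp
next
  case (Cons x \<zeta>')
  obtain j P r Q where x: "x = (j, P, r, Q)" by (cases x)
  have "conf Q P (chain_end X \<zeta>') j r" "Y (length \<zeta>) = P" using assms unfolding Cons x by simp_all
  then show ?thesis using conf_ar unfolding Cons x by simp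
qed

lemma last_inflation_mono:
  assumes "chain X \<zeta>" "ar x T (chain_end X \<zeta>)" "ar y T (chain_end X \<zeta>)" "last_inflation X \<zeta> \<cdot> x =
    last_inflation X \<zeta> \<cdot> y"
  shows "x = y"
proof (cases \<zeta>)
  case Nil
  then show ?thesis using assms by simp
next
  case (Cons c \<zeta>')
  obtain j P r Q where c: "c = (j, P, r, Q)" by (cases c)
  have "conf Q P (chain_end X \<zeta>') j r" using assms unfolding Cons c by simp
  then show ?thesis using conf_mono assms(2-4) unfolding Cons c by simp
qed

lemma spliced_syzygies:
  assumes "chain X \<zeta>" "spliced X \<zeta> Y f"
  shows "\<exists>Z \<iota> \<pi>. zero_object C (Z 0) \<and>
    (\<forall>k\<le>length \<zeta>. conf (Z (Suc k)) (Y k) (Z k) (\<iota> k) (\<pi> k)) \<and>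
    Z (Suc (length \<zeta>)) = chain_end X \<zeta> \<and> \<iota> (length \<zeta>) = last_inflation X \<zeta> \<and>
    (\<forall>k<length \<zeta>. f k = \<iota> k \<cdot> \<pi> (Suc k))"
  using assms
proof (induction \<zeta>)
  case Nil
  then have "X \<in> Obj C" by simp
  \<comment> \<open>The outer conflation \<open>X \<rightarrow> X \<rightarrow> 0\<close>, which
    provides the zero object \<open>Z 0\<close> in the definition of acyclicity.\<close>
  then obtain Z p where Z: "conf X X Z (Ident C X) p" "zero_object C Z"
    using conf_zero_right by metis
  then show ?case using Nil
    by (intro exI[of _ "\<lambda>k. if k = 0 then Z else X"] exI[of _ "\<lambda>_. Ident C X"] exI[of _ "\<lambda>_. p"]) simp
next
  case (Cons x \<zeta>)
  obtain j P r Q where x: "x = (j, P, r, Q)" by (cases x)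
  have c: "conf Q P (chain_end X \<zeta>) j r" "chain X \<zeta>" and spliced: "spliced X \<zeta> Y f" "Y (Suc (length
    \<zeta>)) = P"
    "f (length \<zeta>) = last_inflation X \<zeta> \<cdot> r" using Cons.prems x by simp_all
  obtain Z \<iota> \<pi> where *: "zero_object C (Z 0)"
    "\<And>k. k \<le> length \<zeta> \<Longrightarrow> conf (Z (Suc k)) (Y k) (Z k) (\<iota> k) (\<pi> k)"
    "Z (Suc (length \<zeta>)) = chain_end X \<zeta>" "\<iota> (length \<zeta>) = last_inflation X \<zeta>"
    "\<And>k. k < length \<zeta> \<Longrightarrow> f k = \<iota> k \<cdot> \<pi> (Suc k)" using Cons.IH[OF c(2) spliced(1)] by blast
  define n where "n = Suc (length \<zeta>)"
  have "conf ((Z(Suc n := Q)) (Suc k)) (Y k) ((Z(Suc n := Q)) k) ((\<iota>(n := j)) k) ((\<pi>(n := r)) k)"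
    if "k \<le> n" for k
    using that *(2)[of k] c(1) spliced(2) *(3) by (cases "k = n") (auto simp: n_def)
  moreover have "f k = (\<iota>(n := j)) k \<cdot> (\<pi>(n := r)) (Suc k)" if "k < n" for k
    using that *(5)[of k] spliced(3) *(4) by (cases "k = length \<zeta>") (auto simp: n_def)
  ultimately show ?case unfolding x
    by (intro exI[of _ "Z(Suc n := Q)"] exI[of _ "\<iota>(n := j)"] exI[of _ "\<pi>(n := r)"])
      (use *(1) in \<open>simp add: n_def\<close>)
qed

lemma spliced_extension_acyclic:
  assumes ch: "chain X \<zeta>" and spliced: "spliced_extension X \<zeta> Y f"
  shows "acyclic_complex C (Suc (length \<zeta>)) (Y, f)"
proof -
  define n where "n = length \<zeta>"
  have B: "chain_end X \<zeta> \<in> Obj C" using chain_Obj[OF ch] by blast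
  \<comment> \<open>The conflation at the other end: zero, the end object, and its identity. It
    occupies position \<open>Suc n\<close>.\<close>
  obtain Z0 z where z: "conf Z0 (chain_end X \<zeta>) (chain_end X \<zeta>) z (Ident C (chain_end X \<zeta>))"
    "zero_object C Z0"
    using conf_zero[OF B] by metis
  obtain Z \<iota> \<pi> where *: "zero_object C (Z 0)"
    "\<And>k. k \<le> n \<Longrightarrow> conf (Z (Suc k)) (Y k) (Z k) (\<iota> k) (\<pi> k)"
    "Z (Suc n) = chain_end X \<zeta>" "\<iota> n = last_inflation X \<zeta>" "\<And>k. k < n \<Longrightarrow> f k = \<iota> k \<cdot> \<pi> (Suc k)"
    using spliced_syzygies[OF ch, of Y f] spliced unfolding spliced_extension_def n_def by blast
  define Z' \<iota>' \<pi>' where "Z' = Z(Suc (Suc n) := Z0)" and "\<iota>' = \<iota>(Suc n := z)"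
    and "\<pi>' = \<pi>(Suc n := Ident C (chain_end X \<zeta>))"
  have Y: "Y (Suc n) = chain_end X \<zeta>" "f n = last_inflation X \<zeta>" using spliced unfolding
    spliced_extension_def n_def by auto
  have c: "conf (Z' (Suc k)) (Y k) (Z' k) (\<iota>' k) (\<pi>' k)" if "k \<le> Suc n" for k
    using that *(2)[of k] z(1) Y *(3) unfolding Z'_def \<iota>'_def \<pi>'_def by (cases "k = Suc n") auto
  have last: "ar (last_inflation X \<zeta>) (chain_end X \<zeta>) (Y n)"
    using last_inflation_ar[OF ch] spliced unfolding spliced_extension_def n_def by blast
  have f: "f k = \<iota>' k \<cdot> \<pi>' (Suc k)" if "k < Suc n" for k
  proof (cases "k = n")
    case True
    then show ?thesis unfolding \<iota>'_def \<pi>'_def using Y(2) *(4) last by simp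
  next
    case False
    then show ?thesis using that *(5)[of k] unfolding \<iota>'_def \<pi>'_def by simp
  qed
  have far: "ar (f k) (Y (Suc k)) (Y k)" if "k < Suc n" for k
    using conf_ar[OF c[of k]] conf_ar[OF c[of "Suc k"]] f[OF that] that by simp
  have "f k \<cdot> f (Suc k) = Zero C (Y (Suc (Suc k))) (Y k)" if "Suc k < Suc n" for k
  proof -
    have k: "k \<le> Suc n" "Suc k \<le> Suc n" "Suc (Suc k) \<le> Suc n" using that by simp_all
    note ars = k[THEN c, THEN conf_ar]
    have "f k \<cdot> f (Suc k) = \<iota>' k \<cdot> ((\<pi>' (Suc k) \<cdot> \<iota>' (Suc k)) \<cdot> \<pi>' (Suc (Suc k)))"
      using f[of k] f[of "Suc k"] that ars by simp
    also have "\<dots> = Zero C (Y (Suc (Suc k))) (Y k)"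
      unfolding conf_comp[OF c[OF k(2)]]
      using ars conf_Obj[OF c[OF k(1)]] conf_Obj[OF c[OF k(2)]] conf_Obj[OF c[OF k(3)]] by simp
    finally show ?thesis .
  qed
  then have cplx: "is_complex C (Suc n) (Y, f)"
    unfolding is_complex_def using far c conf_Obj unfolding ar_def by blast
  have "zero_object C (Z' 0)" "zero_object C (Z' (Suc (Suc n)))"
    using *(1) z(2) unfolding Z'_def by auto
  moreover have "Z' k \<in> Obj C" if "k \<le> Suc (Suc n)" for k
    using that c[of k] c[of "Suc n"] conf_Obj le_Suc_eq by metis
  moreover have "\<forall>k\<le>Suc n. \<iota>' k \<in> Hom C (Z' (Suc k)) (Y k) \<and> \<pi>' k \<in> Hom C (Y k) (Z' k) \<and>
      (\<iota>' k, \<pi>' k) \<in> Conf C"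
    using c unfolding conf_def ar_def by blast
  moreover have "\<forall>k<Suc n. f k = \<iota>' k \<cdot> \<pi>' (Suc k)" using f by simp
  ultimately show ?thesis
    unfolding acyclic_complex_def n_def[symmetric] prod.case using cplx by metis
qed

lemma spliced_extension_extension:
  assumes "chain X \<zeta>" "spliced_extension X \<zeta> Y f"
  shows "(Y, f) \<in> extensions C (length \<zeta>) X (chain_end X \<zeta>)"
proof -
  have "spliced X \<zeta> Y f \<Longrightarrow> Y 0 = X" by (induction X \<zeta> Y f rule: spliced.induct) auto
  then show ?thesis unfolding extensions_def
    using spliced_extension_acyclic[OF assms] assms(2) unfolding spliced_extension_def by blast
qed

text \<open>The conflations of an acyclic complex have \<open>Z 1\<close> only isomorphic to
  \<open>X\<close>, and \<open>Z (Suc (Suc n))\<close> only isomorphic to \<open>B\<close>, whereas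
  a chain requires equality. Both isomorphisms are absorbed into neighbouring conflations.\<close>

lemma extension_spliced_extension:
  assumes "(Y, f) \<in> extensions C (Suc n) X B"
  obtains \<zeta> where "length \<zeta> = Suc n" "chain X \<zeta>" "chain_end X \<zeta> = B" "spliced_extension X \<zeta> Y f"
proof -
  have "acyclic_complex C (Suc (Suc n)) (Y, f)" and Y: "Y 0 = X" "Y (Suc (Suc n)) = B"
    using assms unfolding extensions_def by auto
  then obtain Z \<iota> \<pi> where Z: "zero_object C (Z 0)" "zero_object C (Z (Suc (Suc (Suc n))))"
    and c0: "\<forall>k\<le>Suc (Suc n). Z k \<in> Obj C \<and> Y k \<in> Obj C \<and> Z (Suc k) \<in> Obj C \<and>
      \<iota> k \<in> Hom C (Z (Suc k)) (Y k) \<and> \<pi> k \<in> Hom C (Y k) (Z k) \<and> (\<iota> k, \<pi> k) \<in> Conf C"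
    and f: "\<And>k. k < Suc (Suc n) \<Longrightarrow> f k = \<iota> k \<cdot> \<pi> (Suc k)"
    unfolding acyclic_complex_def is_complex_def by auto
  have c: "conf (Z (Suc k)) (Y k) (Z k) (\<iota> k) (\<pi> k)" if "k \<le> Suc (Suc n)" for k
    using c0 that unfolding conf_def ar_def by blast
  \<comment> \<open>One splicing step, corrected by an isomorphism \<open>e\<close> from
    \<open>Z (Suc m)\<close> to the object in which the chain really ends.\<close>
  have step: "conf (Z (Suc (Suc m))) (Y (Suc m)) D (\<iota> (Suc m)) (e \<cdot> \<pi> (Suc m)) \<and>
      f m = j \<cdot> (e \<cdot> \<pi> (Suc m))"
    if "m < Suc n" "isomorphism C (Z (Suc m)) D e" "ar j D (Y m)" "j \<cdot> e = \<iota> m" for m D e j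
  proof -
    have chain_map: "conf (Z (Suc (Suc m))) (Y (Suc m)) (Z (Suc m)) (\<iota> (Suc m)) (\<pi> (Suc m))" using c
      that by simp
    note ars = conf_ar[OF chain_map] conf_Obj[OF chain_map] that(3)
    have e: "ar e (Z (Suc m)) D" using that(2) isomorphism_iff by blast
    have 1: "conf (Z (Suc (Suc m))) (Y (Suc m)) D (\<iota> (Suc m)) (e \<cdot> \<pi> (Suc m))"
      by (rule conf_isomorphic[OF chain_map _ _ isomorphism_Ident isomorphism_Ident that(2)])
        (use ars e in simp_all)
    have "f m = (j \<cdot> e) \<cdot> \<pi> (Suc m)" unfolding that(4) using f that by simp
    then show ?thesis using 1 ars e by simp
  qed
  \<comment> \<open>The correction \<open>e\<close> is \<open>\<iota> 0\<close> at the start,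
    invertible because \<open>Z 0\<close> is zero, and an identity from then on.\<close>
  have claim: "m < Suc n \<Longrightarrow> \<exists>\<zeta> e. length \<zeta> = m \<and> chain X \<zeta> \<and> isomorphism C (Z (Suc m)) (chain_end X
    \<zeta>) e \<and>
      last_inflation X \<zeta> \<cdot> e = \<iota> m \<and> spliced X \<zeta> Y f" for m
  proof (induction m)
    case 0
    have "conf (Z 1) X (Z 0) (\<iota> 0) (\<pi> 0)" using c[of 0] Y by simp
    then show ?case
      using conf_zero_iso_left[OF _ Z(1)] Y conf_ar conf_Obj
      by (intro exI[of _ "[]"] exI[of _ "\<iota> 0"]) auto
  next
    case (Suc m)
    then obtain \<zeta> e where *: "length \<zeta> = m" "chain X \<zeta>" "isomorphism C (Z (Suc m)) (chain_end X \<zeta>) e"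
      "last_inflation X \<zeta> \<cdot> e = \<iota> m" "spliced X \<zeta> Y f" by auto
    have st: "conf (Z (Suc (Suc m))) (Y (Suc m)) (chain_end X \<zeta>) (\<iota> (Suc m)) (e \<cdot> \<pi> (Suc m))"
      "f m = last_inflation X \<zeta> \<cdot> (e \<cdot> \<pi> (Suc m))"
      using step[OF _ *(3) _ *(4)] last_inflation_ar[OF *(2,5)] *(1) Suc by simp_all
    have Obj: "Z (Suc (Suc m)) \<in> Obj C" "ar (\<iota> (Suc m)) (Z (Suc (Suc m))) (Y (Suc m))"
      using conf_Obj[OF st(1)] conf_ar[OF st(1)] by simp_all
    show ?case
      by (intro exI[of _ "(\<iota> (Suc m), Y (Suc m), e \<cdot> \<pi> (Suc m), Z (Suc (Suc m))) # \<zeta>"]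
          exI[of _ "Ident C (Z (Suc (Suc m)))"] conjI)
        (use * st Obj isomorphism_Ident[OF Obj(1)] in simp_all)
  qed
  obtain \<zeta> e where *: "length \<zeta> = n" "chain X \<zeta>" "isomorphism C (Z (Suc n)) (chain_end X \<zeta>) e"
    "last_inflation X \<zeta> \<cdot> e = \<iota> n" "spliced X \<zeta> Y f" using claim[of n] by auto
  have st: "conf (Z (Suc (Suc n))) (Y (Suc n)) (chain_end X \<zeta>) (\<iota> (Suc n)) (e \<cdot> \<pi> (Suc n))"
    "f n = last_inflation X \<zeta> \<cdot> (e \<cdot> \<pi> (Suc n))"
    using step[OF _ *(3) _ *(4)] last_inflation_ar[OF *(2,5)] *(1) by simp_all
  define b where "b = \<pi> (Suc (Suc n))"
  have "isomorphism C B (Z (Suc (Suc n))) b"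
    using conf_zero_iso_right[OF _ Z(2)] c[of "Suc (Suc n)"] Y(2) unfolding b_def by simp
  then obtain b' where b: "isomorphism C (Z (Suc (Suc n))) B b'" "b \<cdot> b' = Ident C (Z (Suc (Suc n)))"
    "ar b' (Z (Suc (Suc n))) B" "ar b B (Z (Suc (Suc n)))"
    using isomorphism_inverse by metis
  note ars = conf_ar[OF st(1)] conf_Obj[OF st(1)] b(3,4)
  have cB: "conf B (Y (Suc n)) (chain_end X \<zeta>) (\<iota> (Suc n) \<cdot> b) (e \<cdot> \<pi> (Suc n))"
    by (rule conf_isomorphic[OF st(1) _ _ b(1) isomorphism_Ident isomorphism_Ident])
      (use ars b(2) in simp_all)
  show ?thesis
    by (rule that[of "(\<iota> (Suc n) \<cdot> b, Y (Suc n), e \<cdot> \<pi> (Suc n), B) # \<zeta>"])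
      (use * cB st Y f[of "Suc n"] in \<open>simp_all add: spliced_extension_def b_def\<close>)
qed

lemma chain_map_components:
  assumes "chain X \<zeta>" "chain X \<zeta>'" "chain_map X \<zeta> \<zeta>' u" "spliced X \<zeta> Y f" "spliced X \<zeta>' Y' f'"
  shows "\<exists>\<phi>. \<phi> 0 = Ident C X \<and> (\<forall>k\<le>length \<zeta>. ar (\<phi> k) (Y k) (Y' k)) \<and>
    (\<forall>k<length \<zeta>. \<phi> k \<cdot> f k = f' k \<cdot> \<phi> (Suc k)) \<and> \<phi> (length \<zeta>) \<cdot> last_inflation X \<zeta> = last_inflation
      X \<zeta>' \<cdot> u"
  using assms
proof (induction X \<zeta> \<zeta>' u rule: chain_map.induct)
  case (1 X u)
  then show ?case by (intro exI[of _ "\<lambda>_. Ident C X"]) simp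
next
  case (2 X j P r Q \<eta> i Z p K \<zeta> u)
  obtain u' g where u: "chain_map X \<eta> \<zeta> u'" "ar g P Z" "ar u Q K" "p \<cdot> g = u' \<cdot> r" "g \<cdot> j = i \<cdot> u"
    using 2(4) by (simp del: ar_iff) blast
  have c: "conf Q P (chain_end X \<eta>) j r" "conf K Z (chain_end X \<zeta>) i p" "chain X \<eta>" "chain X \<zeta>"
    using 2 by simp_all
  have spliced: "spliced X \<eta> Y f" "spliced X \<zeta> Y' f'" "Y (Suc (length \<eta>)) = P" "Y' (Suc (length \<zeta>)) = Z"
    "f (length \<eta>) = last_inflation X \<eta> \<cdot> r" "f' (length \<zeta>) = last_inflation X \<zeta> \<cdot> p" using 2(5,6) by
      simp_all
  have len: "length \<eta> = length \<zeta>" using chain_map_length[OF u(1)] .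
  obtain \<phi> where \<phi>: "\<phi> 0 = Ident C X" "\<And>k. k \<le> length \<eta> \<Longrightarrow> ar (\<phi> k) (Y k) (Y' k)"
    "\<And>k. k < length \<eta> \<Longrightarrow> \<phi> k \<cdot> f k = f' k \<cdot> \<phi> (Suc k)" "\<phi> (length \<eta>) \<cdot> last_inflation X \<eta> =
      last_inflation X \<zeta> \<cdot> u'"
    using "2.IH"[OF c(3,4) u(1) spliced(1,2)] by blast
  define n where "n = length \<eta>"
  note ars = c(1,2)[THEN conf_ar] u(2,3) chain_map_ar[OF c(3) u(1)] last_inflation_ar[OF c(3)
    spliced(1)]
    last_inflation_ar[OF c(4) spliced(2)]
  have "\<phi> n \<cdot> f n = f' n \<cdot> g"
  proof -
    have "\<phi> n \<cdot> f n = last_inflation X \<zeta> \<cdot> (u' \<cdot> r)"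
      using comp_ext2[OF \<phi>(4), of r] spliced(5) ars \<phi>(2)[of n] len unfolding n_def by simp
    also have "\<dots> = f' n \<cdot> g" unfolding u(4)[symmetric] using spliced(6) ars len unfolding n_def by simp
    finally show ?thesis .
  qed
  then have "(\<phi>(Suc n := g)) k \<cdot> f k = f' k \<cdot> (\<phi>(Suc n := g)) (Suc k)" if "k < Suc n" for k
    using that \<phi>(3)[of k] unfolding n_def by (cases "k = length \<eta>") auto
  moreover have "ar ((\<phi>(Suc n := g)) k) (Y k) (Y' k)" if "k \<le> Suc n" for k
    using that \<phi>(2)[of k] u(2) spliced(3,4) len unfolding n_def by (cases "k = Suc (length \<eta>)") auto
  ultimately show ?case
    by (intro exI[of _ "\<phi>(Suc n := g)"]) (use u(5) \<phi>(1) in \<open>simp add: n_def del: ar_iff\<close>)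
qed simp_all

text \<open>The maps on syzygies are recovered one by one: the last inflation is mono, so the square
  of components already gives \<open>p \<cdot> g = u \<cdot> r\<close>, and \<open>g\<close> then
  restricts to the kernels.\<close>

lemma components_chain_map:
  assumes "length \<zeta> = length \<zeta>'" "chain X \<zeta>" "chain X \<zeta>'" "spliced X \<zeta> Y f" "spliced X \<zeta>' Y' f'"
    "\<phi> 0 = Ident C X" "\<And>k. k \<le> length \<zeta> \<Longrightarrow> ar (\<phi> k) (Y k) (Y' k)"
    "\<And>k. k < length \<zeta> \<Longrightarrow> \<phi> k \<cdot> f k = f' k \<cdot> \<phi> (Suc k)"
  shows "\<exists>u. chain_map X \<zeta> \<zeta>' u \<and> \<phi> (length \<zeta>) \<cdot> last_inflation X \<zeta> = last_inflation X \<zeta>' \<cdot> u"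
  using assms
proof (induction \<zeta> \<zeta>' rule: list_induct2)
  case Nil
  then show ?case by simp
next
  case (Cons x \<eta> y \<zeta>)
  obtain j P r Q where x: "x = (j, P, r, Q)" by (cases x)
  obtain i Z p K where y: "y = (i, Z, p, K)" by (cases y)
  have c: "conf Q P (chain_end X \<eta>) j r" "conf K Z (chain_end X \<zeta>) i p" "chain X \<eta>" "chain X \<zeta>"
    using Cons.prems x y by simp_all
  have spliced: "spliced X \<eta> Y f" "spliced X \<zeta> Y' f'" "Y (Suc (length \<eta>)) = P" "Y' (Suc (length \<zeta>)) = Z"
    "f (length \<eta>) = last_inflation X \<eta> \<cdot> r" "f' (length \<zeta>) = last_inflation X \<zeta> \<cdot> p" using
      Cons.prems(3,4) x y by simp_all
  have \<phi>: "\<phi> 0 = Ident C X" "\<And>k. k \<le> length \<eta> \<Longrightarrow> ar (\<phi> k) (Y k) (Y' k)"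
    "\<And>k. k < length \<eta> \<Longrightarrow> \<phi> k \<cdot> f k = f' k \<cdot> \<phi> (Suc k)"
    using Cons.prems(5-7) by (simp_all del: ar_iff)
  obtain u where u: "chain_map X \<eta> \<zeta> u" "\<phi> (length \<eta>) \<cdot> last_inflation X \<eta> = last_inflation X \<zeta> \<cdot> u"
    using Cons.IH[OF c(3,4) spliced(1,2) \<phi>] by blast
  define g where "g = \<phi> (Suc (length \<eta>))"
  have g: "ar g P Z" using Cons.prems(6)[of "Suc (length \<eta>)"] spliced(3,4) Cons.hyps unfolding g_def
    by simp
  note ars = c(1,2)[THEN conf_ar] g chain_map_ar[OF c(3) u(1)] last_inflation_ar[OF c(3) spliced(1)]
    last_inflation_ar[OF c(4) spliced(2)] \<phi>(2)[of "length \<eta>"]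
  have "\<phi> (length \<eta>) \<cdot> (last_inflation X \<eta> \<cdot> r) = (last_inflation X \<zeta> \<cdot> p) \<cdot> g"
    using Cons.prems(7)[of "length \<eta>"] spliced(5,6) Cons.hyps unfolding g_def by simp
  then have "last_inflation X \<zeta> \<cdot> (u \<cdot> r) = last_inflation X \<zeta> \<cdot> (p \<cdot> g)"
    using comp_ext2[OF u(2), of r] ars Cons.hyps by simp
  then have pg: "p \<cdot> g = u \<cdot> r"
    using last_inflation_mono[OF c(4), of "u \<cdot> r" P "p \<cdot> g"] ars by simp
  have "p \<cdot> (g \<cdot> j) = Zero C Q (chain_end X \<zeta>)"
    using comp_ext2[OF pg, of j] conf_comp[OF c(1)] ars conf_Obj[OF c(1)] conf_Obj[OF c(2)] by simp
  then obtain v where v: "ar v Q K" "i \<cdot> v = g \<cdot> j" using conf_lift[OF c(2), of "g \<cdot> j" Q] ars by auto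
  have "chain_map X (x # \<eta>) (y # \<zeta>) v" unfolding x y chain_map.simps using u(1) g v pg by metis
  moreover have "\<phi> (length (x # \<eta>)) \<cdot> last_inflation X (x # \<eta>) = last_inflation X (y # \<zeta>) \<cdot> v"
    using v(2) unfolding x y g_def by simp
  ultimately show ?case by blast
qed

lemma chain_map_extension_map:
  assumes "chain X \<zeta>" "chain X \<zeta>'" "chain_map X \<zeta> \<zeta>' (Ident C B)" "chain_end X \<zeta> = B" "chain_end X
    \<zeta>' = B"
    "spliced_extension X \<zeta> Y f" "spliced_extension X \<zeta>' Y' f'"
  shows "((Y, f), (Y', f')) \<in> extension_map C (length \<zeta>) X B"
proof -
  define n where "n = length \<zeta>"
  have len: "length \<zeta>' = n" using chain_map_length[OF assms(3)] n_def by simp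
  have spliced: "spliced X \<zeta> Y f" "spliced X \<zeta>' Y' f'" "Y (Suc n) = B" "Y' (Suc n) = B"
    "f n = last_inflation X \<zeta>" "f' n = last_inflation X \<zeta>'" using assms(4-7) len unfolding
      spliced_extension_def n_def by auto
  have B: "B \<in> Obj C" using chain_Obj[OF assms(1)] assms(4) by simp
  have last: "ar (last_inflation X \<zeta>') B (Y' n)" using last_inflation_ar[OF assms(2) spliced(2)] len
    assms(5) by simp
  obtain \<phi> where \<phi>: "\<phi> 0 = Ident C X" "\<And>k. k \<le> n \<Longrightarrow> ar (\<phi> k) (Y k) (Y' k)"
    "\<And>k. k < n \<Longrightarrow> \<phi> k \<cdot> f k = f' k \<cdot> \<phi> (Suc k)" "\<phi> n \<cdot> last_inflation X \<zeta> = last_inflation X \<zeta>' \<cdot>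
      Ident C B"
    using chain_map_components[OF assms(1-3) spliced(1,2)] unfolding n_def by blast
  define \<psi> where "\<psi> = \<phi>(Suc n := Ident C B)"
  have "\<psi> k \<in> Hom C (Y k) (Y' k)" if "k \<le> Suc n" for k
    using that \<phi>(2)[of k] spliced(3,4) Ident_in_Hom[OF B] unfolding \<psi>_def ar_def
    by (cases "k = Suc n") auto
  moreover have "\<psi> k \<cdot> f k = g k \<cdot> \<psi> (Suc k)" if "k \<le> n" "g = f'" for k g
    using that \<phi>(3)[of k] \<phi>(4) spliced(5,6) unfolding \<psi>_def by (cases "k = n") auto
  moreover have "\<psi> 0 = Ident C X" "\<psi> (Suc n) = Ident C B" unfolding \<psi>_def using \<phi>(1) by auto
  moreover have "(Y, f) \<in> extensions C n X B" "(Y', f') \<in> extensions C n X B"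
    using spliced_extension_extension[OF assms(1,6)] spliced_extension_extension[OF assms(2,7)]
      assms(4,5) len n_def by simp_all
  ultimately show ?thesis unfolding extension_map_def n_def[symmetric] by blast
qed

lemma extension_map_chain_map:
  assumes m: "((Y, f), (Y', f')) \<in> extension_map C n X B"
    and "length \<zeta> = n" "length \<zeta>' = n" "chain X \<zeta>" "chain X \<zeta>'" "chain_end X \<zeta> = B" "chain_end X \<zeta>' = B"
    "spliced_extension X \<zeta> Y f" "spliced_extension X \<zeta>' Y' f'"
  shows "chain_map X \<zeta> \<zeta>' (Ident C B)"
proof -
  obtain \<phi> where \<phi>: "\<And>k. k \<le> Suc n \<Longrightarrow> \<phi> k \<in> Hom C (Y k) (Y' k)"
    "\<And>k. k \<le> n \<Longrightarrow> \<phi> k \<cdot> f k = f' k \<cdot> \<phi> (Suc k)" "\<phi> 0 = Ident C X" "\<phi> (Suc n) = Ident C B"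
    and ext: "(Y, f) \<in> extensions C n X B" "(Y', f') \<in> extensions C n X B"
    using m unfolding extension_map_def by blast
  have spliced: "spliced X \<zeta> Y f" "spliced X \<zeta>' Y' f'" "f n = last_inflation X \<zeta>" "f' n =
    last_inflation X \<zeta>'"
    using assms unfolding spliced_extension_def by auto
  have "Y k \<in> Obj C" "Y' k \<in> Obj C" if "k \<le> Suc n" for k
    using ext that unfolding extensions_def acyclic_complex_def is_complex_def by auto
  then have "\<And>k. k \<le> length \<zeta> \<Longrightarrow> ar (\<phi> k) (Y k) (Y' k)"
    using \<phi>(1) assms(2) unfolding ar_def by simp
  then obtain u where u: "chain_map X \<zeta> \<zeta>' u" "\<phi> n \<cdot> last_inflation X \<zeta> = last_inflation X \<zeta>' \<cdot> u"
    using components_chain_map[of \<zeta> \<zeta>' X Y f Y' f' \<phi>] assms(2-5) spliced(1,2) \<phi>(2,3) by auto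
  have B: "B \<in> Obj C" using chain_Obj[OF assms(4)] assms(6) by simp
  have "last_inflation X \<zeta>' \<cdot> u = last_inflation X \<zeta>' \<cdot> Ident C B"
    using u(2) \<phi>(2)[of n] \<phi>(4) spliced(3,4) by simp
  then have "u = Ident C B"
    by (rule last_inflation_mono[OF assms(5), rotated 2]) (use chain_map_ar[OF assms(4) u(1)]
      assms(6,7) B in simp_all)
  then show ?thesis using u(1) by simp
qed

end

section \<open>Vanishing of Yoneda Ext\<close>

context exact_category
begin

lemma ex_chain:
  assumes "X \<in> Obj C"
  shows "\<exists>\<zeta>. chain X \<zeta> \<and> length \<zeta> = n"
proof (induction n)
  case 0
  then show ?case using assms by (intro exI[of _ "[]"]) simp
next
  case (Suc n)
  then obtain \<zeta> where \<zeta>: "chain X \<zeta>" "length \<zeta> = n" by blast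
  obtain Z i where "conf Z (chain_end X \<zeta>) (chain_end X \<zeta>) i (Ident C (chain_end X \<zeta>))"
    using conf_zero chain_Obj[OF \<zeta>(1)] by metis
  then show ?case using \<zeta>
    by (intro exI[of _ "(i, chain_end X \<zeta>, Ident C (chain_end X \<zeta>), Z) # \<zeta>"]) simp
qed

text \<open>The condition in \<open>Ext_vanishes\<close> for \<open>h\<close> the identity of the
  end object: the class of the extension is zero.\<close>

definition null :: "'o \<Rightarrow> ('m \<times> 'o \<times> 'm \<times> 'o) list \<Rightarrow> bool" where
  "null X \<zeta> \<longleftrightarrow> (\<exists>\<eta> u. chain X \<eta> \<and> chain_map X \<eta> \<zeta> u \<and> extends_last X \<eta> (chain_end X \<zeta>) u)"

text \<open>A chain whose last conflation splits is null without refinement, because the retraction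
  extends the identity of \<open>B\<close>.\<close>

lemma ex_null_chain:
  assumes X: "X \<in> Obj C" and B: "B \<in> Obj C"
  obtains \<zeta> where "chain X \<zeta>" "length \<zeta> = Suc n" "chain_end X \<zeta> = B" "null X \<zeta>"
proof -
  obtain \<zeta> where \<zeta>: "chain X \<zeta>" "length \<zeta> = n" using ex_chain[OF X] by blast
  obtain S i p t s where S: "conf B S (chain_end X \<zeta>) i p" "ar t S B" "t \<cdot> i = Ident C B"
    using ex_direct_sum_conf[OF B, of "chain_end X \<zeta>"] chain_Obj[OF \<zeta>(1)] by metis
  define \<xi> where "\<xi> = (i, S, p, B) # \<zeta>"
  have \<xi>: "chain X \<xi>" "length \<xi> = Suc n" "chain_end X \<xi> = B" using \<zeta> S unfolding \<xi>_def by simp_all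
  have "extends_last X \<xi> (chain_end X \<xi>) (Ident C (chain_end X \<xi>))"
    unfolding \<xi>_def using S(2,3) by auto
  then have "null X \<xi>" unfolding null_def using chain_map_refl[OF \<xi>(1)] \<xi>(1) by blast
  then show ?thesis using that \<xi> by blast
qed

text \<open>Subtracting \<open>i \<cdot> t\<close> from the last component \<open>g\<close>, where
  \<open>t\<close> extends \<open>w\<close> over the last inflation, changes the map on ends from
  \<open>w\<close> to zero and leaves the earlier components alone.\<close>

lemma chain_map_extends_last_Zero:
  assumes ch: "chain X \<eta>" "chain X \<zeta>" and chain_map: "chain_map X \<eta> \<zeta> w" and extends_last:
    "extends_last X \<eta> (chain_end X \<zeta>) w"
    and ne: "\<eta> \<noteq> []"
  shows "chain_map X \<eta> \<zeta> (Zero C (chain_end X \<eta>) (chain_end X \<zeta>))"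
proof -
  obtain j P r Q \<eta>0 where \<eta>: "\<eta> = (j, P, r, Q) # \<eta>0" using ne by (cases \<eta>) auto
  obtain i Z p K \<zeta>0 where \<zeta>: "\<zeta> = (i, Z, p, K) # \<zeta>0" using chain_map_length[OF chain_map] \<eta> by
    (cases \<zeta>) auto
  obtain u g where u: "chain_map X \<eta>0 \<zeta>0 u" "ar g P Z" "ar w Q K" "p \<cdot> g = u \<cdot> r" "g \<cdot> j = i \<cdot> w"
    using chain_map unfolding \<eta> \<zeta> by (simp del: ar_iff) blast
  obtain t where t: "ar t P K" "t \<cdot> j = w" using extends_last unfolding \<eta> \<zeta> by (simp del: ar_iff) blast
  have c: "conf Q P (chain_end X \<eta>0) j r" "conf K Z (chain_end X \<zeta>0) i p" "chain X \<eta>0"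
    using ch \<eta> \<zeta> by simp_all
  note ars = c(1,2)[THEN conf_ar] u(2,3) t(1) chain_map_ar[OF c(3) u(1)]
  have Obj: "Q \<in> Obj C" "P \<in> Obj C" "K \<in> Obj C" "Z \<in> Obj C" "chain_end X \<zeta>0 \<in> Obj C"
    using conf_Obj c by blast+
  have "ar (i \<cdot> t) P Z" using ars by simp
  then obtain z where z: "ar z P Z" "g = (i \<cdot> t) \<oplus> z" using ex_diff[OF u(2)] by blast
  have "(i \<cdot> (t \<cdot> j)) \<oplus> (z \<cdot> j) = g \<cdot> j" unfolding z(2) using z(1) ars by simp
  also have "\<dots> = (i \<cdot> (t \<cdot> j)) \<oplus> Zero C Q Z" unfolding u(5) t(2) using ars by simp
  finally have zj: "z \<cdot> j = Zero C Q Z" by (rule add_left_cancel) (use ars z(1) Obj in simp_all)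
  have "p \<cdot> g = (p \<cdot> (i \<cdot> t)) \<oplus> (p \<cdot> z)" unfolding z(2) using z(1) ars by simp
  also have "\<dots> = p \<cdot> z" using comp_ext[OF conf_comp[OF c(2)], of t] ars z(1) Obj by simp
  finally have pz: "p \<cdot> z = u \<cdot> r" using u(4) by simp
  have "z \<cdot> j = i \<cdot> Zero C Q K" unfolding zj using ars Obj by simp
  moreover have "ar (Zero C Q K) Q K" using Obj by simp
  ultimately show ?thesis unfolding \<eta> \<zeta> chain_map.simps chain_end.simps using u(1) z(1) pz by blast
qed

text \<open>With zero on the ends, \<open>g\<close> descends along \<open>r\<close> to a map
  \<open>h\<close> from \<open>chain_end X \<eta>\<close>. Together with \<open>i\<close> on the
  summand \<open>B\<close> it maps out of the split conflation. So every null extension receives a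
  map from a split one.\<close>

lemma chain_map_Zero_split:
  assumes ch: "chain X ((j, P, r, Q) # \<eta>)" "chain X \<zeta>" and chain_map: "chain_map X ((j, P, r, Q) #
    \<eta>) \<zeta> (Zero C Q B)"
    and B: "chain_end X \<zeta> = B" and S: "conf B S (chain_end X \<eta>) iS pS" "ar t S B" "t \<cdot> iS = Ident C B"
  shows "chain_map X ((iS, S, pS, B) # \<eta>) \<zeta> (Ident C B)"
proof -
  obtain i Z p K \<zeta>0 where \<zeta>: "\<zeta> = (i, Z, p, K) # \<zeta>0" using chain_map_length[OF chain_map] by (cases
    \<zeta>) auto
  have K: "K = B" using B \<zeta> by simp
  obtain u g where u: "chain_map X \<eta> \<zeta>0 u" "ar g P Z" "p \<cdot> g = u \<cdot> r" "g \<cdot> j = i \<cdot> Zero C Q B"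
    using chain_map unfolding \<zeta> by (simp del: ar_iff) blast
  have c: "conf Q P (chain_end X \<eta>) j r" "conf B Z (chain_end X \<zeta>0) i p" "chain X \<eta>"
    using ch \<zeta> K by simp_all
  note ars = c(1,2)[THEN conf_ar] u(2) S(2) conf_ar[OF S(1)] chain_map_ar[OF c(3) u(1)]
  have Obj: "Q \<in> Obj C" "P \<in> Obj C" "B \<in> Obj C" "Z \<in> Obj C" "chain_end X \<zeta>0 \<in> Obj C" "chain_end X \<eta>
    \<in> Obj C"
    "S \<in> Obj C" using conf_Obj c S(1) by blast+
  have "g \<cdot> j = Zero C Q Z" unfolding u(4) using ars Obj by simp
  then obtain h where h: "ar h (chain_end X \<eta>) Z" "h \<cdot> r = g" using conf_colift[OF c(1) u(2)] by blast
  have "(p \<cdot> h) \<cdot> r = u \<cdot> r" using h u(3) ars by simp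
  then have ph: "p \<cdot> h = u" by (rule conf_epi[OF c(1), rotated 2]) (use h(1) ars in simp_all)
  have 1: "p \<cdot> ((i \<cdot> t) \<oplus> (h \<cdot> pS)) = u \<cdot> pS"
    using comp_ext[OF conf_comp[OF c(2)], of t] comp_ext[OF ph, of pS] ars h(1) Obj by simp
  have 2: "((i \<cdot> t) \<oplus> (h \<cdot> pS)) \<cdot> iS = i \<cdot> Ident C B"
    using S(3) conf_comp[OF S(1)] ars h(1) Obj by simp
  have 3: "ar ((i \<cdot> t) \<oplus> (h \<cdot> pS)) S Z" "ar (Ident C B) B B" using ars h(1) Obj by simp_all
  show ?thesis unfolding \<zeta> K chain_map.simps using u(1) 1 2 3 by blast
qed

text \<open>Nullity is preserved and reflected by the maps generating the equivalence, and some null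
  extension exists, so all are null if there is a single class. A general \<open>h\<close> is
  reduced to this by pushing the extension out along it.\<close>

lemma Ext_zero_imp_Ext_vanishes:
  assumes E: "Ext_zero C (Suc n) X B" and X: "X \<in> Obj C" and B: "B \<in> Obj C"
  shows "Ext_vanishes (Suc n) X B"
proof -
  define R where "R = extension_map C (Suc n) X B \<union> (extension_map C (Suc n) X B)\<inverse>"
  define N where "N = (\<lambda>(Y, f). \<exists>\<zeta>. length \<zeta> = Suc n \<and> chain X \<zeta> \<and> chain_end X \<zeta> = B \<and>
    spliced_extension X \<zeta> Y f \<and> null X \<zeta>)"
  have step: "N x \<longleftrightarrow> N y" if "(x, y) \<in> extension_map C (Suc n) X B" for x y
  proof -
    obtain Y f Y' f' where xy: "x = (Y, f)" "y = (Y', f')" by (cases x, cases y)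
    have m: "((Y, f), (Y', f')) \<in> extension_map C (Suc n) X B" using that xy by simp
    then have ext: "(Y, f) \<in> extensions C (Suc n) X B" "(Y', f') \<in> extensions C (Suc n) X B"
      unfolding extension_map_def by blast+
    show ?thesis
    proof
      assume "N x"
      then obtain \<zeta> where \<zeta>: "length \<zeta> = Suc n" "chain X \<zeta>" "chain_end X \<zeta> = B" "spliced_extension X
        \<zeta> Y f" "null X \<zeta>"
        unfolding N_def xy by blast
      obtain \<zeta>' where \<zeta>': "length \<zeta>' = Suc n" "chain X \<zeta>'" "chain_end X \<zeta>' = B" "spliced_extension X
        \<zeta>' Y' f'"
        using extension_spliced_extension[OF ext(2)] by metis
      have chain_map: "chain_map X \<zeta> \<zeta>' (Ident C B)" using extension_map_chain_map[OF m] \<zeta> \<zeta>' by blast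
      obtain \<eta> u where \<eta>: "chain X \<eta>" "chain_map X \<eta> \<zeta> u" "extends_last X \<eta> B u" using \<zeta>(3,5)
        unfolding null_def by blast
      have "chain_map X \<eta> \<zeta>' (Ident C B \<cdot> u)" by (rule chain_map_trans[OF \<eta>(1) \<zeta>(2) \<zeta>'(2) \<eta>(2)
        chain_map])
      then have "chain_map X \<eta> \<zeta>' u" using chain_map_ar[OF \<eta>(1,2)] \<zeta>(3) by simp
      then show "N y" unfolding N_def xy null_def using \<zeta>' \<eta> by blast
    next
      assume "N y"
      then obtain \<zeta>' where \<zeta>': "length \<zeta>' = Suc n" "chain X \<zeta>'" "chain_end X \<zeta>' = B"
        "spliced_extension X \<zeta>' Y' f'" "null X \<zeta>'"
        unfolding N_def xy by blast
      obtain \<zeta> where \<zeta>: "length \<zeta> = Suc n" "chain X \<zeta>" "chain_end X \<zeta> = B" "spliced_extension X \<zeta> Y f"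
        using extension_spliced_extension[OF ext(1)] by metis
      have chain_map: "chain_map X \<zeta> \<zeta>' (Ident C B)" using extension_map_chain_map[OF m] \<zeta> \<zeta>' by blast
      obtain \<eta> u where \<eta>: "chain X \<eta>" "chain_map X \<eta> \<zeta>' u" "extends_last X \<eta> (chain_end X \<zeta>') u"
        using \<zeta>'(5) unfolding null_def by blast
      obtain \<eta>' w where w: "chain X \<eta>'" "chain_map X \<eta>' \<zeta> w" "extends_last X \<eta>' (chain_end X \<zeta>')
        (Ident C B \<cdot> w)"
        using extends_last_transfer[OF \<zeta>(2) \<zeta>'(2) \<eta>(1) chain_map \<eta>(2,3)] by metis
      then have "extends_last X \<eta>' B w" using chain_map_ar[OF w(1,2)] \<zeta>(3) \<zeta>'(3) by simp
      then show "N x" unfolding N_def xy null_def using \<zeta> w by blast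
    qed
  qed
  have all: "N x" if "x \<in> extensions C (Suc n) X B" for x
  proof -
    obtain \<zeta>0 where \<zeta>0: "chain X \<zeta>0" "length \<zeta>0 = Suc n" "chain_end X \<zeta>0 = B" "null X \<zeta>0"
      using ex_null_chain[OF X B] by metis
    obtain Y f where Yf: "spliced_extension X \<zeta>0 Y f" using ex_spliced_extension by blast
    have "(Y, f) \<in> extensions C (Suc n) X B" using spliced_extension_extension[OF \<zeta>0(1) Yf] \<zeta>0 by simp
    then have "((Y, f), x) \<in> R\<^sup>*" using E that unfolding Ext_zero_iff R_def by blast
    then have "N (Y, f) \<longleftrightarrow> N x"
      by (induction rule: rtrancl_induct) (use step in \<open>auto simp: R_def\<close>)
    moreover have "N (Y, f)" unfolding N_def using \<zeta>0 Yf by blast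
    ultimately show ?thesis by blast
  qed
  show ?thesis unfolding Ext_vanishes_def
  proof (intro allI impI)
    fix \<zeta> h assume \<zeta>: "chain X \<zeta>" "length \<zeta> = Suc n" "ar h (chain_end X \<zeta>) B"
    obtain j P r Q \<zeta>0 where eq: "\<zeta> = (j, P, r, Q) # \<zeta>0" using \<zeta>(2) by (cases \<zeta>) auto
    have c: "conf Q P (chain_end X \<zeta>0) j r" "chain X \<zeta>0" using \<zeta>(1) eq by simp_all
    have h: "ar h Q B" using \<zeta>(3) eq by simp
    obtain P' j' r' g where P': "conf B P' (chain_end X \<zeta>0) j' r'" "ar g P P'" "g \<cdot> j = j' \<cdot> h" "r'
      \<cdot> g = r"
      using conf_pushout[OF c(1) h] by metis
    define \<zeta>' where "\<zeta>' = (j', P', r', B) # \<zeta>0"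
    have \<zeta>': "chain X \<zeta>'" "length \<zeta>' = Suc n" "chain_end X \<zeta>' = B" using P' c \<zeta>(2) eq unfolding
      \<zeta>'_def by simp_all
    have "r' \<cdot> g = Ident C (chain_end X \<zeta>0) \<cdot> r" using P'(4) conf_ar[OF c(1)] by simp
    then have chain_map: "chain_map X \<zeta> \<zeta>' h" unfolding eq \<zeta>'_def chain_map.simps using
      chain_map_refl[OF c(2)] P' h by blast
    obtain Y f where Yf: "spliced_extension X \<zeta>' Y f" using ex_spliced_extension by blast
    have ext: "(Y, f) \<in> extensions C (Suc n) X B" using spliced_extension_extension[OF \<zeta>'(1) Yf] \<zeta>'
      by simp
    \<comment> \<open>Nullity is known for some chain \<open>\<xi>\<close> splicing to the same
      complex, perhaps not for \<open>\<zeta>'\<close> itself. The identity map of that complex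
      compares the two.\<close>
    then obtain \<xi> where \<xi>: "length \<xi> = Suc n" "chain X \<xi>" "chain_end X \<xi> = B" "spliced_extension X \<xi>
      Y f" "null X \<xi>"
      using all unfolding N_def by blast
    have Id: "chain_map X \<zeta>' \<zeta>' (Ident C B)" using chain_map_refl[OF \<zeta>'(1)] \<zeta>'(3) by simp
    have "((Y, f), (Y, f)) \<in> extension_map C (Suc n) X B"
      using chain_map_extension_map[OF \<zeta>'(1) \<zeta>'(1) Id \<zeta>'(3) \<zeta>'(3) Yf Yf] \<zeta>'(2) by simp
    then have "chain_map X \<zeta>' \<xi> (Ident C B)" using extension_map_chain_map \<zeta>' \<xi> Yf by blast
    then have "chain_map X \<zeta> \<xi> (Ident C B \<cdot> h)" using chain_map_trans[OF \<zeta>(1) \<zeta>'(1) \<xi>(2) chain_map]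
      by blast
    then have chain_map': "chain_map X \<zeta> \<xi> h" using h by simp
    obtain \<eta> u where \<eta>: "chain X \<eta>" "chain_map X \<eta> \<xi> u" "extends_last X \<eta> (chain_end X \<xi>) u" using
      \<xi>(5) unfolding null_def by blast
    show "\<exists>\<eta> u. chain X \<eta> \<and> chain_map X \<eta> \<zeta> u \<and> extends_last X \<eta> B (h \<cdot> u)"
      using extends_last_transfer[OF \<zeta>(1) \<xi>(2) \<eta>(1) chain_map' \<eta>(2,3)] \<xi>(3) by metis
  qed
qed

text \<open>On a common refinement of two extensions both comparison maps can be made zero on the
  ends. Replacing its last conflation by a split one yields a single extension by \<open>B\<close>
  that maps to both.\<close>

lemma Ext_vanishes_imp_Ext_zero:
  assumes Ext_vanishes: "Ext_vanishes (Suc n) X B" and X: "X \<in> Obj C" and B: "B \<in> Obj C"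
  shows "Ext_zero C (Suc n) X B"
proof -
  obtain \<zeta>0 where \<zeta>0: "chain X \<zeta>0" "length \<zeta>0 = Suc n" "chain_end X \<zeta>0 = B"
    using ex_null_chain[OF X B] by metis
  have ne: "extensions C (Suc n) X B \<noteq> {}"
    using spliced_extension_extension[OF \<zeta>0(1)] ex_spliced_extension[of X \<zeta>0] \<zeta>0 by auto
  have "(x, y) \<in> (extension_map C (Suc n) X B \<union> (extension_map C (Suc n) X B)\<inverse>)\<^sup>*"
    if xy: "x \<in> extensions C (Suc n) X B" "y \<in> extensions C (Suc n) X B" for x y
  proof -
    obtain Y1 f1 Y2 f2 where eq: "x = (Y1, f1)" "y = (Y2, f2)" by (cases x, cases y)
    obtain \<zeta>1 where \<zeta>1: "length \<zeta>1 = Suc n" "chain X \<zeta>1" "chain_end X \<zeta>1 = B" "spliced_extension X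
      \<zeta>1 Y1 f1"
      using extension_spliced_extension xy(1) unfolding eq by metis
    obtain \<zeta>2 where \<zeta>2: "length \<zeta>2 = Suc n" "chain X \<zeta>2" "chain_end X \<zeta>2 = B" "spliced_extension X
      \<zeta>2 Y2 f2"
      using extension_spliced_extension xy(2) unfolding eq by metis
    have null: "\<exists>\<eta> u. chain X \<eta> \<and> chain_map X \<eta> \<zeta> u \<and> extends_last X \<eta> B u"
      if \<zeta>: "length \<zeta> = Suc n" "chain X \<zeta>" "chain_end X \<zeta> = B" for \<zeta>
    proof -
      obtain \<eta> u where \<eta>: "chain X \<eta>" "chain_map X \<eta> \<zeta> u" "extends_last X \<eta> B (Ident C B \<cdot> u)"
        using Ext_vanishes[unfolded Ext_vanishes_def, rule_format, OF \<zeta>(2,1), of "Ident C B"] \<zeta>(3) B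
          by auto
      then show ?thesis using chain_map_ar[OF \<eta>(1,2)] \<zeta>(3) by auto
    qed
    obtain \<eta>1 u1 where \<eta>1: "chain X \<eta>1" "chain_map X \<eta>1 \<zeta>1 u1" "extends_last X \<eta>1 B u1" using
      null[OF \<zeta>1(1-3)] by blast
    obtain \<eta>2 u2 where \<eta>2: "chain X \<eta>2" "chain_map X \<eta>2 \<zeta>2 u2" "extends_last X \<eta>2 B u2" using
      null[OF \<zeta>2(1-3)] by blast
    have "length \<eta>1 = length \<eta>2" using chain_map_length \<eta>1(2) \<eta>2(2) \<zeta>1(1) \<zeta>2(1) by metis
    then obtain \<eta> w1 w2 where \<eta>: "chain X \<eta>" "chain_map X \<eta> \<eta>1 w1" "chain_map X \<eta> \<eta>2 w2"
      using common_refinement \<eta>1(1) \<eta>2(1) by blast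
    have len: "length \<eta> = Suc n" using chain_map_length \<eta>1(2) \<eta>(2) \<zeta>1(1) by metis
    then obtain j P r Q \<eta>0 where \<eta>eq: "\<eta> = (j, P, r, Q) # \<eta>0" by (cases \<eta>) auto
    have z1: "chain_map X \<eta> \<zeta>1 (Zero C Q B)"
      using chain_map_extends_last_Zero[OF \<eta>(1) \<zeta>1(2) chain_map_trans[OF \<eta>(1) \<eta>1(1) \<zeta>1(2) \<eta>(2) \<eta>1(2)]]
        extends_last_chain_map[OF \<eta>(1) \<eta>1(1) \<eta>(2) \<eta>1(3)] \<zeta>1(3) \<eta>eq by simp
    have z2: "chain_map X \<eta> \<zeta>2 (Zero C Q B)"
      using chain_map_extends_last_Zero[OF \<eta>(1) \<zeta>2(2) chain_map_trans[OF \<eta>(1) \<eta>2(1) \<zeta>2(2) \<eta>(3) \<eta>2(2)]]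
        extends_last_chain_map[OF \<eta>(1) \<eta>2(1) \<eta>(3) \<eta>2(3)] \<zeta>2(3) \<eta>eq by simp
    have \<eta>0: "chain X \<eta>0" using \<eta>(1) \<eta>eq by simp
    obtain S iS pS t s where S: "conf B S (chain_end X \<eta>0) iS pS" "ar t S B" "t \<cdot> iS = Ident C B"
      using ex_direct_sum_conf[OF B, of "chain_end X \<eta>0"] chain_Obj[OF \<eta>0] by metis
    define \<sigma> where "\<sigma> = (iS, S, pS, B) # \<eta>0"
    have \<sigma>: "chain X \<sigma>" "chain_end X \<sigma> = B" "length \<sigma> = Suc n" using S \<eta>0 len \<eta>eq unfolding \<sigma>_def by
      simp_all
    have \<sigma>1: "chain_map X \<sigma> \<zeta>1 (Ident C B)" unfolding \<sigma>_def
      using chain_map_Zero_split[OF \<eta>(1)[unfolded \<eta>eq] \<zeta>1(2) z1[unfolded \<eta>eq] \<zeta>1(3) S] .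
    have \<sigma>2: "chain_map X \<sigma> \<zeta>2 (Ident C B)" unfolding \<sigma>_def
      using chain_map_Zero_split[OF \<eta>(1)[unfolded \<eta>eq] \<zeta>2(2) z2[unfolded \<eta>eq] \<zeta>2(3) S] .
    obtain Y f where Yf: "spliced_extension X \<sigma> Y f" using ex_spliced_extension by blast
    have "((Y, f), x) \<in> extension_map C (Suc n) X B" "((Y, f), y) \<in> extension_map C (Suc n) X B"
      using chain_map_extension_map[OF \<sigma>(1) \<zeta>1(2) \<sigma>1 \<sigma>(2) \<zeta>1(3) Yf \<zeta>1(4)]
        chain_map_extension_map[OF \<sigma>(1) \<zeta>2(2) \<sigma>2 \<sigma>(2) \<zeta>2(3) Yf \<zeta>2(4)] \<sigma>(3) unfolding eq by simp_all
    then show ?thesis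
      by (meson UnCI converseI converse_rtrancl_into_rtrancl r_into_rtrancl)
  qed
  then show ?thesis unfolding Ext_zero_iff using ne by blast
qed

lemma Ext_zero_iff_Ext_vanishes:
  assumes "0 < n" "X \<in> Obj C" "B \<in> Obj C"
  shows "Ext_zero C n X B \<longleftrightarrow> Ext_vanishes n X B"
  using Ext_zero_imp_Ext_vanishes Ext_vanishes_imp_Ext_zero assms by (cases n) auto

end

section \<open>Yoneda Ext and cluster tilting in the opposite category\<close>

definition rev_cplx :: "nat \<Rightarrow> ('o, 'm) cplx \<Rightarrow> ('o, 'm) cplx" where
  "rev_cplx n = (\<lambda>(X, f). (\<lambda>k. X (Suc n - k), \<lambda>k. f (n - k)))"

text \<open>Objects occupy positions \<open>0\<close> to \<open>n + 1\<close> and differentials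
  \<open>0\<close> to \<open>n\<close>, hence the two different reflections in
  \<open>rev_cplx\<close>. The splicing conflation at \<open>k\<close> moves to
  \<open>Suc n - k\<close>.\<close>

lemma rev_extension:
  assumes "x \<in> extensions C n A B"
  shows "rev_cplx n x \<in> extensions (op_cat C) n B A"
proof -
  obtain X f where x: "x = (X, f)" by (cases x)
  have ac: "acyclic_complex C (Suc n) (X, f)" and X: "X 0 = A" "X (Suc n) = B"
    using assms unfolding x extensions_def by auto
  then have cplx: "\<And>k. k \<le> Suc n \<Longrightarrow> X k \<in> Obj C"
    "\<And>k. k < Suc n \<Longrightarrow> f k \<in> Hom C (X (Suc k)) (X k)"
    "\<And>k. k < n \<Longrightarrow> f k \<cdot>\<^bsub>C\<^esub> f (Suc k) = Zero C (X (Suc (Suc k))) (X k)"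
    unfolding acyclic_complex_def is_complex_def by auto
  obtain Z \<iota> \<pi> where Z: "\<And>k. k \<le> Suc (Suc n) \<Longrightarrow> Z k \<in> Obj C" "zero_object C (Z 0)"
    "zero_object C (Z (Suc (Suc n)))"
    "\<And>k. k \<le> Suc n \<Longrightarrow> \<iota> k \<in> Hom C (Z (Suc k)) (X k) \<and> \<pi> k \<in> Hom C (X k) (Z k) \<and> (\<iota> k, \<pi> k) \<in> Conf C"
    "\<And>k. k < Suc n \<Longrightarrow> f k = \<iota> k \<cdot>\<^bsub>C\<^esub> \<pi> (Suc k)"
    using ac unfolding acyclic_complex_def by blast
  define X' f' where "X' = (\<lambda>k. X (Suc n - k))" and "f' = (\<lambda>k. f (n - k))"
  have cplx': "is_complex (op_cat C) (Suc n) (X', f')"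
    unfolding is_complex_def prod.case X'_def f'_def
  proof (intro conjI allI impI)
    show "X (Suc n - k) \<in> Obj (op_cat C)" for k using cplx(1) by simp
    show "f (n - k) \<in> Hom (op_cat C) (X (Suc n - Suc k)) (X (Suc n - k))" if "k < Suc n" for k
      using cplx(2)[of "n - k"] that by (simp add: Suc_diff_le)
    show "f (n - k) \<cdot>\<^bsub>op_cat C\<^esub> f (n - Suc k) = Zero (op_cat C) (X (Suc n - Suc (Suc k))) (X (Suc n
      - k))"
      if "Suc k < Suc n" for k
    proof -
      have "Suc (n - Suc k) = n - k" "Suc (n - k) = Suc n - k" using that by auto
      then show ?thesis using cplx(3)[of "n - Suc k"] that by simp
    qed
  qed
  define Z' \<iota>' \<pi>' where "Z' = (\<lambda>k. Z (Suc (Suc n) - k))" and "\<iota>' = (\<lambda>k. \<pi> (Suc n - k))"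
    and "\<pi>' = (\<lambda>k. \<iota> (Suc n - k))"
  have Z': "\<forall>k\<le>Suc (Suc n). Z' k \<in> Obj (op_cat C)" "zero_object (op_cat C) (Z' 0)"
    "zero_object (op_cat C) (Z' (Suc (Suc n)))" unfolding Z'_def using Z(1-3) by simp_all
  have c': "\<forall>k\<le>Suc n. \<iota>' k \<in> Hom (op_cat C) (Z' (Suc k)) (X' k) \<and> \<pi>' k \<in> Hom (op_cat C) (X' k) (Z' k) \<and>
      (\<iota>' k, \<pi>' k) \<in> Conf (op_cat C)"
  proof (intro allI impI)
    fix k assume k: "k \<le> Suc n"
    have "Suc (Suc n - k) = Suc (Suc n) - k" using k by simp
    then show "\<iota>' k \<in> Hom (op_cat C) (Z' (Suc k)) (X' k) \<and> \<pi>' k \<in> Hom (op_cat C) (X' k) (Z' k) \<and>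
      (\<iota>' k, \<pi>' k) \<in> Conf (op_cat C)"
      using Z(4)[of "Suc n - k"] unfolding Z'_def \<iota>'_def \<pi>'_def X'_def by simp
  qed
  have "\<forall>k<Suc n. f' k = \<iota>' k \<cdot>\<^bsub>op_cat C\<^esub> \<pi>' (Suc k)"
  proof (intro allI impI)
    fix k assume k: "k < Suc n"
    have "Suc (n - k) = Suc n - k" using k by simp
    then show "f' k = \<iota>' k \<cdot>\<^bsub>op_cat C\<^esub> \<pi>' (Suc k)"
      using Z(5)[of "n - k"] unfolding \<iota>'_def \<pi>'_def f'_def by simp
  qed
  then have "acyclic_complex (op_cat C) (Suc n) (X', f')"
    unfolding acyclic_complex_def prod.case using cplx' Z' c' by blast
  then show ?thesis unfolding x rev_cplx_def prod.case extensions_def X'_def f'_def using X by simp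
qed

text \<open>Reversal turns the direction of maps around, which the symmetrised relation
  absorbs.\<close>

lemma rev_extension_map:
  assumes "(x, y) \<in> extension_map C n A B"
  shows "(rev_cplx n x, rev_cplx n y) \<in> extension_map (op_cat C) n B A \<union> (extension_map (op_cat C) n
    B A)\<inverse>"
proof -
  obtain X f Y g where xy: "x = (X, f)" "y = (Y, g)" by (cases x, cases y)
  have ext: "x \<in> extensions C n A B" "y \<in> extensions C n A B" using assms unfolding
    extension_map_def by auto
  obtain \<phi> where \<phi>: "\<And>k. k \<le> Suc n \<Longrightarrow> \<phi> k \<in> Hom C (X k) (Y k)"
    "\<And>k. k \<le> n \<Longrightarrow> \<phi> k \<cdot>\<^bsub>C\<^esub> f k = g k \<cdot>\<^bsub>C\<^esub> \<phi> (Suc k)" "\<phi> 0 = Ident C A" "\<phi> (Suc n) = Ident C B"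
    using assms unfolding extension_map_def xy by auto
  define \<psi> where "\<psi> = (\<lambda>k. \<phi> (Suc n - k))"
  have "(rev_cplx n y, rev_cplx n x) \<in> extension_map (op_cat C) n B A"
    unfolding extension_map_def
  proof (rule CollectI, unfold xy rev_cplx_def prod.case, intro conjI)
    show "(\<lambda>k. Y (Suc n - k), \<lambda>k. g (n - k)) \<in> extensions (op_cat C) n B A"
      "(\<lambda>k. X (Suc n - k), \<lambda>k. f (n - k)) \<in> extensions (op_cat C) n B A"
      using ext[THEN rev_extension] unfolding xy rev_cplx_def by simp_all
    have "\<psi> k \<in> Hom (op_cat C) (Y (Suc n - k)) (X (Suc n - k))" for k
      using \<phi>(1) unfolding \<psi>_def by simp
    moreover have "\<psi> k \<cdot>\<^bsub>op_cat C\<^esub> g (n - k) = f (n - k) \<cdot>\<^bsub>op_cat C\<^esub> \<psi> (Suc k)" if "k \<le> n" for k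
      using \<phi>(2)[of "n - k"] that unfolding \<psi>_def by (simp add: Suc_diff_le)
    moreover have "\<psi> 0 = Ident (op_cat C) B" "\<psi> (Suc n) = Ident (op_cat C) A"
      using \<phi>(3,4) unfolding \<psi>_def by simp_all
    ultimately show "\<exists>\<phi>. (\<forall>k\<le>Suc n. \<phi> k \<in> Hom (op_cat C) (Y (Suc n - k)) (X (Suc n - k))) \<and>
        (\<forall>k\<le>n. \<phi> k \<cdot>\<^bsub>op_cat C\<^esub> g (n - k) = f (n - k) \<cdot>\<^bsub>op_cat C\<^esub> \<phi> (Suc k)) \<and>
        \<phi> 0 = Ident (op_cat C) B \<and> \<phi> (Suc n) = Ident (op_cat C) A" by blast
  qed
  then show ?thesis by blast
qed

lemma op_op_cat [simp]:
  fixes C :: "('o, 'm) excat"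
  shows "op_cat (op_cat C) = C"
  by (simp add: op_cat_def)

text \<open>Reversing twice restores only the meaningful positions, since truncated subtraction
  alters the others. The two complexes are therefore compared by identity components instead of
  being equated.\<close>

lemma (in exact_category) extension_map_rev_rev:
  assumes "x \<in> extensions C n A B" "rev_cplx n (rev_cplx n x) \<in> extensions C n A B"
  shows "(x, rev_cplx n (rev_cplx n x)) \<in> extension_map C n A B"
proof -
  obtain X f where x: "x = (X, f)" by (cases x)
  have c: "is_complex C (Suc n) (X, f)" and X: "X 0 = A" "X (Suc n) = B"
    using assms(1) unfolding x extensions_def acyclic_complex_def by auto
  have ar: "X k \<in> Obj C" "k < Suc n \<Longrightarrow> ar (f k) (X (Suc k)) (X k)" if "k \<le> Suc n" for k
    using c that unfolding is_complex_def ar_def by auto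
  define \<phi> where "\<phi> = (\<lambda>k. Ident C (X k))"
  have "\<phi> k \<in> Hom C (X k) (X (Suc n - (Suc n - k)))" if "k \<le> Suc n" for k
    using Ident_in_Hom[OF ar(1)[OF that]] that unfolding \<phi>_def by simp
  moreover have "\<phi> k \<cdot> f k = f (n - (n - k)) \<cdot> \<phi> (Suc k)" if "k \<le> n" for k
    using ar(2)[of k] that unfolding \<phi>_def by simp
  moreover have "\<phi> 0 = Ident C A" "\<phi> (Suc n) = Ident C B" unfolding \<phi>_def X by simp_all
  ultimately have "\<exists>\<phi>. (\<forall>k\<le>Suc n. \<phi> k \<in> Hom C (X k) (X (Suc n - (Suc n - k)))) \<and>
      (\<forall>k\<le>n. \<phi> k \<cdot> f k = f (n - (n - k)) \<cdot> \<phi> (Suc k)) \<and> \<phi> 0 = Ident C A \<and> \<phi> (Suc n) = Ident C B"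
    by blast
  then show ?thesis
    using assms unfolding x rev_cplx_def extension_map_def prod.case by blast
qed

lemma Ext_zero_op_imp:
  fixes C :: "('o, 'm) excat"
  assumes E: "exact_category C" and Z: "Ext_zero C n A B"
  shows "Ext_zero (op_cat C) n B A"
proof -
  define R where "R = extension_map C n A B \<union> (extension_map C n A B)\<inverse>"
  define R' where "R' = extension_map (op_cat C) n B A \<union> (extension_map (op_cat C) n B A)\<inverse>"
  have sym: "(x, y) \<in> R'\<^sup>* \<Longrightarrow> (y, x) \<in> R'\<^sup>*" for x y
    using sym_rtrancl[of R'] unfolding R'_def sym_def by blast
  have pres: "(rev_cplx n x, rev_cplx n y) \<in> R'\<^sup>*" if "(x, y) \<in> R\<^sup>*" for x y
    using that
  proof (induction rule: rtrancl_induct)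
    case (step y z)
    have "(rev_cplx n y, rev_cplx n z) \<in> R'"
      using step(2) rev_extension_map unfolding R_def R'_def by fast
    then show ?case using step by simp
  qed simp
  have ne: "extensions (op_cat C) n B A \<noteq> {}" using Z rev_extension[of _ C n A B] unfolding
    Ext_zero_iff by blast
  have bwd: "rev_cplx n x \<in> extensions C n A B" if "x \<in> extensions (op_cat C) n B A" for x
    using rev_extension[OF that] by simp
  have id: "(x, rev_cplx n (rev_cplx n x)) \<in> R'\<^sup>*" if "x \<in> extensions (op_cat C) n B A" for x
  proof -
    interpret op: exact_category "op_cat C" using exact_category.op_exact_category[OF E] .
    show ?thesis using op.extension_map_rev_rev[OF that rev_extension[OF bwd[OF that]]]
      unfolding R'_def by blast
  qed
  have "(x, y) \<in> R'\<^sup>*" if "x \<in> extensions (op_cat C) n B A" "y \<in> extensions (op_cat C) n B A" for x y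
  proof -
    have "(rev_cplx n x, rev_cplx n y) \<in> R\<^sup>*"
      using Z bwd that unfolding Ext_zero_iff R_def by blast
    then have "(rev_cplx n (rev_cplx n x), rev_cplx n (rev_cplx n y)) \<in> R'\<^sup>*" by (rule pres)
    then show ?thesis using id[OF that(1)] sym[OF id[OF that(2)]] by (meson rtrancl_trans)
  qed
  then show ?thesis unfolding Ext_zero_iff R'_def using ne by blast
qed

lemma Ext_zero_op:
  fixes C :: "('o, 'm) excat"
  assumes "exact_category C"
  shows "Ext_zero (op_cat C) n B A \<longleftrightarrow> Ext_zero C n A B"
  using Ext_zero_op_imp[OF assms] Ext_zero_op_imp[OF exact_category.op_exact_category[OF assms]] by auto

lemma cluster_tilting_op:
  fixes C :: "('o, 'm) excat"
  assumes E: "exact_category C" and M: "cluster_tilting d C M"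
  shows "cluster_tilting d (op_cat C) M"
proof -
  interpret exact_category C by (rule E)
  have "subcategory C M" "generating C M" "cogenerating C M" "functorially_finite C M"
    and 1: "M = {A \<in> Obj C. \<forall>i. 0 < i \<and> i < d \<longrightarrow> (\<forall>X\<in>M. Ext_zero C i A X)}"
    and 2: "M = {A \<in> Obj C. \<forall>i. 0 < i \<and> i < d \<longrightarrow> (\<forall>X\<in>M. Ext_zero C i X A)}"
    using M unfolding cluster_tilting_def by blast+
  then have "generating (op_cat C) M" "cogenerating (op_cat C) M" "functorially_finite (op_cat C) M"
    unfolding generating_def cogenerating_def functorially_finite_def
      contravariantly_finite_def covariantly_finite_def by simp_all
  moreover have "(\<exists>f. isomorphism C B A f) \<longleftrightarrow> (\<exists>f. isomorphism C A B f)" for A B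
    using isomorphism_inverse by metis
  then have "subcategory (op_cat C) M"
    using \<open>subcategory C M\<close>
    unfolding subcategory_def op_cat_simps isomorphism_op zero_object_op direct_sum_op by blast
  ultimately show ?thesis
    unfolding cluster_tilting_def op_cat_simps Ext_zero_op[OF E] using 1 2 by blast
qed

section \<open>Resolutions by a cluster tilting subcategory\<close>

locale cluster_tilting_category = exact_category C
  for C :: "('o, 'm) excat" (structure) +
  fixes d :: nat and M :: "'o set"
  assumes wic: "weakly_idempotent_complete C"
    and tilting: "cluster_tilting d C M"
    and d_pos: "d \<ge> 1"
begin

text \<open>The description of \<open>M\<close> by Ext with values in \<open>M\<close> enters
  through \<open>op_cat C\<close>, where it takes the form recorded here.\<close>

lemma M_facts:
  shows "subcategory C M" "generating C M" "cogenerating C M" "functorially_finite C M"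
    "M = {A \<in> Obj C. \<forall>i. 0 < i \<and> i < d \<longrightarrow> (\<forall>X\<in>M. Ext_zero C i X A)}"
  using tilting unfolding cluster_tilting_def by blast+

lemma M_Obj: "T \<in> M \<Longrightarrow> T \<in> Obj C"
  using M_facts(1) unfolding subcategory_def by blast

lemma Ext_vanishes_M: "S \<in> M \<Longrightarrow> T \<in> M \<Longrightarrow> 0 < i \<Longrightarrow> i < d \<Longrightarrow> Ext_vanishes i S T"
  using M_facts(5) Ext_zero_iff_Ext_vanishes M_Obj by blast

lemma Ext_vanishes_imp_M:
  assumes "A \<in> Obj C" "\<And>S i. S \<in> M \<Longrightarrow> 0 < i \<Longrightarrow> i < d \<Longrightarrow> Ext_vanishes i S A"
  shows "A \<in> M"
proof -
  have "\<forall>i. 0 < i \<and> i < d \<longrightarrow> (\<forall>X\<in>M. Ext_zero C i X A)"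
    using assms Ext_zero_iff_Ext_vanishes M_Obj by blast
  then show ?thesis using M_facts(5) assms(1) by blast
qed

lemma ex_cover:
  assumes "A \<in> Obj C"
  obtains T p where "T \<in> M" "ar p T A" "deflation C p"
  using M_facts(2) assms M_Obj unfolding generating_def ar_def by blast

text \<open>A cover of \<open>A\<close> by an object of \<open>M\<close> factors through the
  approximation, which is therefore a deflation by cancellation.\<close>

lemma ex_approximation:
  assumes A: "A \<in> Obj C"
  obtains T K a c where "T \<in> M" "conf K T A a c"
    "\<And>S g. S \<in> M \<Longrightarrow> ar g S A \<Longrightarrow> \<exists>h. ar h S T \<and> c \<cdot> h = g"
proof -
  obtain T c where T: "T \<in> M" "ar c T A" and
    lift: "\<And>S g. S \<in> M \<Longrightarrow> ar g S A \<Longrightarrow> \<exists>h. ar h S T \<and> c \<cdot> h = g"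
    using M_facts(4) A M_Obj unfolding functorially_finite_def contravariantly_finite_def ar_def by
      meson
  obtain T' p where p: "T' \<in> M" "ar p T' A" "deflation C p" using ex_cover[OF A] .
  obtain h where h: "ar h T' T" "c \<cdot> h = p" using lift[OF p(1,2)] by blast
  have "deflation C c" using deflation_cancel[OF wic h(1) T(2)] h(2) p(3) by simp
  then obtain K a where "conf K T A a c" using deflation_conf T(2) by metis
  then show ?thesis using that T lift by blast
qed

text \<open>Let \<open>K\<close> be the kernel of an approximation \<open>T \<rightarrow> A\<close>.
  The approximation property gives vanishing in degree one for \<open>K\<close>. In degree
  \<open>Suc n\<close> it follows from vanishing for \<open>A\<close> in degree \<open>n\<close> and
  for \<open>T\<close> in degree \<open>Suc n\<close>; the latter requires \<open>Suc n < d\<close>.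
  The initial chain \<open>\<zeta>0\<close> makes it possible to prescribe the first
  conflation.\<close>

lemma resolution:
  assumes "chain X \<zeta>0"
  shows "m < d \<Longrightarrow> \<exists>\<zeta>. chain X (\<zeta> @ \<zeta>0) \<and> length \<zeta> = m \<and> (\<forall>(j, P, r, Q)\<in>set \<zeta>. P \<in> M) \<and>
    (\<forall>S\<in>M. \<forall>i. 0 < i \<and> i \<le> m \<longrightarrow> Ext_vanishes i S (chain_end X (\<zeta> @ \<zeta>0)))"
proof (induction m)
  case 0
  then show ?case using assms by (intro exI[of _ "[]"]) simp
next
  case (Suc m)
  have "m < d" using Suc.prems by simp
  then obtain \<zeta> where \<zeta>: "chain X (\<zeta> @ \<zeta>0)" "length \<zeta> = m" "\<forall>(j, P, r, Q)\<in>set \<zeta>. P \<in> M"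
    "\<And>S i. S \<in> M \<Longrightarrow> 0 < i \<Longrightarrow> i \<le> m \<Longrightarrow> Ext_vanishes i S (chain_end X (\<zeta> @ \<zeta>0))" using Suc.IH by blast
  define A where "A = chain_end X (\<zeta> @ \<zeta>0)"
  have A: "A \<in> Obj C" using chain_Obj[OF \<zeta>(1)] unfolding A_def by blast
  obtain T K a c where T: "T \<in> M" "conf K T A a c" and
    lift: "\<And>S g. S \<in> M \<Longrightarrow> ar g S A \<Longrightarrow> \<exists>h. ar h S T \<and> c \<cdot> h = g"
    using ex_approximation[OF A] by metis
  have "Ext_vanishes i S K" if S: "S \<in> M" and i: "0 < i" "i \<le> Suc m" for S i
  proof -
    obtain n where n: "i = Suc n" "n \<le> m" using i by (cases i) auto
    have Ext_vanishes: "Ext_vanishes (Suc n) S T" using Ext_vanishes_M[OF S T(1)] n Suc.prems by simp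
    show ?thesis unfolding n(1)
    proof (rule Ext_vanishes_Suc[OF T(2) Ext_vanishes])
      fix \<xi> h assume \<xi>: "chain S \<xi>" "length \<xi> = n" "ar h (chain_end S \<xi>) A"
      show "\<exists>\<eta> u e. chain S \<eta> \<and> chain_map S \<eta> \<xi> u \<and> ar e (chain_end S \<eta>) T \<and> h \<cdot> u = c \<cdot> e"
      proof (cases n)
        case 0
        then have nil: "\<xi> = []" using \<xi>(2) by simp
        obtain e where "ar e S T" "c \<cdot> e = h" using lift[OF S] \<xi>(3) nil by auto
        then show ?thesis using nil \<xi>(1,3)
          by (intro exI[of _ "[]"] exI[of _ "Ident C S"] exI[of _ e]) auto
      next
        case (Suc n')
        then have "Ext_vanishes n S A" using \<zeta>(4)[OF S, of n] n(2) unfolding A_def by simp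
        then show ?thesis using Ext_vanishes_lift[OF _ T(2) \<xi>] by metis
      qed
    qed
  qed
  then show ?case
    using \<zeta> T unfolding A_def by (intro exI[of _ "(a, T, c, K) # \<zeta>"]) auto
qed

text \<open>After \<open>d - 1\<close> approximations the vanishing covers all degrees
  \<open>0 < i < d\<close>, which characterises membership in \<open>M\<close>.\<close>

lemma finite_resolution:
  assumes "chain X \<zeta>0"
  obtains \<zeta> where "chain X (\<zeta> @ \<zeta>0)" "length \<zeta> = d - 1" "\<And>j P r Q. (j, P, r, Q) \<in> set \<zeta> \<Longrightarrow> P \<in> M"
    "chain_end X (\<zeta> @ \<zeta>0) \<in> M"
proof -
  obtain \<zeta> where \<zeta>: "chain X (\<zeta> @ \<zeta>0)" "length \<zeta> = d - 1" "\<forall>(j, P, r, Q)\<in>set \<zeta>. P \<in> M"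
    "\<forall>S\<in>M. \<forall>i. 0 < i \<and> i \<le> d - 1 \<longrightarrow> Ext_vanishes i S (chain_end X (\<zeta> @ \<zeta>0))"
    using resolution[OF assms, of "d - 1"] d_pos by auto
  have "chain_end X (\<zeta> @ \<zeta>0) \<in> M"
    by (rule Ext_vanishes_imp_M) (use chain_Obj[OF \<zeta>(1)] \<zeta>(4) in auto)
  then show ?thesis using that \<zeta> by blast
qed

lemma op_cluster_tilting_category: "cluster_tilting_category (op_cat C) d M"
  by (intro cluster_tilting_category.intro cluster_tilting_category_axioms.intro op_exact_category
      op_weakly_idempotent_complete wic cluster_tilting_op tilting d_pos exact_category_axioms)

section \<open>Deflations in the subcategory and admissible sequences\<close>

lemma spliced_middle:
  "spliced X \<zeta> Y f \<Longrightarrow> 0 < k \<Longrightarrow> k \<le> length \<zeta> \<Longrightarrow> \<exists>j r Q. (j, Y k, r, Q) \<in> set \<zeta>"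
proof (induction X \<zeta> Y f rule: spliced.induct)
  case (2 X j P r Q \<zeta> Y f)
  then show ?case by (cases "k = Suc (length \<zeta>)") auto
qed simp

lemma spliced_first: "spliced X (\<zeta> @ [(j, P, r, Q)]) Y f \<Longrightarrow> Y 0 = X \<and> Y 1 = P \<and> f 0 = Ident C X \<cdot> r"
proof (induction \<zeta>)
  case Nil
  then show ?case by simp
next
  case (Cons x \<zeta>)
  then show ?case by (cases x) auto
qed

text \<open>The deflation is the first conflation of a resolution of \<open>T\<close>. With
  \<open>d - 1\<close> further ones the chain has length \<open>d\<close>, so the spliced complex
  ends at position \<open>Suc d\<close>, as an admissible sequence must.\<close>

lemma deflation_AdmSeq:
  assumes T: "T \<in> M" "T' \<in> M" and p: "ar p T' T" "deflation C p"
  obtains Y f where "(Y, f) \<in> AdmSeq (induced_dexact d C M)" "f 0 = p" "Y 0 = T" "Y 1 = T'"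
proof -
  obtain K i where c: "conf K T' T i p" using deflation_conf p by metis
  define \<zeta>0 where "\<zeta>0 = [(i, T', p, K)]"
  have "chain T \<zeta>0" unfolding \<zeta>0_def using c M_Obj[OF T(1)] by simp
  then obtain \<zeta> where \<zeta>: "chain T (\<zeta> @ \<zeta>0)" "length \<zeta> = d - 1"
    "\<And>j P r Q. (j, P, r, Q) \<in> set \<zeta> \<Longrightarrow> P \<in> M" "chain_end T (\<zeta> @ \<zeta>0) \<in> M"
    using finite_resolution by metis
  have len: "length (\<zeta> @ \<zeta>0) = d" using \<zeta>(2) d_pos unfolding \<zeta>0_def by simp
  obtain Y f where Yf: "spliced_extension T (\<zeta> @ \<zeta>0) Y f" using ex_spliced_extension by blast
  have spliced: "spliced T (\<zeta> @ \<zeta>0) Y f" and last: "Y (Suc d) = chain_end T (\<zeta> @ \<zeta>0)"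
    using Yf len unfolding spliced_extension_def by auto
  have first: "Y 0 = T" "Y 1 = T'" "f 0 = p" 
    using spliced_first[OF spliced[unfolded \<zeta>0_def]] p(1) by simp_all
  have YM: "Y k \<in> M" if k: "k \<le> Suc d" for k
  proof -
    consider "k = 0" | "k = Suc d" | "0 < k" "k \<le> d" using k by linarith
    then show ?thesis
    proof cases
      case 3
      then obtain j r Q where "(j, Y k, r, Q) \<in> set (\<zeta> @ \<zeta>0)" using spliced_middle[OF spliced] len
        by metis
      then show ?thesis using \<zeta>(3) T(2) unfolding \<zeta>0_def by auto
    qed (use first T(1) last \<zeta>(4) in simp_all)
  qed
  have ac: "acyclic_complex C (Suc d) (Y, f)" using spliced_extension_acyclic[OF \<zeta>(1) Yf] len by simp
  then have "is_complex C (Suc d) (Y, f)" unfolding acyclic_complex_def by blast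
  then have "is_complex (full_subcat C M) (Suc d) (Y, f)"
    using YM unfolding is_complex_def full_subcat_def by simp
  then have "(Y, f) \<in> AdmSeq (induced_dexact d C M)" unfolding induced_dexact_def using ac by simp
  then show ?thesis using that first by blast
qed

text \<open>The last map is \<open>\<iota> 0 \<cdot> \<pi> 1\<close>, and \<open>\<iota> 0\<close>
  is invertible because \<open>Z 0\<close> is zero.\<close>

lemma AdmSeq_deflation:
  assumes "(Y, f) \<in> AdmSeq (induced_dexact d C M)"
  shows "deflation C (f 0)"
proof -
  have "acyclic_complex C (Suc d) (Y, f)" using assms unfolding induced_dexact_def by simp
  then obtain Z \<iota> \<pi> where Z: "zero_object C (Z 0)" and Obj: "\<And>k. k \<le> Suc (Suc d) \<Longrightarrow> Z k \<in> Obj C"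
    and Y: "\<And>k. k \<le> Suc d \<Longrightarrow> Y k \<in> Obj C"
    and c: "\<And>k. k \<le> Suc d \<Longrightarrow> \<iota> k \<in> Hom C (Z (Suc k)) (Y k) \<and> \<pi> k \<in> Hom C (Y k) (Z k) \<and> (\<iota> k, \<pi> k) \<in>
      Conf C"
    and f: "\<And>k. k < Suc d \<Longrightarrow> f k = \<iota> k \<cdot> \<pi> (Suc k)"
    unfolding acyclic_complex_def is_complex_def prod.case by metis
  have c: "conf (Z (Suc k)) (Y k) (Z k) (\<iota> k) (\<pi> k)" if "k \<le> Suc d" for k
    using c[OF that] Obj Y that unfolding conf_def ar_def by simp
  have "deflation C (\<iota> 0)" using conf_zero_iso_left[OF c Z] isomorphism_deflation by blast
  moreover have "deflation C (\<pi> 1)" using c[of 1] conf_deflation by simp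
  moreover have "ar (\<iota> 0) (Z 1) (Y 0)" "ar (\<pi> 1) (Y 1) (Z 1)" using conf_ar[OF c[of 0]] conf_ar[OF
    c[of 1]] by simp_all
  ultimately show ?thesis using f[of 0] deflation_comp by simp
qed

text \<open>A coresolution of \<open>A\<close> is a resolution of \<open>A\<close> in the opposite
  category, started from the empty chain. Its head is the conflation farthest from \<open>A\<close>,
  so induction on the list walks back from the end in \<open>M\<close> to \<open>A\<close>.\<close>

lemma coresolution_induct:
  assumes A: "A \<in> Obj C"
    and base: "\<And>T. T \<in> M \<Longrightarrow> R T"
    and step: "\<And>A T D i p. conf A T D i p \<Longrightarrow> T \<in> M \<Longrightarrow> R D \<Longrightarrow> R A"
  shows "R A"
proof -
  interpret op: cluster_tilting_category "op_cat C" d M by (rule op_cluster_tilting_category)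
  have *: "op.chain A \<zeta> \<Longrightarrow> (\<And>j P r Q. (j, P, r, Q) \<in> set \<zeta> \<Longrightarrow> P \<in> M) \<Longrightarrow> R (op.chain_end A \<zeta>) \<Longrightarrow> R A" for \<zeta>
  proof (induction \<zeta>)
    case (Cons x \<zeta>)
    obtain j P r Q where x: "x = (j, P, r, Q)" by (cases x)
    have c: "conf (op.chain_end A \<zeta>) P Q r j" "op.chain A \<zeta>" "R Q"
      using Cons.prems unfolding x by simp_all
    have "P \<in> M" using Cons.prems(2)[of j P r Q] unfolding x by simp
    then have "R (op.chain_end A \<zeta>)" using step c by blast
    then show ?case using Cons.IH[OF c(2)] Cons.prems(2) by (meson list.set_intros(2))
  qed simp
  have "op.chain A []" using A by simp
  then obtain \<zeta> where "op.chain A (\<zeta> @ [])" "\<And>j P r Q. (j, P, r, Q) \<in> set \<zeta> \<Longrightarrow> P \<in> M"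
    "op.chain_end A (\<zeta> @ []) \<in> M" using op.finite_resolution by metis
  then show ?thesis using * base by simp
qed

end

section \<open>Fully faithful functors and covers\<close>

lemma additive_functorD:
  assumes "additive_functor C D F" "category C" "category D"
  shows "A \<in> Obj C \<Longrightarrow> on_obj F A \<in> Obj D"
    and "A \<in> Obj C \<Longrightarrow> on_mor F (Ident C A) = Ident D (on_obj F A)"
    and "category.ar C f A B \<Longrightarrow> category.ar D (on_mor F f) (on_obj F A) (on_obj F B)"
    and "category.ar C f A B \<Longrightarrow> category.ar C g B G \<Longrightarrow>
      on_mor F (g \<cdot>\<^bsub>C\<^esub> f) = on_mor F g \<cdot>\<^bsub>D\<^esub> on_mor F f"
    and "category.ar C f A B \<Longrightarrow> category.ar C g A B \<Longrightarrow>
      on_mor F (Add C f g) = Add D (on_mor F f) (on_mor F g)"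
  using assms unfolding additive_functor_def category.ar_def[OF assms(2)] category.ar_def[OF assms(3)]
  by blast+

context category
begin

lemma ar_comp: "ar f A B \<Longrightarrow> ar g B D \<Longrightarrow> ar (g \<cdot> f) A D"
  by simp

lemma isomorphism_mono:
  assumes e: "isomorphism C B D e" and "ar f A B" "ar g A B" "e \<cdot> f = e \<cdot> g"
  shows "f = g"
proof -
  obtain h where h: "h \<cdot> e = Ident C B" "ar h D B" "ar e B D" using isomorphism_inverse[OF e] by metis
  have "f = h \<cdot> (e \<cdot> f)" using comp_ext[OF h(1), of f] h(2,3) assms(2) by simp
  also have "\<dots> = g" unfolding assms(4) using comp_ext[OF h(1), of g] h(2,3) assms(3) by simp
  finally show ?thesis .
qed

lemma isomorphism_epi:
  assumes e: "isomorphism C A B e" and "ar f B D" "ar g B D" "f \<cdot> e = g \<cdot> e"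
  shows "f = g"
proof -
  obtain h where h: "e \<cdot> h = Ident C B" "ar h B A" "ar e A B" using isomorphism_inverse[OF e] by metis
  have "f = (f \<cdot> e) \<cdot> h" using h assms(2) by simp
  also have "\<dots> = g" unfolding assms(4) using h assms(3) by simp
  finally show ?thesis .
qed

end

lemma quasi_inverse_sym: "quasi_inverse C D F G \<Longrightarrow> quasi_inverse D C G F"
  unfolding quasi_inverse_def by blast

lemma quasi_inverse_natural:
  assumes qi: "quasi_inverse C D F G" and C: "category C"
  obtains \<eta> where "\<And>A. A \<in> Obj C \<Longrightarrow> isomorphism C (on_obj G (on_obj F A)) A (\<eta> A)"
    "\<And>A B f. category.ar C f A B \<Longrightarrow> \<eta> B \<cdot>\<^bsub>C\<^esub> on_mor G (on_mor F f) = f \<cdot>\<^bsub>C\<^esub> \<eta> A"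
proof -
  have "naturally_isomorphic C C (G \<circ>\<^sub>F F) id_functor" using qi unfolding quasi_inverse_def by blast
  then obtain \<eta> where "\<forall>A\<in>Obj C. isomorphism C (on_obj G (on_obj F A)) A (\<eta> A)"
    "\<forall>A\<in>Obj C. \<forall>B\<in>Obj C. \<forall>f\<in>Hom C A B.
      \<eta> B \<cdot>\<^bsub>C\<^esub> on_mor G (on_mor F f) = f \<cdot>\<^bsub>C\<^esub> \<eta> A"
    unfolding naturally_isomorphic_def comp_functor_def id_functor_def by auto
  then show ?thesis by (intro that[of \<eta>]) (simp_all add: category.ar_def[OF C])
qed

lemma quasi_inverse_faithful:
  assumes qi: "quasi_inverse C D F G" and C: "category C" and D: "category D"
    and f: "category.ar C f A B" and g: "category.ar C g A B" and e: "on_mor F f = on_mor F g"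
  shows "f = g"
proof -
  interpret C: category C by (rule C)
  obtain \<eta> where \<eta>: "\<And>A. A \<in> Obj C \<Longrightarrow> isomorphism C (on_obj G (on_obj F A)) A (\<eta> A)"
    and nat: "\<And>A B f. C.ar f A B \<Longrightarrow> \<eta> B \<cdot>\<^bsub>C\<^esub> on_mor G (on_mor F f) = f \<cdot>\<^bsub>C\<^esub> \<eta> A"
    using quasi_inverse_natural[OF qi C] by metis
  have "f \<cdot>\<^bsub>C\<^esub> \<eta> A = g \<cdot>\<^bsub>C\<^esub> \<eta> A" using nat[OF f] nat[OF g] e by simp
  then show ?thesis using C.isomorphism_epi[OF \<eta> f g] C.ar_Obj[OF f] by blast
qed

lemma quasi_inverse_full:
  assumes qi: "quasi_inverse C D F G" and C: "category C" and D: "category D"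
    and AB: "A \<in> Obj C" "B \<in> Obj C" and g: "category.ar D g (on_obj F A) (on_obj F B)"
  shows "\<exists>f. category.ar C f A B \<and> on_mor F f = g"
proof -
  interpret C: category C by (rule C)
  interpret D: category D by (rule D)
  have F: "additive_functor C D F" and G: "additive_functor D C G" using qi unfolding
    quasi_inverse_def by blast+
  note FD = additive_functorD[OF F C D] and GD = additive_functorD[OF G D C]
  obtain \<eta> where \<eta>: "\<And>A. A \<in> Obj C \<Longrightarrow> isomorphism C (on_obj G (on_obj F A)) A (\<eta> A)"
    and nat: "\<And>A B f. C.ar f A B \<Longrightarrow> \<eta> B \<cdot>\<^bsub>C\<^esub> on_mor G (on_mor F f) = f \<cdot>\<^bsub>C\<^esub> \<eta> A"
    using quasi_inverse_natural[OF qi C] by metis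
  obtain h where h: "h \<cdot>\<^bsub>C\<^esub> \<eta> A = Ident C (on_obj G (on_obj F A))" "C.ar h A (on_obj G (on_obj F A))"
    "C.ar (\<eta> A) (on_obj G (on_obj F A)) A" using C.isomorphism_inverse[OF \<eta>[OF AB(1)]] by metis
  have \<eta>B: "C.ar (\<eta> B) (on_obj G (on_obj F B)) B" using \<eta>[OF AB(2)] C.isomorphism_iff by blast
  have Gg: "C.ar (on_mor G g) (on_obj G (on_obj F A)) (on_obj G (on_obj F B))" using GD(3)[OF g] .
  \<comment> \<open>The preimage of \<open>g\<close> is \<open>G g\<close> conjugated by the natural
    isomorphism \<open>\<eta>\<close>. That \<open>F f = g\<close> follows because \<open>G\<close>
    is faithful too.\<close>
  define f where "f = \<eta> B \<cdot>\<^bsub>C\<^esub> (on_mor G g \<cdot>\<^bsub>C\<^esub> h)"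
  have f: "C.ar f A B" unfolding f_def using h \<eta>B Gg by simp
  have GFf: "C.ar (on_mor G (on_mor F f)) (on_obj G (on_obj F A)) (on_obj G (on_obj F B))"
    using GD(3)[OF FD(3)[OF f]] .
  have "\<eta> B \<cdot>\<^bsub>C\<^esub> on_mor G (on_mor F f) = f \<cdot>\<^bsub>C\<^esub> \<eta> A" using nat[OF f] .
  also have "\<dots> = \<eta> B \<cdot>\<^bsub>C\<^esub> on_mor G g" unfolding f_def using h \<eta>B Gg by simp
  finally have "on_mor G (on_mor F f) = on_mor G g"
    using C.isomorphism_mono[OF \<eta>[OF AB(2)] GFf Gg] by blast
  then have "on_mor F f = g"
    using quasi_inverse_faithful[OF quasi_inverse_sym[OF qi] D C FD(3)[OF f] g] by blast
  then show ?thesis using f by blast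
qed

lemma quasi_inverse_ess_surj:
  assumes "quasi_inverse C D F G" "B \<in> Obj D"
  obtains A e where "A \<in> Obj C" "isomorphism D (on_obj F A) B e"
proof -
  have "on_obj G B \<in> Obj C" using assms unfolding quasi_inverse_def additive_functor_def by blast
  moreover have "\<exists>e. isomorphism D (on_obj F (on_obj G B)) B e"
    using assms unfolding quasi_inverse_def naturally_isomorphic_def comp_functor_def id_functor_def
      by auto
  ultimately show ?thesis using that by blast
qed

lemma fully_faithful_equivalence:
  assumes F: "additive_functor C D F" and C: "preadditive_category C" and D: "preadditive_category D"
    and faithful: "\<And>A B f g. category.ar C f A B \<Longrightarrow> category.ar C g A B \<Longrightarrow> on_mor F f = on_mor F g \<Longrightarrow> f
      = g"
    and full: "\<And>A B h. A \<in> Obj C \<Longrightarrow> B \<in> Obj C \<Longrightarrow> category.ar D h (on_obj F A) (on_obj F B) \<Longrightarrow>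
      \<exists>f. category.ar C f A B \<and> on_mor F f = h"
    and ess: "\<And>B. B \<in> Obj D \<Longrightarrow> \<exists>A e. A \<in> Obj C \<and> isomorphism D (on_obj F A) B e"
  shows "equivalence_of_categories C D F"
proof -
  interpret C: preadditive_category C by (rule C)
  interpret D: preadditive_category D by (rule D)
  note FD = additive_functorD[OF F C.category_axioms D.category_axioms]
  obtain g e where ge: "\<And>B. B \<in> Obj D \<Longrightarrow> g B \<in> Obj C \<and> isomorphism D (on_obj F (g B)) B (e B)"
    using ess by metis
  have "\<forall>B. \<exists>k. B \<in> Obj D \<longrightarrow> D.ar k B (on_obj F (g B)) \<and> k \<cdot>\<^bsub>D\<^esub> e B = Ident D (on_obj F (g B)) \<and>
      e B \<cdot>\<^bsub>D\<^esub> k = Ident D B"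
    using ge D.isomorphism_inverse by metis
  then obtain k where k: "\<And>B. B \<in> Obj D \<Longrightarrow> D.ar (k B) B (on_obj F (g B))"
    "\<And>B. B \<in> Obj D \<Longrightarrow> k B \<cdot>\<^bsub>D\<^esub> e B = Ident D (on_obj F (g B))"
    "\<And>B. B \<in> Obj D \<Longrightarrow> e B \<cdot>\<^bsub>D\<^esub> k B = Ident D B" by metis
  have e: "D.ar (e B) (on_obj F (g B)) B" if "B \<in> Obj D" for B
    using ge[OF that] D.isomorphism_iff by blast
  \<comment> \<open>\<open>P h f\<close> is naturality of \<open>e\<close> at \<open>h\<close>. It
    determines \<open>f\<close>, so functoriality of \<open>G\<close> reduces to checking
    \<open>P\<close> on identities, composites and sums.\<close>
  define P where "P h f \<longleftrightarrow> C.ar f (g (D.dom h)) (g (D.cod h)) \<and>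
    e (D.cod h) \<cdot>\<^bsub>D\<^esub> on_mor F f = h \<cdot>\<^bsub>D\<^esub> e (D.dom h)" for h f
  have Pex: "\<exists>f. P h f" if h: "D.ar h B B'" for h B B'
  proof -
    have B: "B \<in> Obj D" "B' \<in> Obj D" using D.ar_Obj[OF h] by auto
    have "D.ar (k B' \<cdot>\<^bsub>D\<^esub> (h \<cdot>\<^bsub>D\<^esub> e B)) (on_obj F (g B)) (on_obj F (g B'))"
      using h k(1)[OF B(2)] e[OF B(1)] by simp
    then obtain f where f: "C.ar f (g B) (g B')" "on_mor F f = k B' \<cdot>\<^bsub>D\<^esub> (h \<cdot>\<^bsub>D\<^esub> e B)"
      using full ge B by blast
    have "e B' \<cdot>\<^bsub>D\<^esub> on_mor F f = h \<cdot>\<^bsub>D\<^esub> e B"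
      unfolding f(2) using D.comp_ext[OF k(3)[OF B(2)], of "h \<cdot>\<^bsub>D\<^esub> e B"] h e[OF B(1)] e[OF B(2)]
        k(1)[OF B(2)]
      by simp
    then have "P h f" unfolding P_def using f(1) h by simp
    then show ?thesis by blast
  qed
  have Puniq: "f = f'" if "P h f" "P h f'" "D.ar h B B'" for h f f' B B'
  proof -
    have B: "B' \<in> Obj D" using D.ar_Obj[OF that(3)] by auto
    have f: "C.ar f (g B) (g B')" "C.ar f' (g B) (g B')" "e B' \<cdot>\<^bsub>D\<^esub> on_mor F f = e B' \<cdot>\<^bsub>D\<^esub> on_mor F f'"
      using that unfolding P_def by simp_all
    have "on_mor F f = on_mor F f'"
      using D.isomorphism_mono[OF _ FD(3)[OF f(1)] FD(3)[OF f(2)] f(3)] ge[OF B] by blast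
    then show ?thesis using faithful f by blast
  qed
  define G where "G = \<lparr>on_obj = g, on_mor = (\<lambda>h. SOME f. P h f)\<rparr>"
  have Gm: "P h (on_mor G h)" if "D.ar h B B'" for h B B'
    using someI_ex[OF Pex[OF that]] unfolding G_def by simp
  have Gu: "on_mor G h = f" if "D.ar h B B'" "P h f" for h f B B'
    using Puniq[OF Gm that(2) that(1)] that(1) by blast
  have Gar: "C.ar (on_mor G h) (g B) (g B')" and Geq: "e B' \<cdot>\<^bsub>D\<^esub> on_mor F (on_mor G h) = h \<cdot>\<^bsub>D\<^esub> e B"
    if "D.ar h B B'" for h B B' using Gm[OF that] that unfolding P_def by simp_all
  have GF: "additive_functor D C G"
    unfolding additive_functor_def
  proof (intro conjI ballI)
    fix A assume A: "A \<in> Obj D"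
    show "on_obj G A \<in> Obj C" unfolding G_def using ge A by simp
    show "on_mor G (Ident D A) = Ident C (on_obj G A)"
    proof (rule Gu[of _ A A])
      show "P (Ident D A) (Ident C (on_obj G A))"
        unfolding P_def G_def using A ge[OF A] FD(2)[of "g A"] e[OF A] by simp
    qed (use A in simp)
  next
    fix A B f assume "A \<in> Obj D" "B \<in> Obj D" "f \<in> Hom D A B"
    then have "D.ar f A B" unfolding D.ar_def by blast
    then have "C.ar (on_mor G f) (g A) (g B)" by (rule Gar)
    then show "on_mor G f \<in> Hom C (on_obj G A) (on_obj G B)" unfolding G_def C.ar_def by simp
  next
    fix A B H f h assume "A \<in> Obj D" "B \<in> Obj D" "H \<in> Obj D" "f \<in> Hom D A B" "h \<in> Hom D B H"
    then have f: "D.ar f A B" and h: "D.ar h B H" unfolding D.ar_def by blast+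
    note ars = f h FD(3)[OF Gar[OF f]] FD(3)[OF Gar[OF h]] Gar[OF f] Gar[OF h]
      e[of A] e[of B] e[of H] D.ar_Obj[OF f] D.ar_Obj[OF h]
    show "on_mor G (h \<cdot>\<^bsub>D\<^esub> f) = on_mor G h \<cdot>\<^bsub>C\<^esub> on_mor G f"
    proof (rule Gu[of _ A H])
      have "e H \<cdot>\<^bsub>D\<^esub> (on_mor F (on_mor G h) \<cdot>\<^bsub>D\<^esub> on_mor F (on_mor G f)) = h \<cdot>\<^bsub>D\<^esub> (e B \<cdot>\<^bsub>D\<^esub> on_mor F
        (on_mor G f))"
        by (rule D.comp_ext2[OF Geq[OF h]]) (use ars in simp_all)
      also have "\<dots> = h \<cdot>\<^bsub>D\<^esub> (f \<cdot>\<^bsub>D\<^esub> e A)" unfolding Geq[OF f] ..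
      finally show "P (h \<cdot>\<^bsub>D\<^esub> f) (on_mor G h \<cdot>\<^bsub>C\<^esub> on_mor G f)"
        unfolding P_def using FD(4)[OF Gar[OF f] Gar[OF h]] ars by simp
    qed (use f h in simp)
  next
    fix A B f h assume "A \<in> Obj D" "B \<in> Obj D" "f \<in> Hom D A B" "h \<in> Hom D A B"
    then have f: "D.ar f A B" and h: "D.ar h A B" unfolding D.ar_def by blast+
    note ars = f h FD(3)[OF Gar[OF f]] FD(3)[OF Gar[OF h]] Gar[OF f] Gar[OF h]
      e[of A] e[of B] D.ar_Obj[OF f]
    show "on_mor G (Add D f h) = Add C (on_mor G f) (on_mor G h)"
    proof (rule Gu[of _ A B])
      show "P (Add D f h) (Add C (on_mor G f) (on_mor G h))"
        unfolding P_def using FD(5)[OF Gar[OF f] Gar[OF h]] ars Geq[OF f] Geq[OF h] by simp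
    qed (use f h in simp)
  qed
  have "\<exists>f. C.ar f (g (on_obj F A)) A \<and> on_mor F f = e (on_obj F A)" if "A \<in> Obj C" for A
    using full[of "g (on_obj F A)" A "e (on_obj F A)"] e[of "on_obj F A"] ge FD(1) that by blast
  then obtain \<eta> where \<eta>: "\<And>A. A \<in> Obj C \<Longrightarrow> C.ar (\<eta> A) (g (on_obj F A)) A"
    "\<And>A. A \<in> Obj C \<Longrightarrow> on_mor F (\<eta> A) = e (on_obj F A)" by metis
  have \<eta>iso: "isomorphism C (g (on_obj F A)) A (\<eta> A)" if A: "A \<in> Obj C" for A
  proof -
    have FA: "on_obj F A \<in> Obj D" "g (on_obj F A) \<in> Obj C" using FD(1) A ge by blast+
    obtain m where m: "C.ar m A (g (on_obj F A))" "on_mor F m = k (on_obj F A)"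
      using full[OF A FA(2)] k(1)[OF FA(1)] by blast
    have "on_mor F (m \<cdot>\<^bsub>C\<^esub> \<eta> A) = on_mor F (Ident C (g (on_obj F A)))"
      using FD(4)[OF \<eta>(1)[OF A] m(1)] FD(2)[OF FA(2)] m(2) \<eta>(2)[OF A] k(2)[OF FA(1)] by simp
    then have 1: "m \<cdot>\<^bsub>C\<^esub> \<eta> A = Ident C (g (on_obj F A))"
      using faithful[of "m \<cdot>\<^bsub>C\<^esub> \<eta> A" "g (on_obj F A)" "g (on_obj F A)"] m(1) \<eta>(1)[OF A] FA by simp
    have "on_mor F (\<eta> A \<cdot>\<^bsub>C\<^esub> m) = on_mor F (Ident C A)"
      using FD(4)[OF m(1) \<eta>(1)[OF A]] FD(2)[OF A] m(2) \<eta>(2)[OF A] k(3)[OF FA(1)] by simp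
    then have 2: "\<eta> A \<cdot>\<^bsub>C\<^esub> m = Ident C A"
      using faithful[of "\<eta> A \<cdot>\<^bsub>C\<^esub> m" A A] m(1) \<eta>(1)[OF A] A by simp
    show ?thesis unfolding C.isomorphism_iff using \<eta>(1)[OF A] m(1) 1 2 by blast
  qed
  have "naturally_isomorphic C C (G \<circ>\<^sub>F F) id_functor"
    unfolding naturally_isomorphic_def
  proof (intro exI[of _ \<eta>] conjI ballI)
    fix A assume "A \<in> Obj C"
    then show "isomorphism C (on_obj (G \<circ>\<^sub>F F) A) (on_obj id_functor A) (\<eta> A)"
      using \<eta>iso unfolding comp_functor_def id_functor_def G_def by simp
  next
    fix A B f assume A: "A \<in> Obj C" and B: "B \<in> Obj C" and "f \<in> Hom C A B"
    then have f: "C.ar f A B" unfolding C.ar_def by blast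
    have GFf: "C.ar (on_mor G (on_mor F f)) (g (on_obj F A)) (g (on_obj F B))" using Gar[OF FD(3)[OF
      f]] .
    have "on_mor F (\<eta> B \<cdot>\<^bsub>C\<^esub> on_mor G (on_mor F f)) = on_mor F (f \<cdot>\<^bsub>C\<^esub> \<eta> A)"
      using FD(4)[OF GFf \<eta>(1)[OF B]] FD(4)[OF \<eta>(1)[OF A] f] Geq[OF FD(3)[OF f]] \<eta>(2) A B by simp
    then have "\<eta> B \<cdot>\<^bsub>C\<^esub> on_mor G (on_mor F f) = f \<cdot>\<^bsub>C\<^esub> \<eta> A"
      using faithful[of _ "g (on_obj F A)" B] C.ar_comp[OF GFf \<eta>(1)[OF B]] C.ar_comp[OF \<eta>(1)[OF A]
        f] by blast
    then show "\<eta> B \<cdot>\<^bsub>C\<^esub> on_mor (G \<circ>\<^sub>F F) f = on_mor id_functor f \<cdot>\<^bsub>C\<^esub> \<eta> A"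
      unfolding comp_functor_def id_functor_def by simp
  qed
  moreover have "naturally_isomorphic D D (F \<circ>\<^sub>F G) id_functor"
    unfolding naturally_isomorphic_def
  proof (intro exI[of _ e] conjI ballI)
    fix A assume "A \<in> Obj D"
    then show "isomorphism D (on_obj (F \<circ>\<^sub>F G) A) (on_obj id_functor A) (e A)"
      using ge unfolding comp_functor_def id_functor_def G_def by simp
  next
    fix A B f assume "A \<in> Obj D" "B \<in> Obj D" "f \<in> Hom D A B"
    then have f: "D.ar f A B" unfolding D.ar_def by blast
    then show "e B \<cdot>\<^bsub>D\<^esub> on_mor (F \<circ>\<^sub>F G) f = on_mor id_functor f \<cdot>\<^bsub>D\<^esub> e A"
      using Geq[OF f] unfolding comp_functor_def id_functor_def by simp
  qed
  ultimately show ?thesis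
    unfolding equivalence_of_categories_def quasi_inverse_def using F GF by blast
qed

section \<open>Morphisms determined on a cover\<close>

context exact_category
begin

lemma deflation_epi:
  assumes "deflation C p" "ar p B D" "ar x D X" "ar y D X" "x \<cdot> p = y \<cdot> p"
  shows "x = y"
  using deflation_conf[OF assms(1,2)] conf_epi assms(3-5) by metis

text \<open>Deflations are epimorphisms. The family is indexed by \<open>I\<close> so that the same
  lemmas serve \<open>M\<close> itself and its image under \<open>\<Phi>\<close>, which need not be
  closed under isomorphism.\<close>

lemma cover_faithful:
  assumes cover: "\<And>A. A \<in> Obj C \<Longrightarrow> \<exists>i\<in>I. \<exists>p. ar p (ob i) A \<and> deflation C p"
    and f: "ar f A B" "ar g A B" and eq: "\<And>i x. i \<in> I \<Longrightarrow> ar x (ob i) A \<Longrightarrow> f \<cdot> x = g \<cdot> x"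
  shows "f = g"
  using cover[of A] deflation_epi f eq ar_Obj[OF f(1)] by metis

text \<open>A Yoneda lemma for covers: \<open>A\<close> is the cokernel of the kernel of a cover
  \<open>m\<close>, so a natural family \<open>\<alpha>\<close> is composition with the map induced
  by its value at \<open>m\<close>.\<close>

lemma cover_full:
  assumes cover: "\<And>A. A \<in> Obj C \<Longrightarrow> \<exists>i\<in>I. \<exists>p. ar p (ob i) A \<and> deflation C p"
    and A: "A \<in> Obj C" and \<alpha>: "\<And>i x. i \<in> I \<Longrightarrow> ar x (ob i) A \<Longrightarrow> ar (\<alpha> i x) (ob i) B"
    and nat: "\<And>i j x s. i \<in> I \<Longrightarrow> j \<in> I \<Longrightarrow> ar x (ob i) A \<Longrightarrow> ar s (ob j) (ob i) \<Longrightarrow> \<alpha> j (x \<cdot> s) = \<alpha> i x \<cdot> s"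
  obtains f where "ar f A B" "\<And>i x. i \<in> I \<Longrightarrow> ar x (ob i) A \<Longrightarrow> \<alpha> i x = f \<cdot> x"
proof -
  obtain i m where i: "i \<in> I" "ar m (ob i) A" "deflation C m" using cover[OF A] by blast
  have am: "ar (\<alpha> i m) (ob i) B" using \<alpha> i by blast
  have B: "B \<in> Obj C" and oi: "ob i \<in> Obj C" using ar_Obj[OF am] by blast+
  obtain K k where c: "conf K (ob i) A k m" using deflation_conf i(2,3) by metis
  have k: "ar k K (ob i)" "K \<in> Obj C" using conf_ar[OF c] conf_Obj[OF c] by blast+
  obtain j p where j: "j \<in> I" "ar p (ob j) K" "deflation C p" using cover[OF k(2)] by blast
  have oj: "ob j \<in> Obj C" using ar_Obj[OF j(2)] by blast
  have kp: "ar (k \<cdot> p) (ob j) (ob i)" "ar (Zero C (ob j) (ob i)) (ob j) (ob i)" using k j(2) oi oj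
    by simp_all
  \<comment> \<open>The maps \<open>k \<cdot> p\<close> and zero agree after \<open>m\<close>, so
    naturality at both shows that \<open>\<alpha> i m\<close> kills
    \<open>k \<cdot> p\<close>.\<close>
  have "m \<cdot> (k \<cdot> p) = m \<cdot> Zero C (ob j) (ob i)"
    using comp_ext[OF conf_comp[OF c], of p] i(2) k j(2) oj A by simp
  then have "\<alpha> i m \<cdot> (k \<cdot> p) = \<alpha> i m \<cdot> Zero C (ob j) (ob i)"
    using nat[OF i(1) j(1) i(2) kp(1)] nat[OF i(1) j(1) i(2) kp(2)] by simp
  then have "(\<alpha> i m \<cdot> k) \<cdot> p = Zero C K B \<cdot> p" using am k j(2) oj B by simp
  then have "\<alpha> i m \<cdot> k = Zero C K B"
    using deflation_epi[OF j(3,2)] am k B by simp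
  then obtain f where f: "ar f A B" "f \<cdot> m = \<alpha> i m" using conf_colift[OF c am] by blast
  have "\<alpha> l x = f \<cdot> x" if l: "l \<in> I" and x: "ar x (ob l) A" for l x
  proof -
    \<comment> \<open>An arbitrary \<open>x\<close> need not factor through \<open>m\<close>, but it
      does after the deflation \<open>r\<close>. A further cover \<open>t\<close> returns to the
      family, and \<open>r \<cdot> t\<close> can be cancelled.\<close>
    obtain P n r g where P: "conf K P (ob l) n r" "ar g P (ob i)" "m \<cdot> g = x \<cdot> r"
      using conf_pullback[OF c x] by metis
    have r: "ar r P (ob l)" "P \<in> Obj C" using conf_ar[OF P(1)] conf_Obj[OF P(1)] by blast+
    obtain q t where q: "q \<in> I" "ar t (ob q) P" "deflation C t" using cover[OF r(2)] by blast
    have rt: "ar (r \<cdot> t) (ob q) (ob l)" "ar (g \<cdot> t) (ob q) (ob i)" using r(1) q(2) P(2) by simp_all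
    have d: "deflation C (r \<cdot> t)" using deflation_comp[OF q(2) r(1) q(3) conf_deflation[OF P(1)]] .
    have eq: "m \<cdot> (g \<cdot> t) = x \<cdot> (r \<cdot> t)" using comp_ext2[OF P(3), of t] P(2) i(2) x r(1) q(2) by simp
    have "\<alpha> l x \<cdot> (r \<cdot> t) = \<alpha> i m \<cdot> (g \<cdot> t)"
      using nat[OF i(1) q(1) i(2) rt(2)] nat[OF l q(1) x rt(1)] eq by simp
    also have "\<dots> = f \<cdot> (m \<cdot> (g \<cdot> t))"
      using comp_ext[OF f(2), of "g \<cdot> t"] f(1) i(2) rt(2) by simp
    also have "\<dots> = (f \<cdot> x) \<cdot> (r \<cdot> t)" unfolding eq using f(1) x rt(1) by simp
    finally show ?thesis using deflation_epi[OF d rt(1) \<alpha>[OF l x], of "f \<cdot> x"] f(1) x by simp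
  qed
  then show ?thesis using that f(1) by blast
qed

text \<open>Preimages under composition with \<open>f\<close> form a natural family by injectivity,
  hence are composition with some \<open>g\<close>; both composites of \<open>f\<close> and
  \<open>g\<close> are identities on the cover.\<close>

lemma cover_isomorphism:
  assumes cover: "\<And>A. A \<in> Obj C \<Longrightarrow> \<exists>i\<in>I. \<exists>p. ar p (ob i) A \<and> deflation C p"
    and f: "ar f A B"
    and inj: "\<And>i x y. i \<in> I \<Longrightarrow> ar x (ob i) A \<Longrightarrow> ar y (ob i) A \<Longrightarrow> f \<cdot> x = f \<cdot> y \<Longrightarrow> x = y"
    and surj: "\<And>i y. i \<in> I \<Longrightarrow> ar y (ob i) B \<Longrightarrow> \<exists>x. ar x (ob i) A \<and> f \<cdot> x = y"
  shows "isomorphism C A B f"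
proof -
  have AB: "A \<in> Obj C" "B \<in> Obj C" using ar_Obj[OF f] by blast+
  define \<alpha> where "\<alpha> i y = (SOME x. ar x (ob i) A \<and> f \<cdot> x = y)" for i y
  have \<alpha>: "ar (\<alpha> i y) (ob i) A \<and> f \<cdot> \<alpha> i y = y" if "i \<in> I" "ar y (ob i) B" for i y
    unfolding \<alpha>_def by (rule someI_ex[OF surj[OF that]])
  have "\<alpha> j (x \<cdot> s) = \<alpha> i x \<cdot> s" if "i \<in> I" "j \<in> I" "ar x (ob i) B" "ar s (ob j) (ob i)" for i j x s
  proof (rule inj[OF that(2)])
    have xs: "ar (x \<cdot> s) (ob j) B" using that by simp
    show "ar (\<alpha> j (x \<cdot> s)) (ob j) A" using \<alpha>[OF that(2) xs] by blast
    show "ar (\<alpha> i x \<cdot> s) (ob j) A" using \<alpha>[OF that(1,3)] that(4) by simp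
    have "f \<cdot> (\<alpha> i x \<cdot> s) = x \<cdot> s" using \<alpha>[OF that(1,3)] that(4) f by (intro comp_ext) simp_all
    then show "f \<cdot> \<alpha> j (x \<cdot> s) = f \<cdot> (\<alpha> i x \<cdot> s)" using \<alpha>[OF that(2) xs] by simp
  qed
  then obtain g where g: "ar g B A" "\<And>i x. i \<in> I \<Longrightarrow> ar x (ob i) B \<Longrightarrow> \<alpha> i x = g \<cdot> x"
    using cover_full[OF cover AB(2), where \<alpha> = \<alpha> and B = A] \<alpha> by metis
  have fg: "f \<cdot> g = Ident C B"
  proof (rule cover_faithful[OF cover])
    fix i x assume i: "i \<in> I" "ar x (ob i) B"
    have "f \<cdot> (g \<cdot> x) = x" using g(2)[OF i] \<alpha>[OF i] by simp
    then show "(f \<cdot> g) \<cdot> x = Ident C B \<cdot> x" using f g(1) i(2) by simp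
  qed (use f g(1) AB in simp_all)
  have "g \<cdot> f = Ident C A"
  proof (rule cover_faithful[OF cover])
    fix i x assume i: "i \<in> I" "ar x (ob i) A"
    show "(g \<cdot> f) \<cdot> x = Ident C A \<cdot> x"
    proof (rule inj[OF i(1)])
      show "f \<cdot> ((g \<cdot> f) \<cdot> x) = f \<cdot> (Ident C A \<cdot> x)"
        using comp_ext[OF fg, of "f \<cdot> x"] f g(1) i(2) by simp
    qed (use f g(1) i(2) AB in simp_all)
  qed (use f g(1) AB in simp_all)
  then show ?thesis unfolding isomorphism_iff using f g(1) fg by blast
qed

lemma induced_category:
  assumes "M \<subseteq> Obj C"
  shows "category (induced_dexact d C M)"
  unfolding induced_dexact_def
  by (rule category.intro; unfold dexcat.simps precat.simps;
      use assms Hom_disjoint Ident_in_Hom Comp_in_Hom Comp_Ident_right Comp_Ident_left Comp_assoc in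
        \<open>meson subsetD\<close>)

lemma induced_ar:
  assumes "M \<subseteq> Obj C"
  shows "category.ar (induced_dexact d C M) f A B \<longleftrightarrow> A \<in> M \<and> B \<in> M \<and> ar f A B"
  unfolding category.ar_def[OF induced_category[OF assms]] ar_def
  using assms by (auto simp: induced_dexact_def)

lemma induced_isomorphism:
  "isomorphism (induced_dexact d C M) A B f \<Longrightarrow> M \<subseteq> Obj C \<Longrightarrow> isomorphism C A B f"
  unfolding isomorphism_def induced_dexact_def by auto

end

section \<open>Extending an equivalence of cluster tilting subcategories\<close>

text \<open>The quasi-inverse \<open>\<Gamma>\<close> is a parameter to make the data symmetric: the
  construction is run a second time from \<open>E'\<close> to \<open>E\<close> for essential
  surjectivity.\<close>

locale tilting_equivalence =
  src: cluster_tilting_category E d M + tgt: cluster_tilting_category E' d N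
  for E :: "('o, 'm) excat" and d :: nat and M :: "'o set"
    and E' :: "('p, 'n) excat" and N :: "'p set" +
  fixes \<Phi> :: "('o, 'm, 'p, 'n) func" and \<Gamma> :: "('p, 'n, 'o, 'm) func"
  assumes qi: "quasi_inverse (induced_dexact d E M) (induced_dexact d E' N) \<Phi> \<Gamma>"
    and pres: "preserves_AdmSeq (induced_dexact d E M) (induced_dexact d E' N) \<Phi>"
    and pres': "preserves_AdmSeq (induced_dexact d E' N) (induced_dexact d E M) \<Gamma>"
begin

abbreviation Fo where "Fo \<equiv> on_obj \<Phi>"
abbreviation Fm where "Fm \<equiv> on_mor \<Phi>"

lemma MN: "M \<subseteq> Obj E" "N \<subseteq> Obj E'"
  using src.M_Obj tgt.M_Obj by blast+

lemmas src_ind = src.induced_category[OF MN(1), of d]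
lemmas tgt_ind = tgt.induced_category[OF MN(2), of d]
lemmas src_ind_ar = src.induced_ar[OF MN(1), of d]
lemmas tgt_ind_ar = tgt.induced_ar[OF MN(2), of d]

abbreviation src_comp (infixl "\<star>" 70) where "g \<star> f \<equiv> g \<cdot>\<^bsub>E\<^esub> f"
abbreviation tgt_comp (infixl "\<bullet>" 70) where "g \<bullet> f \<equiv> g \<cdot>\<^bsub>E'\<^esub> f"

lemma ind_simps [simp]:
  "Obj (induced_dexact d E M) = M" "Obj (induced_dexact d E' N) = N"
  "g \<cdot>\<^bsub>induced_dexact d E M\<^esub> f = g \<cdot>\<^bsub>E\<^esub> f" "g' \<cdot>\<^bsub>induced_dexact d E' N\<^esub> f' = g' \<cdot>\<^bsub>E'\<^esub> f'"
  "Ident (induced_dexact d E M) = Ident E" "Ident (induced_dexact d E' N) = Ident E'"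
  "Add (induced_dexact d E M) = Add E" "Add (induced_dexact d E' N) = Add E'"
  by (simp_all add: induced_dexact_def)

lemma \<Phi>_functor: "additive_functor (induced_dexact d E M) (induced_dexact d E' N) \<Phi>"
  using qi unfolding quasi_inverse_def by blast

lemmas \<Phi>D = additive_functorD[OF \<Phi>_functor src_ind tgt_ind, unfolded src_ind_ar tgt_ind_ar ind_simps]

lemma F_obj: "S \<in> M \<Longrightarrow> Fo S \<in> N"
  using \<Phi>D(1) .

lemma F_Obj: "S \<in> M \<Longrightarrow> Fo S \<in> Obj E'"
  using \<Phi>D(1) MN(2) by blast

lemma F_ar: "S \<in> M \<Longrightarrow> T \<in> M \<Longrightarrow> src.ar f S T \<Longrightarrow> tgt.ar (Fm f) (Fo S) (Fo T)"
  using \<Phi>D(3) by blast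

lemma F_comp:
  "S \<in> M \<Longrightarrow> T \<in> M \<Longrightarrow> U \<in> M \<Longrightarrow> src.ar f S T \<Longrightarrow> src.ar g T U \<Longrightarrow>
    Fm (g \<star> f) = Fm g \<bullet> Fm f"
  using \<Phi>D(4) by blast

lemma F_add:
  "S \<in> M \<Longrightarrow> T \<in> M \<Longrightarrow> src.ar f S T \<Longrightarrow> src.ar g S T \<Longrightarrow> Fm (Add E f g) = Add E' (Fm f) (Fm g)"
  using \<Phi>D(5) by blast

lemma F_faithful:
  assumes "S \<in> M" "T \<in> M" "src.ar f S T" "src.ar g S T" "Fm f = Fm g"
  shows "f = g"
  using quasi_inverse_faithful[OF qi src_ind tgt_ind, of f S T g] assms unfolding src_ind_ar by blast

lemma F_full:
  assumes "S \<in> M" "T \<in> M" "tgt.ar g (Fo S) (Fo T)"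
  obtains f where "src.ar f S T" "Fm f = g"
  using quasi_inverse_full[OF qi src_ind tgt_ind, of S T g] assms F_obj
  unfolding src_ind_ar tgt_ind_ar ind_simps by blast

lemma F_ess_surj:
  assumes "U \<in> N"
  obtains S e where "S \<in> M" "isomorphism E' (Fo S) U e"
  using quasi_inverse_ess_surj[OF qi, of U] assms tgt.induced_isomorphism[OF _ MN(2)]
  unfolding ind_simps by metis

lemma F_deflation:
  assumes "S \<in> M" "T \<in> M" "src.ar p S T" "deflation E p"
  shows "deflation E' (Fm p)"
proof -
  obtain Y f where *: "(Y, f) \<in> AdmSeq (induced_dexact d E M)" "f 0 = p"
    using src.deflation_AdmSeq[OF assms(2,1,3,4)] by metis
  then have "(Fo \<circ> Y, Fm \<circ> f) \<in> AdmSeq (induced_dexact d E' N)"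
    using pres unfolding preserves_AdmSeq_def by blast
  then show ?thesis using tgt.AdmSeq_deflation * by fastforce
qed

lemma src_cover:
  assumes "A \<in> Obj E"
  shows "\<exists>S\<in>M. \<exists>p. src.ar p S A \<and> deflation E p"
  using src.ex_cover[OF assms] by metis

lemma F_cover:
  assumes "A \<in> Obj E'"
  shows "\<exists>S\<in>M. \<exists>p. tgt.ar p (Fo S) A \<and> deflation E' p"
proof -
  obtain U q where U: "U \<in> N" "tgt.ar q U A" "deflation E' q" using tgt.ex_cover[OF assms] by metis
  obtain S e where S: "S \<in> M" "isomorphism E' (Fo S) U e" using F_ess_surj[OF U(1)] by metis
  have e: "tgt.ar e (Fo S) U" using S(2) tgt.isomorphism_iff by blast
  show ?thesis
    using S(1) tgt.ar_comp[OF e U(2)] tgt.deflation_comp[OF e U(2) tgt.isomorphism_deflation[OF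
      S(2)] U(3)]
    by blast
qed

section \<open>Representing objects in the target category\<close>

text \<open>A natural isomorphism \<open>Hom(-, A) \<cong> Hom(\<Phi> -, A')\<close> of functors on \<open>M\<close>.  The object at which
  \<open>\<theta>\<close> is evaluated is the domain of its argument.\<close>

definition represents :: "'o \<Rightarrow> 'p \<Rightarrow> ('m \<Rightarrow> 'n) \<Rightarrow> bool" where
  "represents A A' \<theta> \<longleftrightarrow> A \<in> Obj E \<and> A' \<in> Obj E' \<and>
     (\<forall>S\<in>M. \<forall>x. src.ar x S A \<longrightarrow> tgt.ar (\<theta> x) (Fo S) A') \<and>
     (\<forall>S\<in>M. \<forall>x y. src.ar x S A \<longrightarrow> src.ar y S A \<longrightarrow> \<theta> x = \<theta> y \<longrightarrow> x = y) \<and>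
     (\<forall>S\<in>M. \<forall>y. tgt.ar y (Fo S) A' \<longrightarrow> (\<exists>x. src.ar x S A \<and> \<theta> x = y)) \<and>
     (\<forall>S\<in>M. \<forall>T\<in>M. \<forall>x s. src.ar x S A \<longrightarrow> src.ar s T S \<longrightarrow> \<theta> (x \<star> s) = \<theta> x \<bullet> Fm s) \<and>
     (\<forall>S\<in>M. \<forall>x y. src.ar x S A \<longrightarrow> src.ar y S A \<longrightarrow> \<theta> (Add E x y) = Add E' (\<theta> x) (\<theta> y))"

lemma representsD:
  assumes "represents A A' \<theta>"
  shows "A \<in> Obj E" "A' \<in> Obj E'"
    and "S \<in> M \<Longrightarrow> src.ar x S A \<Longrightarrow> tgt.ar (\<theta> x) (Fo S) A'"
    and "S \<in> M \<Longrightarrow> src.ar x S A \<Longrightarrow> src.ar y S A \<Longrightarrow> \<theta> x = \<theta> y \<Longrightarrow> x = y"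
    and "S \<in> M \<Longrightarrow> tgt.ar z (Fo S) A' \<Longrightarrow> \<exists>x. src.ar x S A \<and> \<theta> x = z"
    and "S \<in> M \<Longrightarrow> T \<in> M \<Longrightarrow> src.ar x S A \<Longrightarrow> src.ar s T S \<Longrightarrow> \<theta> (x \<star> s) = \<theta> x \<bullet> Fm s"
    and "S \<in> M \<Longrightarrow> src.ar x S A \<Longrightarrow> src.ar y S A \<Longrightarrow> \<theta> (Add E x y) = Add E' (\<theta> x) (\<theta> y)"
  using assms unfolding represents_def by blast+

lemma represents_Zero:
  assumes r: "represents A A' \<theta>" and S: "S \<in> M"
  shows "\<theta> (Zero E S A) = Zero E' (Fo S) A'"
proof -
  have Obj: "S \<in> Obj E" "A \<in> Obj E" "Fo S \<in> Obj E'" "A' \<in> Obj E'"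
    using representsD(1,2)[OF r] S MN F_Obj by blast+
  have z: "src.ar (Zero E S A) S A" using Obj by simp
  have tz: "tgt.ar (\<theta> (Zero E S A)) (Fo S) A'" using representsD(3)[OF r S z] .
  have "Add E' (\<theta> (Zero E S A)) (\<theta> (Zero E S A)) = \<theta> (Add E (Zero E S A) (Zero E S A))"
    using representsD(7)[OF r S z z] by simp
  also have "Add E (Zero E S A) (Zero E S A) = Zero E S A" using Obj by simp
  also have "\<theta> (Zero E S A) = Add E' (\<theta> (Zero E S A)) (Zero E' (Fo S) A')"
    using tz by simp
  finally show ?thesis by (rule tgt.add_left_cancel) (use tz Obj in simp_all)
qed

lemma represents_self:
  assumes "T \<in> M"
  shows "represents T (Fo T) Fm"
  unfolding represents_def
proof (intro conjI ballI allI impI)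
  show "T \<in> Obj E" "Fo T \<in> Obj E'" using assms MN F_Obj by blast+
  show "tgt.ar (Fm x) (Fo S) (Fo T)" if "S \<in> M" "src.ar x S T" for S x
    using F_ar[OF that(1) assms that(2)] .
  show "x = y" if "S \<in> M" "src.ar x S T" "src.ar y S T" "Fm x = Fm y" for S x y
    using F_faithful[OF that(1) assms that(2-4)] .
  show "\<exists>x. src.ar x S T \<and> Fm x = y" if "S \<in> M" "tgt.ar y (Fo S) (Fo T)" for S y
    using F_full[OF that(1) assms that(2)] by metis
  show "Fm (x \<star> s) = Fm x \<bullet> Fm s" if "S \<in> M" "U \<in> M" "src.ar x S T" "src.ar s U S" for S U x s
    using F_comp[OF that(2,1) assms that(4,3)] .
  show "Fm (Add E x y) = Add E' (Fm x) (Fm y)" if "S \<in> M" "src.ar x S T" "src.ar y S T" for S x y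
    using F_add[OF that(1) assms that(2,3)] .
qed

text \<open>Cover \<open>D'\<close> by some \<open>\<Phi> T\<close>; the corresponding \<open>t : T \<rightarrow> D\<close> lifts along \<open>s\<close> after a deflation
  between objects of \<open>M\<close>, and those are preserved by \<open>\<Phi>\<close>.\<close>

lemma represents_deflation:
  assumes r: "represents D D' \<theta>" and S: "S \<in> M" and s: "src.ar s S D" and ds: "deflation E s"
  shows "deflation E' (\<theta> s)"
proof -
  note rD = representsD[OF r]
  obtain T q where T: "T \<in> M" "tgt.ar q (Fo T) D'" "deflation E' q" using F_cover[OF rD(2)] by blast
  obtain t where t: "src.ar t T D" "\<theta> t = q" using rD(5)[OF T(1,2)] by blast
  obtain K i where c: "src.conf K S D i s" using src.deflation_conf[OF ds s] by metis
  obtain P j r g where P: "src.conf K P T j r" "src.ar g P S" "s \<star> g = t \<star> r"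
    using src.conf_pullback[OF c t(1)] by metis
  have r: "src.ar r P T" "P \<in> Obj E" using src.conf_ar[OF P(1)] src.conf_Obj[OF P(1)] by blast+
  obtain U w where U: "U \<in> M" "src.ar w U P" "deflation E w" using src_cover[OF r(2)] by blast
  have rw: "src.ar (r \<star> w) U T" "deflation E (r \<star> w)"
    using src.ar_comp[OF U(2) r(1)] src.deflation_comp[OF U(2) r(1) U(3) src.conf_deflation[OF P(1)]] .
  have gw: "src.ar (g \<star> w) U S" using src.ar_comp[OF U(2) P(2)] .
  have "s \<star> (g \<star> w) = t \<star> (r \<star> w)"
    by (rule src.comp_ext2[OF P(3)]) (use s t(1) r P(2) U(2) in simp_all)
  then have "\<theta> s \<bullet> Fm (g \<star> w) = \<theta> t \<bullet> Fm (r \<star> w)"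
    using rD(6)[OF S U(1) s gw] rD(6)[OF T(1) U(1) t(1) rw(1)] by simp
  moreover have "deflation E' (\<theta> t \<bullet> Fm (r \<star> w))"
    unfolding t(2)
    by (rule tgt.deflation_comp[OF F_ar[OF U(1) T(1) rw(1)] T(2) F_deflation[OF U(1) T(1) rw] T(3)])
  ultimately have "deflation E' (\<theta> s \<bullet> Fm (g \<star> w))" by simp
  then show ?thesis
    using tgt.deflation_cancel[OF tgt.wic F_ar[OF U(1) S gw] rD(3)[OF S s]] by blast
qed

text \<open>Hom functors are left exact, so the isomorphisms for \<open>T\<close> and
  \<open>D\<close> restrict to kernels. Each property of the restriction is checked after composing
  with the monomorphism \<open>i'\<close>.\<close>

lemma represents_kernel:
  assumes c: "src.conf A T D i p" and T: "T \<in> M" and r: "represents D D' \<theta>"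
  shows "\<exists>A' \<theta>'. represents A A' \<theta>'"
proof -
  note rD = representsD[OF r]
  have i: "src.ar i A T" and p: "src.ar p T D" and A: "A \<in> Obj E"
    using src.conf_ar[OF c] src.conf_Obj[OF c] by blast+
  have \<theta>p: "tgt.ar (\<theta> p) (Fo T) D'" using rD(3)[OF T p] .
  have "deflation E' (\<theta> p)" using represents_deflation[OF r T p src.conf_deflation[OF c]] .
  then obtain A' i' where c': "tgt.conf A' (Fo T) D' i' (\<theta> p)" using tgt.deflation_conf[OF _ \<theta>p] by
    metis
  have i': "tgt.ar i' A' (Fo T)" and A': "A' \<in> Obj E'" using tgt.conf_ar[OF c'] tgt.conf_Obj[OF c']
    by blast+
  \<comment> \<open>The domain \<open>S\<close> is read off from \<open>x\<close>, as
    \<open>represents\<close> requires \<open>\<theta>'\<close> to be a function of morphisms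
    alone.\<close>
  define \<theta>' where "\<theta>' x = (SOME y. tgt.ar y (Fo (src.dom x)) A' \<and> i' \<bullet> y = Fm (i \<star> x))" for x
  have \<theta>': "tgt.ar (\<theta>' x) (Fo S) A'" "i' \<bullet> \<theta>' x = Fm (i \<star> x)" if S: "S \<in> M" and x: "src.ar x S A"
    for S x
  proof -
    have SO: "S \<in> Obj E" using MN S by blast
    have ix: "src.ar (i \<star> x) S T" using src.ar_comp[OF x i] .
    have "\<theta> p \<bullet> Fm (i \<star> x) = \<theta> (p \<star> (i \<star> x))" using rD(6)[OF T S p ix] by simp
    also have "p \<star> (i \<star> x) = Zero E S D"
      using src.comp_ext[OF src.conf_comp[OF c], of x] i p x SO rD(1) A by simp
    also have "\<theta> (Zero E S D) = Zero E' (Fo S) D'" using represents_Zero[OF r S] .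
    finally obtain y where "tgt.ar y (Fo S) A'" "i' \<bullet> y = Fm (i \<star> x)"
      using tgt.conf_lift[OF c' F_ar[OF S T ix]] by blast
    then have "\<exists>y. tgt.ar y (Fo (src.dom x)) A' \<and> i' \<bullet> y = Fm (i \<star> x)"
      using x by auto
    then have "tgt.ar (\<theta>' x) (Fo (src.dom x)) A' \<and> i' \<bullet> \<theta>' x = Fm (i \<star> x)"
      unfolding \<theta>'_def by (rule someI_ex)
    then show "tgt.ar (\<theta>' x) (Fo S) A'" "i' \<bullet> \<theta>' x = Fm (i \<star> x)" using x by simp_all
  qed
  have "represents A A' \<theta>'"
    unfolding represents_def
  proof (intro conjI ballI allI impI A A')
    show "tgt.ar (\<theta>' x) (Fo S) A'" if "S \<in> M" "src.ar x S A" for S x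
      using \<theta>'(1)[OF that] .
    show "x = y" if S: "S \<in> M" and x: "src.ar x S A" and y: "src.ar y S A" and e: "\<theta>' x = \<theta>' y" for
      S x y
    proof -
      have "Fm (i \<star> x) = Fm (i \<star> y)" using \<theta>'(2)[OF S x] \<theta>'(2)[OF S y] e by simp
      then have "i \<star> x = i \<star> y"
        using F_faithful[OF S T src.ar_comp[OF x i] src.ar_comp[OF y i]] by blast
      then show ?thesis using src.conf_mono[OF c x y] by blast
    qed
    show "\<exists>x. src.ar x S A \<and> \<theta>' x = y" if S: "S \<in> M" and y: "tgt.ar y (Fo S) A'" for S y
    proof -
      have SO: "S \<in> Obj E" "Fo S \<in> Obj E'" using MN S F_Obj by blast+
      obtain z where z: "src.ar z S T" "Fm z = i' \<bullet> y" using F_full[OF S T tgt.ar_comp[OF y i']] by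
        metis
      have "\<theta> (p \<star> z) = \<theta> p \<bullet> (i' \<bullet> y)" using rD(6)[OF T S p z(1)] z(2) by simp
      also have "\<dots> = Zero E' (Fo S) D'"
        using tgt.comp_ext[OF tgt.conf_comp[OF c'], of y] i' \<theta>p y SO rD(2) A' by simp
      also have "\<dots> = \<theta> (Zero E S D)" using represents_Zero[OF r S] by simp
      finally have "p \<star> z = Zero E S D"
        by (rule rD(4)[OF S src.ar_comp[OF z(1) p], rotated]) (use SO rD(1) in simp)
      then obtain x where x: "src.ar x S A" "i \<star> x = z" using src.conf_lift[OF c z(1)] by blast
      have "\<theta>' x = y"
        by (rule tgt.conf_mono[OF c' \<theta>'(1)[OF S x(1)] y]) (use \<theta>'(2)[OF S x(1)] x(2) z(2) in simp)
      then show ?thesis using x(1) by blast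
    qed
    show "\<theta>' (x \<star> s) = \<theta>' x \<bullet> Fm s"
      if S: "S \<in> M" and U: "U \<in> M" and x: "src.ar x S A" and s: "src.ar s U S" for S U x s
    proof -
      have xs: "src.ar (x \<star> s) U A" using src.ar_comp[OF s x] .
      have ix: "src.ar (i \<star> x) S T" using src.ar_comp[OF x i] .
      have Fs: "tgt.ar (Fm s) (Fo U) (Fo S)" using F_ar[OF U S s] .
      have "i' \<bullet> \<theta>' (x \<star> s) = Fm ((i \<star> x) \<star> s)" using \<theta>'(2)[OF U xs] i x s by simp
      also have "\<dots> = Fm (i \<star> x) \<bullet> Fm s" using F_comp[OF U S T s ix] .
      also have "\<dots> = i' \<bullet> (\<theta>' x \<bullet> Fm s)"
        using tgt.comp_ext[OF \<theta>'(2)[OF S x], of "Fm s"] i' \<theta>'(1)[OF S x] Fs by simp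
      finally show ?thesis
        using tgt.conf_mono[OF c' \<theta>'(1)[OF U xs] tgt.ar_comp[OF Fs \<theta>'(1)[OF S x]]] by blast
    qed
    show "\<theta>' (Add E x y) = Add E' (\<theta>' x) (\<theta>' y)"
      if S: "S \<in> M" and x: "src.ar x S A" and y: "src.ar y S A" for S x y
    proof -
      have xy: "src.ar (Add E x y) S A" using x y by simp
      have a: "tgt.ar (Add E' (\<theta>' x) (\<theta>' y)) (Fo S) A'" using \<theta>'(1)[OF S x] \<theta>'(1)[OF S y] by simp
      have "i' \<bullet> \<theta>' (Add E x y) = Fm (Add E (i \<star> x) (i \<star> y))" using \<theta>'(2)[OF S xy] i x y by simp
      also have "\<dots> = Add E' (Fm (i \<star> x)) (Fm (i \<star> y))"
        using F_add[OF S T src.ar_comp[OF x i] src.ar_comp[OF y i]] .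
      also have "\<dots> = i' \<bullet> Add E' (\<theta>' x) (\<theta>' y)"
        using \<theta>'(2)[OF S x] \<theta>'(2)[OF S y] \<theta>'(1)[OF S x] \<theta>'(1)[OF S y] i' by simp
      finally show ?thesis using tgt.conf_mono[OF c' \<theta>'(1)[OF S xy] a] by blast
    qed
  qed
  then show ?thesis by blast
qed

lemma ex_represents:
  assumes "A \<in> Obj E"
  shows "\<exists>A' \<theta>. represents A A' \<theta>"
  using assms
proof (rule src.coresolution_induct)
  show "\<exists>A' \<theta>. represents T A' \<theta>" if "T \<in> M" for T using represents_self[OF that] by blast
  show "\<exists>A' \<theta>. represents A A' \<theta>"
    if "src.conf A T D i p" "T \<in> M" "\<exists>A' \<theta>. represents D A' \<theta>" for A T D i p
    using represents_kernel[OF that(1,2)] that(3) by blast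
qed

text \<open>Composition with \<open>f\<close>, conjugated by \<open>\<theta>\<close> and
  \<open>\<kappa>\<close>, is a natural family on the cover by the objects \<open>\<Phi> S\<close>,
  hence composition with a morphism of \<open>E'\<close>. Fullness of \<open>\<Phi>\<close> is what
  makes it natural for all maps \<open>\<Phi> T \<rightarrow> \<Phi> S\<close>.\<close>

lemma represents_map:
  assumes rA: "represents A A' \<theta>" and rB: "represents B B' \<kappa>" and f: "src.ar f A B"
  obtains f' where "tgt.ar f' A' B'" "\<And>S x. S \<in> M \<Longrightarrow> src.ar x S A \<Longrightarrow> \<kappa> (f \<star> x) = f' \<bullet> \<theta> x"
proof -
  note A = representsD[OF rA] and B = representsD[OF rB]
  define pre where "pre S y = (SOME x. src.ar x S A \<and> \<theta> x = y)" for S y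
  have pre: "src.ar (pre S y) S A \<and> \<theta> (pre S y) = y" if "S \<in> M" "tgt.ar y (Fo S) A'" for S y
    unfolding pre_def by (rule someI_ex[OF A(5)[OF that]])
  have pre\<theta>: "pre S (\<theta> x) = x" if "S \<in> M" "src.ar x S A" for S x
    using A(4)[OF that(1)] pre[OF that(1) A(3)[OF that]] that(2) by blast
  define \<alpha> where "\<alpha> S y = \<kappa> (f \<star> pre S y)" for S y
  have \<alpha>: "tgt.ar (\<alpha> S y) (Fo S) B'" if "S \<in> M" "tgt.ar y (Fo S) A'" for S y
    unfolding \<alpha>_def using B(3)[OF that(1)] pre[OF that] src.ar_comp[OF _ f] by blast
  have "\<alpha> T (y \<bullet> s) = \<alpha> S y \<bullet> s"
    if S: "S \<in> M" and T: "T \<in> M" and y: "tgt.ar y (Fo S) A'" and s: "tgt.ar s (Fo T) (Fo S)" for S T y s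
  proof -
    obtain t where t: "src.ar t T S" "Fm t = s" using F_full[OF T S s] by metis
    define x where "x = pre S y"
    have x: "src.ar x S A" "\<theta> x = y" using pre[OF S y] unfolding x_def by blast+
    have "pre T (y \<bullet> s) = x \<star> t"
      using pre\<theta>[OF T src.ar_comp[OF t(1) x(1)]] A(6)[OF S T x(1) t(1)] x(2) t(2) by simp
    then have "\<alpha> T (y \<bullet> s) = \<kappa> ((f \<star> x) \<star> t)" unfolding \<alpha>_def using f x(1) t(1) by simp
    also have "\<dots> = \<alpha> S y \<bullet> s"
      using B(6)[OF S T src.ar_comp[OF x(1) f] t(1)] t(2) unfolding \<alpha>_def x_def by simp
    finally show ?thesis .
  qed
  then obtain f' where f': "tgt.ar f' A' B'"
    "\<And>S y. S \<in> M \<Longrightarrow> tgt.ar y (Fo S) A' \<Longrightarrow> \<alpha> S y = f' \<bullet> y"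
    using tgt.cover_full[OF F_cover A(2), where \<alpha> = \<alpha> and B = B'] \<alpha> by metis
  have "\<kappa> (f \<star> x) = f' \<bullet> \<theta> x" if "S \<in> M" "src.ar x S A" for S x
    using f'(2)[OF that(1) A(3)[OF that]] pre\<theta>[OF that] unfolding \<alpha>_def by simp
  then show ?thesis using that f'(1) by blast
qed

lemma represents_map_back:
  assumes rA: "represents A A' \<theta>" and rB: "represents B B' \<kappa>" and f: "tgt.ar f' A' B'"
  obtains f where "src.ar f A B" "\<And>S x. S \<in> M \<Longrightarrow> src.ar x S A \<Longrightarrow> \<kappa> (f \<star> x) = f' \<bullet> \<theta> x"
proof -
  note A = representsD[OF rA] and B = representsD[OF rB]
  define \<alpha> where "\<alpha> S x = (SOME z. src.ar z S B \<and> \<kappa> z = f' \<bullet> \<theta> x)" for S x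
  have \<alpha>: "src.ar (\<alpha> S x) S B \<and> \<kappa> (\<alpha> S x) = f' \<bullet> \<theta> x" if "S \<in> M" "src.ar x S A" for S x
    unfolding \<alpha>_def by (rule someI_ex[OF B(5)[OF that(1) tgt.ar_comp[OF A(3)[OF that] f]]])
  have "\<alpha> T (x \<star> s) = \<alpha> S x \<star> s"
    if S: "S \<in> M" and T: "T \<in> M" and x: "src.ar x S A" and s: "src.ar s T S" for S T x s
  proof (rule B(4)[OF T])
    have xs: "src.ar (x \<star> s) T A" using src.ar_comp[OF s x] .
    show "src.ar (\<alpha> T (x \<star> s)) T B" using \<alpha>[OF T xs] by blast
    show "src.ar (\<alpha> S x \<star> s) T B" using src.ar_comp[OF s] \<alpha>[OF S x] by blast
    have "\<kappa> (\<alpha> T (x \<star> s)) = f' \<bullet> (\<theta> x \<bullet> Fm s)" using \<alpha>[OF T xs] A(6)[OF S T x s] by simp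
    also have "\<dots> = (f' \<bullet> \<theta> x) \<bullet> Fm s" using f A(3)[OF S x] F_ar[OF T S s] by simp
    also have "\<dots> = \<kappa> (\<alpha> S x \<star> s)" using \<alpha>[OF S x] B(6)[OF S T _ s] by simp
    finally show "\<kappa> (\<alpha> T (x \<star> s)) = \<kappa> (\<alpha> S x \<star> s)" .
  qed
  then obtain f where g: "src.ar f A B" "\<And>S x. S \<in> M \<Longrightarrow> src.ar x S A \<Longrightarrow> \<alpha> S x = f \<star> x"
    using src.cover_full[OF src_cover A(1), where \<alpha> = \<alpha> and B = B] \<alpha> by metis
  then have "\<kappa> (f \<star> x) = f' \<bullet> \<theta> x" if "S \<in> M" "src.ar x S A" for S x
    using \<alpha>[OF that] that by metis
  then show ?thesis using that g(1) by blast
qed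

lemma represents_map_unique:
  assumes rA: "represents A A' \<theta>" and "tgt.ar f A' B'" "tgt.ar g A' B'"
    and eq: "\<And>S x. S \<in> M \<Longrightarrow> src.ar x S A \<Longrightarrow> f \<bullet> \<theta> x = g \<bullet> \<theta> x"
  shows "f = g"
proof (rule tgt.cover_faithful[OF F_cover])
  show "f \<bullet> y = g \<bullet> y" if "S \<in> M" "tgt.ar y (Fo S) A'" for S y
    using representsD(5)[OF rA that] eq[OF that(1)] by blast
qed (use assms in blast)+

section \<open>Essential surjectivity through the inverse equivalence\<close>

lemma inverse_equivalence: "tilting_equivalence E' d N E M \<Gamma> \<Phi>"
  by unfold_locales (use quasi_inverse_sym[OF qi] pres pres' in blast)+

text \<open>Take \<open>A\<close> representing \<open>B\<close> for \<open>\<Gamma>\<close>. On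
  \<open>N\<close> this gives Hom(\<open>T\<close>, \<open>B\<close>) =
  Hom(\<open>\<Gamma> T\<close>, \<open>A\<close>) = Hom(\<open>\<Phi> (\<Gamma> T)\<close>,
  \<open>A'\<close>) = Hom(\<open>T\<close>, \<open>A'\<close>) naturally, and \<open>N\<close>
  covers \<open>E'\<close>. Quantifying over all \<open>A'\<close> makes the result apply to
  whichever representing object is chosen later.\<close>

lemma represents_ess_surj:
  assumes B: "B \<in> Obj E'"
  obtains A where "A \<in> Obj E" "\<And>A' \<theta>. represents A A' \<theta> \<Longrightarrow> \<exists>e. isomorphism E' B A' e"
proof -
  interpret inv: tilting_equivalence E' d N E M \<Gamma> \<Phi> by (rule inverse_equivalence)
  obtain A \<beta> where rB: "inv.represents B A \<beta>" using inv.ex_represents[OF B] by blast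
  note Bd = inv.representsD[OF rB]
  have "\<exists>e. isomorphism E' B A' e" if rA: "represents A A' \<theta>" for A' \<theta>
  proof -
    note Ad = representsD[OF rA]
    obtain \<epsilon> where \<epsilon>: "\<And>T. T \<in> N \<Longrightarrow> isomorphism (induced_dexact d E' N) (Fo (inv.Fo T)) T (\<epsilon> T)"
      "\<And>S T s. category.ar (induced_dexact d E' N) s S T \<Longrightarrow>
        \<epsilon> T \<bullet> Fm (inv.Fm s) = s \<bullet> \<epsilon> S"
      using quasi_inverse_natural[OF quasi_inverse_sym[OF qi] tgt_ind] unfolding ind_simps by metis
    have \<epsilon>iso: "isomorphism E' (Fo (inv.Fo T)) T (\<epsilon> T)" if "T \<in> N" for T
      using tgt.induced_isomorphism[OF \<epsilon>(1)[OF that] MN(2)] .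
    have "\<forall>T. \<exists>k. T \<in> N \<longrightarrow> isomorphism E' T (Fo (inv.Fo T)) k \<and> k \<bullet> \<epsilon> T = Ident E' (Fo (inv.Fo T)) \<and>
        \<epsilon> T \<bullet> k = Ident E' T"
      using \<epsilon>iso tgt.isomorphism_inverse by metis
    then obtain k where k: "\<And>T. T \<in> N \<Longrightarrow> isomorphism E' T (Fo (inv.Fo T)) (k T)"
      "\<And>T. T \<in> N \<Longrightarrow> k T \<bullet> \<epsilon> T = Ident E' (Fo (inv.Fo T))"
      "\<And>T. T \<in> N \<Longrightarrow> \<epsilon> T \<bullet> k T = Ident E' T" by metis
    have kar: "tgt.ar (k T) T (Fo (inv.Fo T))" "tgt.ar (\<epsilon> T) (Fo (inv.Fo T)) T" if "T \<in> N" for T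
      using k(1)[OF that] \<epsilon>iso[OF that] tgt.isomorphism_iff by blast+
    define \<alpha> where "\<alpha> T x = \<theta> (\<beta> x) \<bullet> k T" for T x
    have \<theta>\<beta>: "tgt.ar (\<theta> (\<beta> x)) (Fo (inv.Fo T)) A'" if "T \<in> N" "tgt.ar x T B" for T x
      using Ad(3)[OF inv.F_obj[OF that(1)] Bd(3)[OF that]] .
    have \<alpha>: "tgt.ar (\<alpha> T x) T A'" if "T \<in> N" "tgt.ar x T B" for T x
      unfolding \<alpha>_def using tgt.ar_comp[OF kar(1)[OF that(1)] \<theta>\<beta>[OF that]] .
    have nat: "\<alpha> S (x \<bullet> s) = \<alpha> T x \<bullet> s"
      if T: "T \<in> N" and S: "S \<in> N" and x: "tgt.ar x T B" and s: "tgt.ar s S T" for S T x s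
    proof -
      have Gs: "src.ar (inv.Fm s) (inv.Fo S) (inv.Fo T)" using inv.F_ar[OF S T s] .
      have FGs: "tgt.ar (Fm (inv.Fm s)) (Fo (inv.Fo S)) (Fo (inv.Fo T))"
        using F_ar[OF inv.F_obj[OF S] inv.F_obj[OF T] Gs] .
      have n: "\<epsilon> T \<bullet> Fm (inv.Fm s) = s \<bullet> \<epsilon> S"
        using \<epsilon>(2) S T s unfolding tgt_ind_ar by blast
      note ars = s FGs kar[OF S] kar[OF T] \<theta>\<beta>[OF T x]
      \<comment> \<open>Naturality of the inverses \<open>k\<close> is derived from that of
        \<open>\<epsilon>\<close>.\<close>
      have "Fm (inv.Fm s) \<bullet> k S = k T \<bullet> (\<epsilon> T \<bullet> (Fm (inv.Fm s) \<bullet> k S))"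
        using tgt.comp_ext[OF k(2)[OF T], of "Fm (inv.Fm s) \<bullet> k S"] ars by simp
      also have "\<epsilon> T \<bullet> (Fm (inv.Fm s) \<bullet> k S) = s \<bullet> (\<epsilon> S \<bullet> k S)"
        by (rule tgt.comp_ext2[OF n]) (use ars in simp_all)
      also have "\<dots> = s" unfolding k(3)[OF S] using s by simp
      finally have ks: "Fm (inv.Fm s) \<bullet> k S = k T \<bullet> s" .
      have "\<theta> (\<beta> (x \<bullet> s)) = \<theta> (\<beta> x) \<bullet> Fm (inv.Fm s)"
        using Bd(6)[OF T S x s] Ad(6)[OF inv.F_obj[OF T] inv.F_obj[OF S] Bd(3)[OF T x] Gs] by simp
      then have "\<alpha> S (x \<bullet> s) = \<theta> (\<beta> x) \<bullet> (Fm (inv.Fm s) \<bullet> k S)"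
        unfolding \<alpha>_def using ars by simp
      also have "\<dots> = \<alpha> T x \<bullet> s" unfolding ks \<alpha>_def using ars by simp
      finally show ?thesis .
    qed
    have cover: "\<And>A. A \<in> Obj E' \<Longrightarrow> \<exists>T\<in>N. \<exists>p. tgt.ar p T A \<and> deflation E' p" using inv.src_cover .
    obtain f where f: "tgt.ar f B A'" "\<And>T x. T \<in> N \<Longrightarrow> tgt.ar x T B \<Longrightarrow> \<alpha> T x = f \<bullet> x"
      using tgt.cover_full[where I = N and ob = "\<lambda>T. T", OF cover B, where \<alpha> = \<alpha> and B = A'] \<alpha> nat
        by metis
    have "isomorphism E' B A' f"
    proof (rule tgt.cover_isomorphism[where I = N and ob = "\<lambda>T. T", OF cover f(1)])
      fix T x y assume T: "T \<in> N" and x: "tgt.ar x T B" and y: "tgt.ar y T B" and e: "f \<bullet> x = f \<bullet> y"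
      have "\<theta> (\<beta> x) \<bullet> k T = \<theta> (\<beta> y) \<bullet> k T"
        using f(2)[OF T x] f(2)[OF T y] e unfolding \<alpha>_def by simp
      then have "\<theta> (\<beta> x) = \<theta> (\<beta> y)"
        using tgt.isomorphism_epi[OF k(1)[OF T] \<theta>\<beta>[OF T x] \<theta>\<beta>[OF T y]] by blast
      then have "\<beta> x = \<beta> y" using Ad(4)[OF inv.F_obj[OF T] Bd(3)[OF T x] Bd(3)[OF T y]] by blast
      then show "x = y" using Bd(4)[OF T x y] by blast
    next
      fix T y assume T: "T \<in> N" and y: "tgt.ar y T A'"
      have "tgt.ar (y \<bullet> \<epsilon> T) (Fo (inv.Fo T)) A'" using tgt.ar_comp[OF kar(2)[OF T] y] .
      then obtain z where z: "src.ar z (inv.Fo T) A" "\<theta> z = y \<bullet> \<epsilon> T" using Ad(5)[OF inv.F_obj[OF T]]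
        by blast
      obtain x where x: "tgt.ar x T B" "\<beta> x = z" using Bd(5)[OF T z(1)] by blast
      have "f \<bullet> x = (y \<bullet> \<epsilon> T) \<bullet> k T" using f(2)[OF T x(1)] x(2) z(2) unfolding \<alpha>_def by simp
      also have "\<dots> = y \<bullet> (\<epsilon> T \<bullet> k T)" using y kar[OF T] by simp
      also have "\<dots> = y" unfolding k(3)[OF T] using y by simp
      finally show "\<exists>x. tgt.ar x T B \<and> f \<bullet> x = y" using x(1) by blast
    qed
    then show ?thesis by blast
  qed
  then show ?thesis using that Bd(2) by blast
qed

section \<open>The extended functor\<close>

text \<open>Choosing \<open>\<Phi>\<close> itself on \<open>M\<close> makes the extension agree with \<open>\<Phi>\<close> strictly.\<close>

definition choice :: "'o \<Rightarrow> 'p \<times> ('m \<Rightarrow> 'n)" where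
  "choice A = (if A \<in> M then (Fo A, Fm) else (SOME z. represents A (fst z) (snd z)))"

definition Po :: "'o \<Rightarrow> 'p" where "Po A = fst (choice A)"

definition \<theta> :: "'o \<Rightarrow> 'm \<Rightarrow> 'n" where "\<theta> A = snd (choice A)"

lemma choice_represents:
  assumes "A \<in> Obj E"
  shows "represents A (Po A) (\<theta> A)"
proof (cases "A \<in> M")
  case True
  then show ?thesis using represents_self unfolding Po_def \<theta>_def choice_def by simp
next
  case False
  have "\<exists>z. represents A (fst z) (snd z)" using ex_represents[OF assms] by simp
  then have "represents A (fst (SOME z. represents A (fst z) (snd z))) (snd (SOME z. represents A
    (fst z) (snd z)))"
    by (rule someI_ex)
  then show ?thesis using False unfolding Po_def \<theta>_def choice_def by simp
qed

text \<open>\<open>f'\<close> is the morphism corresponding to \<open>f\<close> under the chosen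
  representations. It is unique, so the choice in \<open>\<Psi>\<close> is harmless and
  functoriality is a matter of uniqueness.\<close>

definition lifts :: "'m \<Rightarrow> 'n \<Rightarrow> bool" where
  "lifts f f' \<longleftrightarrow> tgt.ar f' (Po (src.dom f)) (Po (src.cod f)) \<and>
     (\<forall>S\<in>M. \<forall>x. src.ar x S (src.dom f) \<longrightarrow> \<theta> (src.cod f) (f \<star> x) = f' \<bullet> \<theta> (src.dom f) x)"

definition \<Psi> :: "('o, 'm, 'p, 'n) func" where
  "\<Psi> = \<lparr>on_obj = Po, on_mor = (\<lambda>f. SOME f'. lifts f f')\<rparr>"

lemma lifts_iff:
  assumes "src.ar f A B"
  shows "lifts f f' \<longleftrightarrow> tgt.ar f' (Po A) (Po B) \<and>
    (\<forall>S\<in>M. \<forall>x. src.ar x S A \<longrightarrow> \<theta> B (f \<star> x) = f' \<bullet> \<theta> A x)"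
proof -
  have "src.dom f = A" "src.cod f = B" using src.ar_dom_cod[OF assms] by blast+
  then show ?thesis unfolding lifts_def by (simp del: src.ar_iff tgt.ar_iff)
qed

lemma \<Psi>_lifts:
  assumes "src.ar f A B"
  shows "lifts f (on_mor \<Psi> f)"
proof -
  have "\<exists>f'. lifts f f'"
    using represents_map[OF choice_represents choice_represents assms] src.ar_Obj[OF assms]
    unfolding lifts_iff[OF assms] by metis
  then show ?thesis unfolding \<Psi>_def by (simp add: someI_ex)
qed

lemma \<Psi>_ar: "src.ar f A B \<Longrightarrow> tgt.ar (on_mor \<Psi> f) (Po A) (Po B)"
  using \<Psi>_lifts lifts_iff by blast

lemma \<Psi>_comp_\<theta>: "src.ar f A B \<Longrightarrow> S \<in> M \<Longrightarrow> src.ar x S A \<Longrightarrow> on_mor \<Psi> f \<bullet> \<theta> A x = \<theta> B (f \<star> x)"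
  using \<Psi>_lifts lifts_iff by metis

lemma \<Psi>_unique:
  assumes f: "src.ar f A B" and "tgt.ar f' (Po A) (Po B)"
    and "\<And>S x. S \<in> M \<Longrightarrow> src.ar x S A \<Longrightarrow> \<theta> B (f \<star> x) = f' \<bullet> \<theta> A x"
  shows "on_mor \<Psi> f = f'"
proof (rule represents_map_unique[OF choice_represents \<Psi>_ar[OF f] assms(2)])
  show "A \<in> Obj E" using src.ar_Obj[OF f] by blast
  show "on_mor \<Psi> f \<bullet> \<theta> A x = f' \<bullet> \<theta> A x" if "S \<in> M" "src.ar x S A" for S x
    using \<Psi>_comp_\<theta>[OF f that] assms(3)[OF that] by simp
qed

lemma \<theta>_ar: "A \<in> Obj E \<Longrightarrow> S \<in> M \<Longrightarrow> src.ar x S A \<Longrightarrow> tgt.ar (\<theta> A x) (Fo S) (Po A)"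
  using representsD(3)[OF choice_represents] .

lemma Po_Obj: "A \<in> Obj E \<Longrightarrow> Po A \<in> Obj E'"
  using representsD(2)[OF choice_represents] .

lemma \<Psi>_functor: "additive_functor E E' \<Psi>"
  unfolding additive_functor_def
proof (intro conjI ballI)
  fix A assume A: "A \<in> Obj E"
  show "on_obj \<Psi> A \<in> Obj E'" unfolding \<Psi>_def using Po_Obj[OF A] by simp
  have "on_mor \<Psi> (Ident E A) = Ident E' (Po A)"
  proof (rule \<Psi>_unique)
    show "\<theta> A (Ident E A \<star> x) = Ident E' (Po A) \<bullet> \<theta> A x" if "S \<in> M" "src.ar x S A" for S x
      using \<theta>_ar[OF A that] that by simp
  qed (use A Po_Obj[OF A] in simp_all)
  then show "on_mor \<Psi> (Ident E A) = Ident E' (on_obj \<Psi> A)" unfolding \<Psi>_def by simp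
next
  fix A B f assume "A \<in> Obj E" "B \<in> Obj E" "f \<in> Hom E A B"
  then have "src.ar f A B" unfolding src.ar_def by blast
  then have "on_mor \<Psi> f \<in> Hom E' (Po A) (Po B)" using \<Psi>_ar unfolding tgt.ar_def by blast
  then show "on_mor \<Psi> f \<in> Hom E' (on_obj \<Psi> A) (on_obj \<Psi> B)" unfolding \<Psi>_def by simp
next
  fix A B G f g assume AB: "A \<in> Obj E" "B \<in> Obj E" "G \<in> Obj E" and "f \<in> Hom E A B" "g \<in> Hom E B G"
  then have f: "src.ar f A B" and g: "src.ar g B G" unfolding src.ar_def by blast+
  show "on_mor \<Psi> (g \<star> f) = on_mor \<Psi> g \<bullet> on_mor \<Psi> f"
  proof (rule \<Psi>_unique[OF src.ar_comp[OF f g] tgt.ar_comp[OF \<Psi>_ar[OF f] \<Psi>_ar[OF g]]])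
    fix S x assume S: "S \<in> M" and x: "src.ar x S A"
    have "\<theta> G ((g \<star> f) \<star> x) = on_mor \<Psi> g \<bullet> (on_mor \<Psi> f \<bullet> \<theta> A x)"
      unfolding \<Psi>_comp_\<theta>[OF f S x] \<Psi>_comp_\<theta>[OF g S src.ar_comp[OF x f]] using f g x by simp
    then show "\<theta> G ((g \<star> f) \<star> x) = (on_mor \<Psi> g \<bullet> on_mor \<Psi> f) \<bullet> \<theta> A x"
      using \<Psi>_ar[OF f] \<Psi>_ar[OF g] \<theta>_ar[OF AB(1) S x] by simp
  qed
next
  fix A B f g assume AB: "A \<in> Obj E" "B \<in> Obj E" and "f \<in> Hom E A B" "g \<in> Hom E A B"
  then have f: "src.ar f A B" and g: "src.ar g A B" unfolding src.ar_def by blast+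
  have fg: "src.ar (Add E f g) A B" using f g by simp
  have fg': "tgt.ar (Add E' (on_mor \<Psi> f) (on_mor \<Psi> g)) (Po A) (Po B)"
    using \<Psi>_ar[OF f] \<Psi>_ar[OF g] by simp
  show "on_mor \<Psi> (Add E f g) = Add E' (on_mor \<Psi> f) (on_mor \<Psi> g)"
  proof (rule \<Psi>_unique[OF fg fg'])
    fix S x assume S: "S \<in> M" and x: "src.ar x S A"
    have "\<theta> B (Add E f g \<star> x) = \<theta> B (Add E (f \<star> x) (g \<star> x))" using f g x by simp
    also have "\<dots> = Add E' (on_mor \<Psi> f \<bullet> \<theta> A x) (on_mor \<Psi> g \<bullet> \<theta> A x)"
      unfolding \<Psi>_comp_\<theta>[OF f S x] \<Psi>_comp_\<theta>[OF g S x]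
      by (rule representsD(7)[OF choice_represents[OF AB(2)] S src.ar_comp[OF x f] src.ar_comp[OF x g]])
    also have "\<dots> = Add E' (on_mor \<Psi> f) (on_mor \<Psi> g) \<bullet> \<theta> A x"
      using \<Psi>_ar[OF f] \<Psi>_ar[OF g] \<theta>_ar[OF AB(1) S x] by simp
    finally show "\<theta> B (Add E f g \<star> x) = Add E' (on_mor \<Psi> f) (on_mor \<Psi> g) \<bullet> \<theta> A x" .
  qed
qed

lemma \<Psi>_equivalence: "equivalence_of_categories E E' \<Psi>"
proof (rule fully_faithful_equivalence[OF \<Psi>_functor])
  show "preadditive_category E" "preadditive_category E'"
    by (rule src.preadditive_category_axioms tgt.preadditive_category_axioms)+
  fix A B f g assume f: "src.ar f A B" and g: "src.ar g A B" and e: "on_mor \<Psi> f = on_mor \<Psi> g"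
  have B: "B \<in> Obj E" using src.ar_Obj[OF f] by blast
  show "f = g"
  proof (rule src.cover_faithful[where ob = "\<lambda>S. S", OF src_cover f g])
    fix S x assume S: "S \<in> M" and x: "src.ar x S A"
    show "f \<star> x = g \<star> x"
      using representsD(4)[OF choice_represents[OF B] S src.ar_comp[OF x f] src.ar_comp[OF x g]]
        \<Psi>_comp_\<theta>[OF f S x] \<Psi>_comp_\<theta>[OF g S x] e by simp
  qed
next
  fix A B h assume A: "A \<in> Obj E" and B: "B \<in> Obj E" and "tgt.ar h (on_obj \<Psi> A) (on_obj \<Psi> B)"
  then have h: "tgt.ar h (Po A) (Po B)" unfolding \<Psi>_def by simp
  obtain f where f: "src.ar f A B"
    "\<And>S x. S \<in> M \<Longrightarrow> src.ar x S A \<Longrightarrow> \<theta> B (f \<star> x) = h \<bullet> \<theta> A x"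
    using represents_map_back[OF choice_represents[OF A] choice_represents[OF B] h] by metis
  show "\<exists>f. src.ar f A B \<and> on_mor \<Psi> f = h" using f(1) \<Psi>_unique[OF f(1) h] f(2) by blast
next
  fix B assume B: "B \<in> Obj E'"
  obtain A where A: "A \<in> Obj E" "\<And>A' \<theta>. represents A A' \<theta> \<Longrightarrow> \<exists>e. isomorphism E' B A' e"
    using represents_ess_surj[OF B] by blast
  obtain e where "isomorphism E' B (Po A) e" using A(2)[OF choice_represents[OF A(1)]] by blast
  then have "\<exists>e. isomorphism E' (Po A) B e" using tgt.isomorphism_inverse by metis
  then show "\<exists>A e. A \<in> Obj E \<and> isomorphism E' (on_obj \<Psi> A) B e" using A(1) unfolding \<Psi>_def by auto
qed

text \<open>For a cover \<open>q\<close> of \<open>B\<close>, the image of \<open>p\<close> composed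
  with \<open>\<theta> B q\<close> is \<open>\<theta> D (p \<star> q)\<close>, a deflation, so the
  image of \<open>p\<close> is one by cancellation. Its kernel is compared with \<open>Po A\<close>
  on maps from the objects \<open>\<Phi> T\<close>, where both correspond to the maps
  \<open>T \<rightarrow> B\<close> killed by \<open>p\<close>.\<close>

lemma \<Psi>_conf:
  assumes c: "src.conf A B D i p"
  shows "tgt.conf (Po A) (Po B) (Po D) (on_mor \<Psi> i) (on_mor \<Psi> p)"
proof -
  have i: "src.ar i A B" and p: "src.ar p B D" and Obj: "A \<in> Obj E" "B \<in> Obj E" "D \<in> Obj E"
    using src.conf_ar[OF c] src.conf_Obj[OF c] by blast+
  note rA = choice_represents[OF Obj(1)] and rB = choice_represents[OF Obj(2)]
    and rD = choice_represents[OF Obj(3)]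
  have \<Psi>i: "tgt.ar (on_mor \<Psi> i) (Po A) (Po B)" and \<Psi>p: "tgt.ar (on_mor \<Psi> p) (Po B) (Po D)"
    using \<Psi>_ar i p by blast+
  obtain S q where S: "S \<in> M" "src.ar q S B" "deflation E q" using src_cover[OF Obj(2)] by blast
  have "deflation E' (\<theta> D (p \<star> q))"
    using represents_deflation[OF rD S(1) src.ar_comp[OF S(2) p]
        src.deflation_comp[OF S(2) p S(3) src.conf_deflation[OF c]]] .
  then have "deflation E' (on_mor \<Psi> p \<bullet> \<theta> B q)" unfolding \<Psi>_comp_\<theta>[OF p S(1,2)] .
  then have "deflation E' (on_mor \<Psi> p)"
    using tgt.deflation_cancel[OF tgt.wic \<theta>_ar[OF Obj(2) S(1,2)] \<Psi>p] by blast
  then obtain K k where k: "tgt.conf K (Po B) (Po D) k (on_mor \<Psi> p)"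
    using tgt.deflation_conf \<Psi>p by metis
  have kar: "tgt.ar k K (Po B)" and KO: "K \<in> Obj E'" using tgt.conf_ar[OF k] tgt.conf_Obj[OF k] by
    blast+
  have "on_mor \<Psi> p \<bullet> on_mor \<Psi> i = on_mor \<Psi> (p \<star> i)"
    using additive_functorD(4)[OF \<Psi>_functor src.category_axioms tgt.category_axioms i p] by simp
  also have "\<dots> = Zero E' (Po A) (Po D)"
  proof (rule \<Psi>_unique[OF src.ar_comp[OF i p]])
    show "tgt.ar (Zero E' (Po A) (Po D)) (Po A) (Po D)" using Po_Obj Obj by simp
    fix T x assume T: "T \<in> M" "src.ar x T A"
    have TO: "T \<in> Obj E" using T MN by blast
    have "(p \<star> i) \<star> x = Zero E T D" unfolding src.conf_comp[OF c] using T TO Obj by simp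
    then show "\<theta> D ((p \<star> i) \<star> x) = Zero E' (Po A) (Po D) \<bullet> \<theta> A x"
      using represents_Zero[OF rD T(1)] \<theta>_ar[OF Obj(1) T] Po_Obj Obj by simp
  qed
  finally obtain u where u: "tgt.ar u (Po A) K" "k \<bullet> u = on_mor \<Psi> i"
    using tgt.conf_lift[OF k \<Psi>i] by blast
  have ku: "k \<bullet> (u \<bullet> \<theta> A z) = \<theta> B (i \<star> z)" if "T \<in> M" "src.ar z T A" for T z
    using tgt.comp_ext[OF u(2), of "\<theta> A z"] \<Psi>_comp_\<theta>[OF i that] \<theta>_ar[OF Obj(1) that] u(1) kar by simp
  have uiso: "isomorphism E' (Po A) K u"
  proof (rule tgt.cover_isomorphism[OF F_cover u(1)])
    fix T x y assume T: "T \<in> M" and x: "tgt.ar x (Fo T) (Po A)" and y: "tgt.ar y (Fo T) (Po A)"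
      and e: "u \<bullet> x = u \<bullet> y"
    obtain z where z: "src.ar z T A" "\<theta> A z = x" using representsD(5)[OF rA T x] by blast
    obtain w where w: "src.ar w T A" "\<theta> A w = y" using representsD(5)[OF rA T y] by blast
    have "\<theta> B (i \<star> z) = \<theta> B (i \<star> w)" using ku[OF T z(1)] ku[OF T w(1)] z(2) w(2) e by simp
    then have "i \<star> z = i \<star> w"
      using representsD(4)[OF rB T src.ar_comp[OF z(1) i] src.ar_comp[OF w(1) i]] by blast
    then have "z = w" using src.conf_mono[OF c z(1) w(1)] by blast
    then show "x = y" using z(2) w(2) by simp
  next
    fix T y assume T: "T \<in> M" and y: "tgt.ar y (Fo T) K"
    have TO: "T \<in> Obj E" "Fo T \<in> Obj E'" using T MN F_Obj by blast+
    obtain x where x: "src.ar x T B" "\<theta> B x = k \<bullet> y"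
      using representsD(5)[OF rB T tgt.ar_comp[OF y kar]] by blast
    have "\<theta> D (p \<star> x) = on_mor \<Psi> p \<bullet> (k \<bullet> y)" using \<Psi>_comp_\<theta>[OF p T x(1)] x(2) by simp
    also have "\<dots> = Zero E' (Fo T) (Po D)"
      using tgt.comp_ext[OF tgt.conf_comp[OF k], of y] y kar \<Psi>p TO Po_Obj Obj by simp
    also have "\<dots> = \<theta> D (Zero E T D)" using represents_Zero[OF rD T] by simp
    finally have "p \<star> x = Zero E T D"
      by (rule representsD(4)[OF rD T src.ar_comp[OF x(1) p], rotated]) (use TO Obj in simp)
    then obtain z where z: "src.ar z T A" "i \<star> z = x" using src.conf_lift[OF c x(1)] by blast
    have "u \<bullet> \<theta> A z = y"
      by (rule tgt.conf_mono[OF k tgt.ar_comp[OF \<theta>_ar[OF Obj(1) T z(1)] u(1)] y])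
        (use ku[OF T z(1)] z(2) x(2) in simp)
    then show "\<exists>x. tgt.ar x (Fo T) (Po A) \<and> u \<bullet> x = y" using \<theta>_ar[OF Obj(1) T z(1)] by blast
  qed
  obtain v where v: "isomorphism E' K (Po A) v" "v \<bullet> u = Ident E' (Po A)" "u \<bullet> v = Ident E' K"
    "tgt.ar v K (Po A)" using tgt.isomorphism_inverse[OF uiso] by metis
  \<comment> \<open>The inverse \<open>v\<close> of \<open>u\<close> identifies the conflation
    \<open>k\<close> with the pair of images, with identities on \<open>Po B\<close> and
    \<open>Po D\<close>.\<close>
  have "on_mor \<Psi> i \<bullet> v = k \<bullet> (u \<bullet> v)" unfolding u(2)[symmetric] using u(1) kar v(4) by simp
  also have "\<dots> = Ident E' (Po B) \<bullet> k" unfolding v(3) using kar by simp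
  finally have e: "Ident E' (Po B) \<bullet> k = on_mor \<Psi> i \<bullet> v" by simp
  show ?thesis
    by (rule tgt.conf_isomorphic[OF k \<Psi>i \<Psi>p v(1) tgt.isomorphism_Ident tgt.isomorphism_Ident e])
      (use Po_Obj Obj \<Psi>p in simp_all)
qed

lemma \<Psi>_exact: "exact_equivalence E E' \<Psi>"
  unfolding exact_equivalence_def
proof (intro conjI \<Psi>_equivalence ballI)
  fix z assume "z \<in> Conf E"
  moreover obtain i p where z: "z = (i, p)" by (cases z)
  ultimately obtain A B D where "src.conf A B D i p" using src.Conf_kernel_cokernel by blast
  then have "(on_mor \<Psi> i, on_mor \<Psi> p) \<in> Conf E'" using \<Psi>_conf unfolding tgt.conf_def by blast
  then show "case z of (i, p) \<Rightarrow> (on_mor \<Psi> i, on_mor \<Psi> p) \<in> Conf E'" unfolding z by simp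
qed

text \<open>On \<open>M\<close> the chosen representations are \<open>\<Phi>\<close> itself, so
  \<open>Fm f\<close> satisfies the equations that determine the image of \<open>f\<close>.\<close>

lemma \<Psi>_extends: "functor_eq (full_subcat E M) (\<Psi> \<circ>\<^sub>F inclusion) (inclusion \<circ>\<^sub>F \<Phi>)"
proof -
  have "on_mor \<Psi> f = Fm f" if A: "A \<in> M" and B: "B \<in> M" and f: "f \<in> Hom E A B" for A B f
  proof -
    have ar: "src.ar f A B" using f A B MN unfolding src.ar_def by blast
    have eq: "Po A = Fo A" "Po B = Fo B" "\<theta> A = Fm" "\<theta> B = Fm"
      using A B unfolding Po_def \<theta>_def choice_def by simp_all
    show ?thesis
      by (rule \<Psi>_unique[OF ar]) (use F_ar[OF A B ar] F_comp[OF _ A B _ ar] eq in \<open>simp_all del: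
        tgt.ar_iff src.ar_iff\<close>)
  qed
  then show ?thesis
    unfolding functor_eq_def full_subcat_def comp_functor_def id_functor_def
    by (simp add: \<Psi>_def Po_def choice_def)
qed

end

theorem corollary6p9:
  fixes d :: nat
    and E :: "('o, 'm) excat" and E' :: "('p, 'n) excat"
    and M :: "'o set" and N :: "'p set"
    and \<Phi> :: "('o, 'm, 'p, 'n) func"
  assumes "d \<ge> 1"
    and "exact_category E" and "weakly_idempotent_complete E"
    and "exact_category E'" and "weakly_idempotent_complete E'"
    and "cluster_tilting d E M" and "cluster_tilting d E' N"
    and "dexact_equivalence (induced_dexact d E M) (induced_dexact d E' N) \<Phi>"
  shows "\<exists>\<Psi> :: ('o, 'm, 'p, 'n) func. exact_equivalence E E' \<Psi> \<and>
           functor_eq (full_subcat E M) (\<Psi> \<circ>\<^sub>F inclusion) (inclusion \<circ>\<^sub>F \<Phi>)"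
proof -
  obtain \<Gamma> where \<Gamma>: "quasi_inverse (induced_dexact d E M) (induced_dexact d E' N) \<Phi> \<Gamma>"
    "preserves_AdmSeq (induced_dexact d E' N) (induced_dexact d E M) \<Gamma>"
    "preserves_AdmSeq (induced_dexact d E M) (induced_dexact d E' N) \<Phi>"
    using assms(8) unfolding dexact_equivalence_def by blast
  interpret tilting_equivalence E d M E' N \<Phi> \<Gamma>
    by (intro tilting_equivalence.intro cluster_tilting_category.intro
      cluster_tilting_category_axioms.intro
        tilting_equivalence_axioms.intro assms \<Gamma>)
  show ?thesis using \<Psi>_exact \<Psi>_extends by blast
qed

end
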